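(* Let $D$ be a domain in $\mathbb{C}^n$ containing the origin $o$. For any ideal $I$ of $\mathcal{O}_o$, the set $T\big(\tilde\ell_I\cap\ell_0^{(n)}\big)$ is dense in $A^2(D,I)^{\perp}$.
   Context: $\mathcal{O}_o$ is the ring of germs at the origin $o\in\mathbb{C}^n$ of holomorphic functions, and $(f,o)$ denotes the germ at $o$ of $f$. $A^2(D)=L^2(D)\cap\mathcal{O}(D)$ is the Bergman space, a Hilbert space with the $L^2$ inner product $\langle\cdot,\cdot\rangle$ (linear in the first variable). $A^2(D,I):=\{f\in A^2(D):(f,o)\in I\}$ is a closed subspace of $A^2(D)$ and $A^2(D,I)^\perp$ is its orthogonal complement in $A^2(D)$. Sequence spaces: $$\ell_1^{(n)}:=\Big\{(\xi_\alpha)_{\alpha\in\mathbb{N}^n}:\ \xi_\alpha\in\mathbb{C},\ \sum_{\alpha\in\mathbb{N}^n}|\xi_\alpha|\rho^{|\alpha|}<+\infty\ \text{for all }\rho>0\Big\},$$ $$\ell_0^{(n)}:=\Big\{(\xi_\alpha)_{\alpha\in\mathbb{N}^n}:\ \xi_\alpha\in\mathbb{C},\ \exists k\in\mathbb{N}\ \text{such that}\ \xi_\alpha=0\ \text{for all }\alpha\text{ with }|\alpha|>k\Big\}\subseteq\ell_1^{(n)},$$ where $\mathbb{N}$ contains $0$ and $|\alpha|=\alpha_1+\cdots+\alpha_n$. For $\xi=(\xi_\alpha)\in\ell_1^{(n)}$ and a holomorphic germ $f=\sum_\alpha c_\alpha z^\alpha$ at $o$, put $(\xi\cdot f)(o):=\sum_\alpha\xi_\alpha\frac{(D^\alpha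 f)(o)}{\alpha!}=\sum_\alpha\xi_\alpha c_\alpha$. $\tilde\ell_I:=\{\xi\in\ell_1^{(n)}:(\xi\cdot f)(o)=0\ \text{for all }(f,o)\in I\}$. For $\xi\in\ell_1^{(n)}$ the functional $A^2(D)\to\mathbb{C}$, $f\mapsto(\xi\cdot f)(o)$, is linear and continuous, and $T(\xi)\in A^2(D)$ denotes its Riesz representative: $\langle f,T(\xi)\rangle=(\xi\cdot f)(o)$ for all $f\in A^2(D)$. *)

theory Defs
  imports "HOL-Analysis.Analysis" "HOL-Algebra.QuotRing"
begin

text \<open>Used for open \<open>U\<close> only: the real Frechet derivative exists and is complex-linear.\<close>

definition mv_holomorphic_on :: "(complex^'n \<Rightarrow> complex) \<Rightarrow> (complex^'n) set \<Rightarrow> bool"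
    (infixl "mv'_holomorphic'_on" 50) where
  "f mv_holomorphic_on U \<longleftrightarrow>
     (\<forall>z\<in>U. \<exists>L. Vector_Spaces.linear (*s) (*) L \<and> (f has_derivative L) (at z within U))"

definition holomorphic_near_0 :: "(complex^'n \<Rightarrow> complex) \<Rightarrow> bool" where
  "holomorphic_near_0 f \<longleftrightarrow> (\<exists>U. open U \<and> 0 \<in> U \<and> f mv_holomorphic_on U)"

text \<open>Germs are cosets: functions holomorphic near the origin, modulo those that vanish near
  the origin.\<close>

definition hol0_ring :: "(complex^'n \<Rightarrow> complex) ring" where
  "hol0_ring = \<lparr>carrier = {f. holomorphic_near_0 f},
     monoid.mult = (\<lambda>f g z. f z * g z), one = (\<lambda>z. 1),
     zero = (\<lambda>z. 0), add = (\<lambda>f g z. f z + g z)\<rparr>"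

definition null0 :: "(complex^'n \<Rightarrow> complex) set" where
  "null0 = {f. \<forall>\<^sub>F z in nhds 0. f z = 0}"

definition germ_ring :: "(complex^'n \<Rightarrow> complex) set ring" where
  "germ_ring = hol0_ring Quot null0"

definition germ :: "(complex^'n \<Rightarrow> complex) \<Rightarrow> (complex^'n \<Rightarrow> complex) set" where
  "germ f = null0 +>\<^bsub>hol0_ring\<^esub> f"

lemma mv_holomorphic_on_subset:
  "f mv_holomorphic_on U \<Longrightarrow> V \<subseteq> U \<Longrightarrow> f mv_holomorphic_on V"
  unfolding mv_holomorphic_on_def by (meson has_derivative_subset subsetD)

lemma mv_holomorphic_on_const: "(\<lambda>z. c) mv_holomorphic_on U"
proof -
  have "Vector_Spaces.linear (*s) (*) (\<lambda>z::complex^'n. 0::complex)"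
    by unfold_locales (auto simp: algebra_simps)
  then show ?thesis
    unfolding mv_holomorphic_on_def using has_derivative_const by blast
qed

lemma mv_holomorphic_on_add:
  assumes "f mv_holomorphic_on U" "g mv_holomorphic_on U"
  shows "(\<lambda>z. f z + g z) mv_holomorphic_on U"
  unfolding mv_holomorphic_on_def
proof
  fix z assume "z \<in> U"
  then obtain L M where LM: "Vector_Spaces.linear (*s) (*) L" "(f has_derivative L) (at z within U)"
    "Vector_Spaces.linear (*s) (*) M" "(g has_derivative M) (at z within U)"
    using assms unfolding mv_holomorphic_on_def by blast
  have "Vector_Spaces.linear (*s) (*) (\<lambda>h. L h + M h)"
    using LM(1,3) unfolding Vector_Spaces.linear_iff by (simp add: algebra_simps)
  with has_derivative_add[OF LM(2,4)]
  show "\<exists>L. Vector_Spaces.linear (*s) (*) L \<and>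
      ((\<lambda>z. f z + g z) has_derivative L) (at z within U)" by blast
qed

lemma mv_holomorphic_on_mult:
  assumes "f mv_holomorphic_on U" "g mv_holomorphic_on U"
  shows "(\<lambda>z. f z * g z) mv_holomorphic_on U"
  unfolding mv_holomorphic_on_def
proof
  fix z assume "z \<in> U"
  then obtain L M where LM: "Vector_Spaces.linear (*s) (*) L" "(f has_derivative L) (at z within U)"
    "Vector_Spaces.linear (*s) (*) M" "(g has_derivative M) (at z within U)"
    using assms unfolding mv_holomorphic_on_def by blast
  have "Vector_Spaces.linear (*s) (*) (\<lambda>h. f z * M h + L h * g z)"
    using LM(1,3) unfolding Vector_Spaces.linear_iff by (simp add: algebra_simps)
  with has_derivative_mult[OF LM(2,4)]
  show "\<exists>L. Vector_Spaces.linear (*s) (*) L \<and>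
      ((\<lambda>z. f z * g z) has_derivative L) (at z within U)" by blast
qed

lemma holomorphic_near_0_const: "holomorphic_near_0 (\<lambda>z. c)"
  unfolding holomorphic_near_0_def using mv_holomorphic_on_const open_UNIV by blast

lemma holomorphic_near_0_common:
  assumes "holomorphic_near_0 f" "holomorphic_near_0 g"
  obtains U where "open U" "0 \<in> U" "f mv_holomorphic_on U" "g mv_holomorphic_on U"
proof -
  obtain U V where "open U" "0 \<in> U" "f mv_holomorphic_on U"
    "open V" "0 \<in> V" "g mv_holomorphic_on V"
    using assms unfolding holomorphic_near_0_def by blast
  then show ?thesis
    using that[of "U \<inter> V"] mv_holomorphic_on_subset by (metis IntI inf_le1 inf_le2 open_Int)
qed

lemma holomorphic_near_0_add:
  "holomorphic_near_0 f \<Longrightarrow> holomorphic_near_0 g \<Longrightarrow> holomorphic_near_0 (\<lambda>z. f z + g z)"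
  by (metis holomorphic_near_0_common holomorphic_near_0_def mv_holomorphic_on_add)

lemma holomorphic_near_0_mult:
  "holomorphic_near_0 f \<Longrightarrow> holomorphic_near_0 g \<Longrightarrow> holomorphic_near_0 (\<lambda>z. f z * g z)"
  by (metis holomorphic_near_0_common holomorphic_near_0_def mv_holomorphic_on_mult)

lemma holomorphic_near_0_uminus: "holomorphic_near_0 f \<Longrightarrow> holomorphic_near_0 (\<lambda>z. - f z)"
  using holomorphic_near_0_mult[OF holomorphic_near_0_const[of "-1"]] by simp

lemma null0_imp_holomorphic_near_0:
  fixes f :: "complex^'n \<Rightarrow> complex"
  assumes "f \<in> null0" shows "holomorphic_near_0 f"
proof -
  obtain U where U: "open U" "0 \<in> U" "\<And>z. z \<in> U \<Longrightarrow> f z = 0"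
    using assms unfolding null0_def eventually_nhds by auto
  have "f mv_holomorphic_on U"
    using mv_holomorphic_on_const[of 0 U] U(3) unfolding mv_holomorphic_on_def
    by (metis has_derivative_transform)
  with U show ?thesis unfolding holomorphic_near_0_def by blast
qed

lemma cring_hol0_ring: "cring (hol0_ring :: (complex^'n \<Rightarrow> complex) ring)"
proof (rule cringI)
  show "abelian_group (hol0_ring :: (complex^'n \<Rightarrow> complex) ring)"
  proof (rule abelian_groupI)
    fix f :: "complex^'n \<Rightarrow> complex" assume "f \<in> carrier hol0_ring"
    then show "\<exists>g\<in>carrier hol0_ring. g \<oplus>\<^bsub>hol0_ring\<^esub> f = \<zero>\<^bsub>hol0_ring\<^esub>"
      by (intro bexI[of _ "\<lambda>z. - f z"]) (auto simp: hol0_ring_def holomorphic_near_0_uminus)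
  qed (auto simp: hol0_ring_def holomorphic_near_0_add holomorphic_near_0_const algebra_simps)
  show "Group.comm_monoid (hol0_ring :: (complex^'n \<Rightarrow> complex) ring)"
    by (rule comm_monoidI)
      (auto simp: hol0_ring_def holomorphic_near_0_mult holomorphic_near_0_const algebra_simps)
qed (auto simp: hol0_ring_def algebra_simps)

lemma a_inv_hol0_ring:
  fixes f :: "complex^'n \<Rightarrow> complex"
  assumes "holomorphic_near_0 f" shows "\<ominus>\<^bsub>hol0_ring\<^esub> f = (\<lambda>z. - f z)"
proof -
  interpret cring "hol0_ring :: (complex^'n \<Rightarrow> complex) ring" by (rule cring_hol0_ring)
  show ?thesis
    by (rule sym, rule sum_zero_eq_neg)
      (auto simp: hol0_ring_def assms holomorphic_near_0_uminus)
qed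

lemma ideal_null0: "ideal null0 (hol0_ring :: (complex^'n \<Rightarrow> complex) ring)"
proof -
  interpret cring "hol0_ring :: (complex^'n \<Rightarrow> complex) ring" by (rule cring_hol0_ring)
  have *: "subgroup null0 (add_monoid (hol0_ring :: (complex^'n \<Rightarrow> complex) ring))"
  proof (rule group.subgroupI)
    show "Group.group (add_monoid (hol0_ring :: (complex^'n \<Rightarrow> complex) ring))"
      by (rule a_group)
    show "null0 \<subseteq> carrier (add_monoid (hol0_ring :: (complex^'n \<Rightarrow> complex) ring))"
      by (auto simp: hol0_ring_def null0_imp_holomorphic_near_0)
    show "null0 \<noteq> ({} :: (complex^'n \<Rightarrow> complex) set)"
      unfolding null0_def by (auto intro!: exI[of _ "\<lambda>_. 0"])
  next
    fix f :: "complex^'n \<Rightarrow> complex" assume f: "f \<in> null0"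
    have "inv\<^bsub>add_monoid hol0_ring\<^esub> f = (\<lambda>z. - f z)"
      using a_inv_hol0_ring[OF null0_imp_holomorphic_near_0[OF f]] by (simp add: a_inv_def)
    then show "inv\<^bsub>add_monoid hol0_ring\<^esub> f \<in> null0"
      using f by (simp add: null0_def)
  next
    fix f g :: "complex^'n \<Rightarrow> complex" assume "f \<in> null0" "g \<in> null0"
    then show "f \<otimes>\<^bsub>add_monoid hol0_ring\<^esub> g \<in> null0"
      by (auto simp: null0_def hol0_ring_def elim: eventually_elim2)
  qed
  show ?thesis
    by (rule idealI[OF ring_axioms *])
      (auto simp: null0_def hol0_ring_def elim: eventually_mono)
qed

lemma cring_germ_ring: "cring germ_ring"
  unfolding germ_ring_def using ideal.quotient_is_cring[OF ideal_null0 cring_hol0_ring] .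

lemma carrier_germ_ring: "carrier germ_ring = germ ` {f. holomorphic_near_0 f}"
  by (auto simp: germ_ring_def FactRing_def A_RCOSETS_def' germ_def hol0_ring_def)

lemma germ_eq_Collect:
  "germ f = {g. \<forall>\<^sub>F z in nhds 0. g z = f z}"
proof -
  have "\<exists>h\<in>null0. g = (\<lambda>z. h z + f z)" if "\<forall>\<^sub>F z in nhds 0. g z = f z" for g
    using that by (intro bexI[of _ "\<lambda>z. g z - f z"]) (auto simp: null0_def)
  then show ?thesis
    by (auto simp: germ_def a_r_coset_def' hol0_ring_def null0_def)
qed

definition cpartial :: "'n \<Rightarrow> (complex^'n \<Rightarrow> complex) \<Rightarrow> complex^'n \<Rightarrow> complex" where
  "cpartial i f z = deriv (\<lambda>w. f (z + axis i w)) 0"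

text \<open>Iterated partial derivatives are taken in the order of a fixed but arbitrary enumeration of
  the coordinates; for holomorphic functions the order is immaterial.\<close>

definition coords :: "'n::finite list" where
  "coords = (SOME is. distinct is \<and> set is = UNIV)"

definition multi_deriv ::
    "('n \<Rightarrow> nat) \<Rightarrow> (complex^'n \<Rightarrow> complex) \<Rightarrow> complex^'n \<Rightarrow> complex" where
  "multi_deriv \<alpha> f = foldr (\<lambda>i. cpartial i ^^ \<alpha> i) coords f"

definition mi_size :: "('n::finite \<Rightarrow> nat) \<Rightarrow> nat" where
  "mi_size \<alpha> = (\<Sum>i\<in>UNIV. \<alpha> i)"

definition mi_fact :: "('n::finite \<Rightarrow> nat) \<Rightarrow> nat" where
  "mi_fact \<alpha> = (\<Prod>i\<in>UNIV. fact (\<alpha> i))"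

definition ell1 :: "(('n::finite \<Rightarrow> nat) \<Rightarrow> complex) set" where
  "ell1 = {\<xi>. \<forall>\<rho>>0. (\<lambda>\<alpha>. cmod (\<xi> \<alpha>) * \<rho> ^ mi_size \<alpha>) summable_on UNIV}"

definition ell0 :: "(('n::finite \<Rightarrow> nat) \<Rightarrow> complex) set" where
  "ell0 = {\<xi>. \<exists>k. \<forall>\<alpha>. mi_size \<alpha> > k \<longrightarrow> \<xi> \<alpha> = 0}"

definition pairing0 :: "(('n \<Rightarrow> nat) \<Rightarrow> complex) \<Rightarrow> (complex^'n \<Rightarrow> complex) \<Rightarrow> complex" where
  "pairing0 \<xi> f = (\<Sum>\<^sub>\<infinity>\<alpha>. \<xi> \<alpha> * (multi_deriv \<alpha> f 0 / of_nat (mi_fact \<alpha>)))"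

definition ell_tilde :: "(complex^'n \<Rightarrow> complex) set set \<Rightarrow> (('n \<Rightarrow> nat) \<Rightarrow> complex) set" where
  "ell_tilde I = {\<xi>\<in>ell1. \<forall>f. holomorphic_near_0 f \<and> germ f \<in> I \<longrightarrow> pairing0 \<xi> f = 0}"

text \<open>A function on \<open>D\<close> is represented by its extension by zero, so that elements of the Bergman
  space are determined by their values on \<open>D\<close>.\<close>

definition bergman :: "(complex^'n) set \<Rightarrow> (complex^'n \<Rightarrow> complex) set" where
  "bergman D = {f. f mv_holomorphic_on D \<and> (\<forall>z. z \<notin> D \<longrightarrow> f z = 0) \<and>
     set_integrable lborel D (\<lambda>z. (cmod (f z))\<^sup>2)}"

definition bergman_inner ::
    "(complex^'n) set \<Rightarrow> (complex^'n \<Rightarrow> complex) \<Rightarrow> (complex^'n \<Rightarrow> complex) \<Rightarrow> complex" where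
  "bergman_inner D f g = (LINT z:D|lborel. f z * cnj (g z))"

definition bergman_norm :: "(complex^'n) set \<Rightarrow> (complex^'n \<Rightarrow> complex) \<Rightarrow> real" where
  "bergman_norm D f = sqrt (LINT z:D|lborel. (cmod (f z))\<^sup>2)"

definition bergman_ideal ::
    "(complex^'n) set \<Rightarrow> (complex^'n \<Rightarrow> complex) set set \<Rightarrow> (complex^'n \<Rightarrow> complex) set" where
  "bergman_ideal D I = {f\<in>bergman D. germ f \<in> I}"

definition bergman_orth ::
    "(complex^'n) set \<Rightarrow> (complex^'n \<Rightarrow> complex) set \<Rightarrow> (complex^'n \<Rightarrow> complex) set" where
  "bergman_orth D S = {g\<in>bergman D. \<forall>f\<in>S. bergman_inner D f g = 0}"

definition bergman_dense_in ::
    "(complex^'n) set \<Rightarrow> (complex^'n \<Rightarrow> complex) set \<Rightarrow> (complex^'n \<Rightarrow> complex) set \<Rightarrow> bool" where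
  "bergman_dense_in D S A \<longleftrightarrow>
     S \<subseteq> A \<and> (\<forall>f\<in>A. \<forall>\<epsilon>>0. \<exists>g\<in>S. bergman_norm D (\<lambda>z. f z - g z) < \<epsilon>)"

definition riesz_rep ::
    "(complex^'n) set \<Rightarrow> (('n \<Rightarrow> nat) \<Rightarrow> complex) \<Rightarrow> complex^'n \<Rightarrow> complex" where
  "riesz_rep D \<xi> =
     (THE g. g \<in> bergman D \<and> (\<forall>f\<in>bergman D. bergman_inner D f g = pairing0 \<xi> f))"

end

theory Submission
  imports Defs "HOL-Complex_Analysis.Cauchy_Integral_Formula" "HOL-Computational_Algebra.Primes"
begin

text \<open>
  By Hilbert space duality it suffices that a function \<open>f\<close> of the Bergman space which is annihilated by every
  finitely supported \<open>\<xi>\<close> that kills \<open>I\<close> has its germ in \<open>I\<close>. (Point evaluations, and hence Taylor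
  coefficients, are bounded by the mean value property, so the Bergman space is complete and the Riesz
  representatives exist.)

  For this, order the monomials by the weight \<open>wt \<alpha> = \<Prod>i. p\<^sub>i ^ \<alpha> i\<close> with distinct primes \<open>p\<^sub>i\<close>, let \<open>M\<close> be the
  set of leading exponents of members of \<open>I\<close>, and divide with remainder: each germ is the sum of an
  element of \<open>I\<close> and a convergent series \<open>r\<close> supported off \<open>M\<close>. The quotient and remainder coefficients solve
  a triangular linear system, so every coefficient of \<open>r\<close> is a finite linear combination of Taylor
  coefficients of \<open>f\<close>; and \<open>r = 0\<close> for \<open>f\<close> in \<open>I\<close>, since otherwise its leading exponent would lie in \<open>M\<close>.
  The remainder coefficients are therefore finitely supported functionals that kill \<open>I\<close>, and if all of them
  vanish at \<open>f\<close> then \<open>f\<close> is in \<open>I\<close>. Convergence is controlled by the norms \<open>\<Sum>\<alpha>. \<bar>c \<alpha>\<bar> / wt \<alpha> ^ s\<close>: for large \<open>s\<close>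
  the leading term dominates the rest.
\<close>

section \<open>Holomorphic functions of several variables\<close>

text \<open>The obstacle is closedness. Agreeing with members of the ideal in any finite set of
  coefficients does not by itself put a germ in the ideal; the division must produce convergent
  quotients.

  The weight plays two roles. As an order it is total (unique factorisation), compatible with
  products of monomials, and has finite initial segments, so each row of the system is finite. As a
  size, \<open>1 / wt \<alpha> ^ s\<close> is the value of the monomial at the point with
  coordinates \<open>1 / pr i ^ s\<close>; as \<open>s\<close> grows, a monomial becomes negligible
  against any of smaller weight.

  By Dickson's lemma finitely many members of the ideal supply all leading exponents, so a single
  \<open>s\<close> makes the tail of each at most half of its leading term. Multiplying by a
  monomial scales leading term and tail alike, so the half survives for all multiples. The system is
  then the identity plus a perturbation of norm at most 1/2, which explains the constants 3/2 = 1 +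
  1/2 and 2 = 1 / (1 - 1/2).\<close>

lemma linear_smult_add:
  fixes L :: "complex^'n \<Rightarrow> complex"
  assumes "Vector_Spaces.linear (*s) (*) L"
  shows "L (a *s v) = a * L v" "L (v + w) = L v + L w"
  using assms unfolding Vector_Spaces.linear_iff by auto

lemma mv_holomorphic_on_openD:
  assumes "f mv_holomorphic_on U" "open U" "z \<in> U"
  obtains L where "Vector_Spaces.linear (*s) (*) L" "(f has_derivative L) (at z)"
  using assms unfolding mv_holomorphic_on_def by (metis at_within_open)

lemma mv_holomorphic_on_imp_continuous_on:
  "f mv_holomorphic_on U \<Longrightarrow> continuous_on U f"
  unfolding mv_holomorphic_on_def continuous_on_eq_continuous_within
  using has_derivative_continuous by blast

lemma mv_holomorphic_on_cmult: "f mv_holomorphic_on U \<Longrightarrow> (\<lambda>z. c * f z) mv_holomorphic_on U"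
  using mv_holomorphic_on_mult[OF mv_holomorphic_on_const] by blast

lemma mv_holomorphic_on_diff:
  assumes "f mv_holomorphic_on U" "g mv_holomorphic_on U"
  shows "(\<lambda>z. f z - g z) mv_holomorphic_on U"
  using mv_holomorphic_on_add[OF assms(1) mv_holomorphic_on_cmult[OF assms(2), of "-1"]] by simp

lemma mv_holomorphic_on_sum:
  "(\<And>i. i \<in> A \<Longrightarrow> f i mv_holomorphic_on U) \<Longrightarrow> (\<lambda>z. \<Sum>i\<in>A. f i z) mv_holomorphic_on U"
  by (induction A rule: infinite_finite_induct)
    (auto intro: mv_holomorphic_on_const mv_holomorphic_on_add)

lemma mv_holomorphic_on_prod:
  "(\<And>i. i \<in> A \<Longrightarrow> f i mv_holomorphic_on U) \<Longrightarrow> (\<lambda>z. \<Prod>i\<in>A. f i z) mv_holomorphic_on U"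
  by (induction A rule: infinite_finite_induct)
    (auto intro: mv_holomorphic_on_const mv_holomorphic_on_mult)

lemma mv_holomorphic_on_power:
  "f mv_holomorphic_on U \<Longrightarrow> (\<lambda>z. f z ^ k) mv_holomorphic_on U"
  by (induction k) (auto intro: mv_holomorphic_on_const mv_holomorphic_on_mult)

lemma mv_holomorphic_on_nth: "(\<lambda>z::complex^'n. z $ i) mv_holomorphic_on U"
proof -
  have "Vector_Spaces.linear (*s) (*) (\<lambda>z::complex^'n. z $ i)"
    unfolding Vector_Spaces.linear_iff by (auto intro: vec.vector_space_axioms vector_space_over_itself.vector_space_axioms)
  moreover have "((\<lambda>z. z $ i) has_derivative (\<lambda>z. z $ i)) (at z within U)" for z
    by (rule bounded_linear_imp_has_derivative[OF bounded_linear_vec_nth])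
  ultimately show ?thesis unfolding mv_holomorphic_on_def by blast
qed

lemma mv_holomorphic_on_translate:
  assumes "f mv_holomorphic_on U" "open U" "open V" "\<And>z. z \<in> V \<Longrightarrow> z + a \<in> U"
  shows "(\<lambda>z. f (z + a)) mv_holomorphic_on V"
  unfolding mv_holomorphic_on_def
proof
  fix z assume z: "z \<in> V"
  obtain L where L: "Vector_Spaces.linear (*s) (*) L" "(f has_derivative L) (at (z + a))"
    using mv_holomorphic_on_openD[OF assms(1,2) assms(4)[OF z]] .
  have "((\<lambda>z. z + a) has_derivative (\<lambda>h. h)) (at z within V)"
    by (auto intro!: derivative_eq_intros)
  from has_derivative_compose[OF this, of f L] L
  show "\<exists>L. Vector_Spaces.linear (*s) (*) L \<and> ((\<lambda>z. f (z + a)) has_derivative L) (at z within V)"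
    by blast
qed

lemma has_field_derivative_along_line:
  fixes f :: "complex^'n \<Rightarrow> complex"
  assumes "Vector_Spaces.linear (*s) (*) L" "(f has_derivative L) (at (z + t *s v))"
  shows "((\<lambda>t. f (z + t *s v)) has_field_derivative L v) (at t)"
proof -
  have bl: "bounded_linear (\<lambda>t. t *s v)"
    by (rule linear_conv_bounded_linear[THEN iffD1], rule linearI)
      (auto simp: vec_eq_iff algebra_simps)
  have "((\<lambda>t. z + t *s v) has_derivative (\<lambda>t. t *s v)) (at t)"
    using bounded_linear_imp_has_derivative[OF bl] by (auto intro!: derivative_eq_intros)
  from has_derivative_compose[OF this assms(2)]
  show ?thesis
    unfolding has_field_derivative_def
    by (simp add: linear_smult_add[OF assms(1)] mult.commute[of _ "L v"] )
qed

text \<open>Slices along complex lines are the gate through which one-variable theory (Cauchy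
  estimates, power series, mean values) enters.\<close>

lemma holomorphic_on_line:
  fixes f :: "complex^'n \<Rightarrow> complex"
  assumes "f mv_holomorphic_on U" "open U" "\<And>t. t \<in> T \<Longrightarrow> z + t *s v \<in> U"
  shows "(\<lambda>t. f (z + t *s v)) holomorphic_on T"
  unfolding holomorphic_on_def
proof
  fix t assume "t \<in> T"
  then obtain L where "Vector_Spaces.linear (*s) (*) L" "(f has_derivative L) (at (z + t *s v))"
    using mv_holomorphic_on_openD assms by metis
  from has_field_derivative_along_line[OF this]
  show "(\<lambda>t. f (z + t *s v)) field_differentiable at t within T"
    using field_differentiable_def has_field_derivative_at_within by blast
qed

lemma norm_vector_smult: "norm (t *s (v::complex^'n)) = cmod t * norm v"
  unfolding norm_vec_def by (simp add: L2_set_def norm_mult power_mult_distrib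
      sum_distrib_left[symmetric] real_sqrt_mult)

text \<open>Cauchy's inequality for the slice of \<open>f\<close> in direction \<open>v\<close>: the
  parameter disc of radius \<open>R / norm v\<close> is carried into
  \<open>cball z R\<close>.\<close>

lemma derivative_bound:
  fixes f :: "complex^'n \<Rightarrow> complex"
  assumes hol: "f mv_holomorphic_on U" "open U" and R: "R > 0" "cball z R \<subseteq> U"
    and L: "Vector_Spaces.linear (*s) (*) L" "(f has_derivative L) (at z)"
    and M: "\<And>w. w \<in> cball z R \<Longrightarrow> cmod (f w) \<le> M"
  shows "cmod (L v) \<le> M / R * norm v"
proof (cases "v = 0")
  case True
  then show ?thesis using linear_smult_add(1)[OF L(1), of 0 v] by simp
next
  case False
  define r where "r = R / norm v"
  have r: "r > 0" using False R by (simp add: r_def)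
  have in_cball: "z + t *s v \<in> cball z R" if "t \<in> cball 0 r" for t
    using that False by (simp add: dist_norm norm_vector_smult r_def field_simps)
  let ?g = "\<lambda>t. f (z + t *s v)"
  have g: "?g holomorphic_on cball 0 r"
    using holomorphic_on_line[OF hol] in_cball R(2) by blast
  have "cmod ((deriv ^^ 1) ?g 0) \<le> fact 1 * M / r ^ 1"
  proof (rule Cauchy_inequality)
    show "?g holomorphic_on ball 0 r" using g holomorphic_on_subset ball_subset_cball by blast
    show "continuous_on (cball 0 r) ?g" using g holomorphic_on_imp_continuous_on by blast
    show "cmod (?g x) \<le> M" if "cmod (0 - x) = r" for x
      by (rule M, rule in_cball) (use that in auto)
  qed (use r in auto)
  moreover have "deriv ?g 0 = L v"
    by (rule DERIV_imp_deriv, rule has_field_derivative_along_line) (use L in auto)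
  ultimately show ?thesis using False by (simp add: r_def field_simps)
qed

text \<open>The Weierstrass convergence theorem. \<open>derivative_bound\<close>, applied to
  differences \<open>f m - f n\<close>, turns uniform convergence of the functions into uniform
  convergence of the derivatives on a smaller ball. The limit of the derivatives is then the
  derivative of the limit, and complex linearity passes to it pointwise.\<close>

lemma mv_holomorphic_on_uniform_limit:
  fixes f :: "nat \<Rightarrow> complex^'n \<Rightarrow> complex"
  assumes hol: "\<And>n. f n mv_holomorphic_on U" and "open U"
    and lim: "\<And>z. z \<in> U \<Longrightarrow> \<exists>r>0. cball z r \<subseteq> U \<and> uniform_limit (cball z r) f g sequentially"
  shows "g mv_holomorphic_on U"
  unfolding mv_holomorphic_on_def
proof
  fix z assume "z \<in> U"
  then obtain r where r: "r > 0" "cball z r \<subseteq> U" and u: "uniform_limit (cball z r) f g sequentially"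
    using lim by blast
  \<comment> \<open>Half the radius, so that a ball of radius \<open>r/2\<close> about any point of
    \<open>S\<close> is available for the Cauchy estimate.\<close>
  define S where "S = ball z (r/2)"
  have sub: "cball x (r/2) \<subseteq> cball z r" if "x \<in> S" for x
    proof
    fix y assume "y \<in> cball x (r/2)"
    then show "y \<in> cball z r" using that dist_triangle[of z y x] by (simp add: S_def)
  qed
  have SU: "S \<subseteq> U" using r by (auto simp: S_def)
  define L where "L n x = (SOME L. Vector_Spaces.linear (*s) (*) L \<and> (f n has_derivative L) (at x))" for n x
  have L: "Vector_Spaces.linear (*s) (*) (L n x)" "(f n has_derivative L n x) (at x)" if "x \<in> U" for n x
    using mv_holomorphic_on_openD[OF hol \<open>open U\<close> that]
      someI_ex[of "\<lambda>L. Vector_Spaces.linear (*s) (*) L \<and> (f n has_derivative L) (at x)"]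
    unfolding L_def by metis+
  have diff: "cmod (L m x v - L n x v) \<le> (e / (r/2)) * norm v"
    if "x \<in> S" "\<And>w. w \<in> cball z r \<Longrightarrow> cmod (f m w - f n w) \<le> e" for m n x v e
  proof (rule derivative_bound[where f = "\<lambda>w. f m w - f n w" and U = U])
    show "(\<lambda>w. f m w - f n w) mv_holomorphic_on U" by (intro mv_holomorphic_on_diff hol)
    show "cball x (r/2) \<subseteq> U" using sub that r by blast
    have xU: "x \<in> U" using that SU by blast
    show "Vector_Spaces.linear (*s) (*) (\<lambda>v. L m x v - L n x v)"
      using L(1)[OF xU] unfolding Vector_Spaces.linear_iff by (auto simp: algebra_simps)
    show "((\<lambda>w. f m w - f n w) has_derivative (\<lambda>v. L m x v - L n x v)) (at x)"
      by (intro has_derivative_diff L xU)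
    show "cmod (f m w - f n w) \<le> e" if "w \<in> cball x (r/2)" for w
      using sub[OF \<open>x \<in> S\<close>] that \<open>\<And>w. w \<in> cball z r \<Longrightarrow> cmod (f m w - f n w) \<le> e\<close> by blast
  qed (use r \<open>open U\<close> in auto)
  have ev: "\<exists>N. \<forall>m\<ge>N. \<forall>n\<ge>N. \<forall>w\<in>cball z r. cmod (f m w - f n w) \<le> e" if "e > 0" for e
  proof -
    obtain N where N: "\<And>m w. m \<ge> N \<Longrightarrow> w \<in> cball z r \<Longrightarrow> dist (f m w) (g w) < e/2"
      using u half_gt_zero[OF \<open>e > 0\<close>] unfolding uniform_limit_sequentially_iff by blast
    have "cmod (f m w - f n w) \<le> e" if "m \<ge> N" "n \<ge> N" "w \<in> cball z r" for m n w
      using N[OF that(1,3)] N[OF that(2,3)] dist_triangle_half_l[of "f m w" "g w" e "f n w"]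
      by (simp add: dist_norm dist_commute less_imp_le)
    then show ?thesis by blast
  qed
  have conv: "\<exists>l. (\<lambda>n. L n x v) \<longlonglongrightarrow> l" if "x \<in> S" for x v
  proof -
    have "Cauchy (\<lambda>n. L n x v)"
    proof (rule metric_CauchyI)
      fix e :: real assume e: "e > 0"
      \<comment> \<open>Chosen so that the bound \<open>e' / (r/2) * norm v\<close> stays below
        \<open>e / 2\<close>; the summand 1 covers \<open>v = 0\<close>.\<close>
      define e' where "e' = e * r / (4 * (norm v + 1))"
      have e': "e' > 0" using e r by (auto simp: e'_def intro!: divide_pos_pos add_nonneg_pos)
      obtain N where N: "\<And>m n w. m \<ge> N \<Longrightarrow> n \<ge> N \<Longrightarrow> w \<in> cball z r \<Longrightarrow> cmod (f m w - f n w) \<le> e'"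
        using ev[OF e'] by blast
      have "dist (L m x v) (L n x v) < e" if "m \<ge> N" "n \<ge> N" for m n
      proof -
        have "cmod (L m x v - L n x v) \<le> (e' / (r/2)) * norm v"
          by (rule diff[OF \<open>x \<in> S\<close> N[OF that]])
        also have "\<dots> = e / 2 * (norm v / (norm v + 1))"
        proof -
          have "norm v + 1 \<noteq> 0" using norm_ge_zero[of v] by linarith
          then show ?thesis using r by (simp add: e'_def divide_simps)
        qed
        also have "\<dots> \<le> e / 2 * 1"
          using e by (intro mult_left_mono) (auto simp: divide_le_eq_1 add_nonneg_pos)
        also have "\<dots> < e" using e by simp
        finally show ?thesis by (simp add: dist_norm)
      qed
      then show "\<exists>N. \<forall>m\<ge>N. \<forall>n\<ge>N. dist (L m x v) (L n x v) < e" by blast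
    qed
    then show ?thesis using Cauchy_convergent_iff convergent_def by blast
  qed
  define L' where "L' x v = lim (\<lambda>n. L n x v)" for x v
  have L': "(\<lambda>n. L n x v) \<longlonglongrightarrow> L' x v" if "x \<in> S" for x v
    using conv[OF that] unfolding L'_def by (metis limI)
  have "\<exists>g'. \<forall>x\<in>S. (\<lambda>n. f n x) \<longlonglongrightarrow> g' x \<and> (g' has_derivative L' x) (at x within S)"
  proof (rule has_derivative_sequence)
    show "convex S" by (simp add: S_def)
    show "(f n has_derivative L n x) (at x within S)" if "x \<in> S" for n x
      using L(2)[of x n] that SU has_derivative_at_withinI by blast
    show "\<forall>\<^sub>F n in sequentially. \<forall>x\<in>S. \<forall>h. cmod (L n x h - L' x h) \<le> e * norm h" if "e > 0" for e
    proof -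
      have "e * (r/2) > 0" using that r by simp
      then obtain N where N: "\<And>m n w. m \<ge> N \<Longrightarrow> n \<ge> N \<Longrightarrow> w \<in> cball z r \<Longrightarrow> cmod (f m w - f n w) \<le> e * (r/2)"
        using ev[OF \<open>e * (r/2) > 0\<close>] by blast
      have "cmod (L n x h - L' x h) \<le> e * norm h" if "n \<ge> N" "x \<in> S" for n x h
      proof (rule tendsto_upperbound)
        show "(\<lambda>m. cmod (L n x h - L m x h)) \<longlonglongrightarrow> cmod (L n x h - L' x h)"
          by (intro tendsto_intros L' that)
        have "cmod (L n x h - L m x h) \<le> e * norm h" if "m \<ge> N" for m
          using diff[OF \<open>x \<in> S\<close> N[OF \<open>n \<ge> N\<close> that], where v = h] r by simp
        then show "\<forall>\<^sub>F m in sequentially. cmod (L n x h - L m x h) \<le> e * norm h"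
          using eventually_sequentially by blast
      qed simp
      then show ?thesis using eventually_sequentially by blast
    qed
    show "z \<in> S" using r by (simp add: S_def)
    show "(\<lambda>n. f n z) \<longlonglongrightarrow> g z"
      using tendsto_uniform_limitI[OF u, of z] r by simp
  qed
  then obtain g' where g': "\<And>x. x \<in> S \<Longrightarrow> (\<lambda>n. f n x) \<longlonglongrightarrow> g' x"
    "\<And>x. x \<in> S \<Longrightarrow> (g' has_derivative L' x) (at x within S)" by blast
  have eq: "g' x = g x" if "x \<in> S" for x
    using tendsto_uniform_limitI[OF u, of x] g'(1)[OF that] that r LIMSEQ_unique
    by (auto simp: S_def)
  have zS: "z \<in> S" using r by (simp add: S_def)
  have "(g has_derivative L' z) (at z within S)"
    using g'(2)[OF zS] has_derivative_transform[OF zS eq] by (metis (no_types, lifting) eq has_derivative_transform zS)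
  then have "(g has_derivative L' z) (at z)"
    using zS at_within_open[of z S] by (simp add: S_def)
  moreover have "Vector_Spaces.linear (*s) (*) (L' z)"
  proof -
    have "L' z (v + w) = L' z v + L' z w" for v w
      using LIMSEQ_unique[OF L'[OF zS, of "v+w"]] tendsto_add[OF L'[OF zS, of v] L'[OF zS, of w]]
      by (simp add: linear_smult_add[OF L(1)[OF \<open>z \<in> U\<close>]])
    moreover have "L' z (a *s v) = a * L' z v" for a v
      using LIMSEQ_unique[OF L'[OF zS, of "a *s v"]] tendsto_mult_left[OF L'[OF zS, of v], of a]
      by (simp add: linear_smult_add[OF L(1)[OF \<open>z \<in> U\<close>]])
    ultimately show ?thesis
      using L(1)[OF \<open>z \<in> U\<close>, of 0] unfolding Vector_Spaces.linear_iff by auto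
  qed
  ultimately show "\<exists>L. Vector_Spaces.linear (*s) (*) L \<and> (g has_derivative L) (at z within U)"
    using has_derivative_at_withinI by blast
qed

lemma mv_holomorphic_on_locally:
  assumes "\<And>z. z \<in> U \<Longrightarrow> \<exists>V. open V \<and> z \<in> V \<and> f mv_holomorphic_on V"
  shows "f mv_holomorphic_on U"
  unfolding mv_holomorphic_on_def
proof
  fix z assume "z \<in> U"
  then obtain V where V: "open V" "z \<in> V" "f mv_holomorphic_on V" using assms by blast
  from mv_holomorphic_on_openD[OF V(3,1,2)]
  show "\<exists>L. Vector_Spaces.linear (*s) (*) L \<and> (f has_derivative L) (at z within U)"
    using has_derivative_at_withinI by metis
qed

section \<open>Partial derivatives of holomorphic functions\<close>

lemma difference_quotient_bound:
  assumes g: "g holomorphic_on ball 0 (3 * r)" and M: "\<And>t. t \<in> ball 0 (3 * r) \<Longrightarrow> cmod (g t) \<le> M"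
    and r: "r > 0" and h: "cmod h \<le> r" "h \<noteq> 0"
  shows "cmod ((g h - g 0) / h - deriv g 0) \<le> 2 * M / r\<^sup>2 * cmod h"
proof -
  define B where "B = 2 * M / r\<^sup>2"
  have "cmod ((deriv ^^ 0) g h - (\<Sum>i\<le>1. (deriv ^^ i) g 0 * (h - 0) ^ i / fact i))
      \<le> B * cmod (h - 0) ^ Suc 1 / fact 1"
  proof (rule complex_Taylor)
    show "convex (cball (0::complex) r)" by simp
    show "((deriv ^^ i) g has_field_derivative (deriv ^^ Suc i) g x) (at x within cball 0 r)"
      if "x \<in> cball 0 r" for i x
      using has_field_derivative_higher_deriv[OF g, of x i] that r
      by (auto intro: has_field_derivative_at_within)
    show "cmod ((deriv ^^ Suc 1) g x) \<le> B" if x: "x \<in> cball 0 r" for x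
    proof -
      \<comment> \<open>Taylor's formula needs the second derivative on \<open>cball 0 r\<close>,
        and the Cauchy estimate at a point there uses another \<open>r\<close>; the radius
        \<open>3 * r\<close> keeps both inside the open disc.\<close>
      have sub: "cball x r \<subseteq> ball 0 (3 * r)"
      proof
        fix y assume "y \<in> cball x r"
        then show "y \<in> ball 0 (3 * r)" using x r dist_triangle[of 0 y x] by simp
      qed
      have "cmod ((deriv ^^ 2) g x) \<le> fact 2 * M / r ^ 2"
      proof (rule Cauchy_inequality)
        show "g holomorphic_on ball x r"
          using g sub holomorphic_on_subset ball_subset_cball by (metis order_trans)
        show "continuous_on (cball x r) g"
          using g sub holomorphic_on_imp_continuous_on continuous_on_subset by blast
        show "cmod (g y) \<le> M" if "cmod (x - y) = r" for y
          using M sub that by (auto simp: dist_norm subset_iff)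
      qed (use r in auto)
      then show ?thesis by (simp add: B_def numeral_2_eq_2)
    qed
  qed (use h r in auto)
  then have *: "cmod (g h - g 0 - deriv g 0 * h) \<le> B * (cmod h)\<^sup>2"
    by (simp add: power2_eq_square algebra_simps)
  have "(g h - g 0) / h - deriv g 0 = (g h - g 0 - deriv g 0 * h) / h"
    using h by (simp add: field_simps)
  then have "cmod ((g h - g 0) / h - deriv g 0) = cmod (g h - g 0 - deriv g 0 * h) / cmod h"
    by (simp add: norm_divide)
  also have "\<dots> \<le> B * cmod h"
    using * h by (simp add: field_simps power2_eq_square)
  finally show ?thesis by (simp add: B_def)
qed

lemma axis_eq_smult: "axis i w = w *s (axis i 1 :: complex^'n)"
  by (simp add: vec_eq_iff axis_def)

lemma norm_axis_complex: "norm (axis i (w::complex) :: complex^'n) = cmod w"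
  by (simp add: axis_eq_smult[of i w] norm_vector_smult)

lemma axis_add: "axis i (v + w) = axis i v + (axis i w :: complex^'n)"
  by (simp add: vec_eq_iff axis_def)

text \<open>A partial derivative is a locally uniform limit of difference quotients, each of which
  is a combination of translates of \<open>f\<close> and hence holomorphic; the error is of the
  order of the step by \<open>difference_quotient_bound\<close>.\<close>

lemma mv_holomorphic_on_cpartial:
  fixes f :: "complex^'n \<Rightarrow> complex"
  assumes f: "f mv_holomorphic_on U" and U: "open U"
  shows "cpartial i f mv_holomorphic_on U"
proof (rule mv_holomorphic_on_locally)
  fix z0 assume "z0 \<in> U"
  then obtain R where R: "R > 0" "cball z0 R \<subseteq> U"
    using U open_contains_cball by blast
  \<comment> \<open>A point within \<open>r\<close> of \<open>z0\<close>, moved along an axis by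
    less than \<open>3 * r\<close>, is still in \<open>cball z0 R\<close>.\<close>
  define r where "r = R / 4"
  have r: "r > 0" using R by (simp add: r_def)
  have "compact (f ` cball z0 R)"
    by (intro compact_continuous_image continuous_on_subset[OF mv_holomorphic_on_imp_continuous_on[OF f] R(2)]) auto
  then obtain M where "\<forall>x\<in>f ` cball z0 R. cmod x \<le> M"
    using compact_imp_bounded bounded_iff by metis
  then have M: "\<And>z. z \<in> cball z0 R \<Longrightarrow> cmod (f z) \<le> M" by blast
  define V where "V = ball z0 r"
  have inR: "z + axis i t \<in> cball z0 R" if "z \<in> V" "t \<in> ball 0 (3 * r)" for z t
  proof -
    have "dist z0 (z + axis i t) \<le> dist z0 z + dist z (z + axis i t)" by (rule dist_triangle)
    also have "dist z (z + axis i t) = cmod t" by (simp add: dist_norm norm_axis_complex)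
    finally show ?thesis using that by (simp add: V_def r_def)
  qed
  define h where "h n = complex_of_real (r / real (Suc n))" for n
  have h: "h n \<noteq> 0" "cmod (h n) \<le> r" "cmod (h n) = r / real (Suc n)" for n
  proof -
    show "cmod (h n) = r / real (Suc n)" using r by (simp add: h_def norm_divide del: of_real_divide of_nat_Suc)
    then show "cmod (h n) \<le> r" using r frac_le[of r r 1 "real (Suc n)"] by simp
    show "h n \<noteq> 0" using r by (simp add: h_def del: of_nat_Suc)
  qed
  define D where "D n z = (f (z + axis i (h n)) - f z) * inverse (h n)" for n z
  have D: "D n mv_holomorphic_on V" for n
    unfolding D_def
  proof (intro mv_holomorphic_on_mult mv_holomorphic_on_diff mv_holomorphic_on_const)
    show "f mv_holomorphic_on V"
      by (rule mv_holomorphic_on_subset[OF f]) (use inR[of _ 0] R r in \<open>auto simp: axis_eq_smult[of i 0]\<close>)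
    show "(\<lambda>z. f (z + axis i (h n))) mv_holomorphic_on V"
      by (rule mv_holomorphic_on_translate[OF f U])
        (use inR[of _ "h n"] R h[of n] r in \<open>auto simp: V_def\<close>)
  qed
  have bound: "cmod (D n z - cpartial i f z) \<le> 2 * M / r\<^sup>2 * cmod (h n)" if "z \<in> V" for n z
  proof -
    let ?g = "\<lambda>t. f (z + axis i t)"
    have "cmod ((?g (h n) - ?g 0) / h n - deriv ?g 0) \<le> 2 * M / r\<^sup>2 * cmod (h n)"
    proof (rule difference_quotient_bound)
      have "(\<lambda>t. f (z + t *s axis i 1)) holomorphic_on ball 0 (3 * r)"
        by (rule holomorphic_on_line[OF f U]) (use inR[OF that] R in \<open>auto simp: axis_eq_smult[symmetric]\<close>)
      then show "?g holomorphic_on ball 0 (3 * r)" by (simp add: axis_eq_smult[symmetric])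
    qed (use M inR[OF that] r h in auto)
    then show ?thesis by (simp add: D_def cpartial_def divide_inverse axis_eq_smult[of i 0])
  qed
  have "cpartial i f mv_holomorphic_on V"
  proof (rule mv_holomorphic_on_uniform_limit[where f = D])
    fix z assume "z \<in> V"
    then obtain s where s: "s > 0" "cball z s \<subseteq> V"
      using open_contains_cball[of V] unfolding V_def by blast
    have "uniform_limit V D (cpartial i f) sequentially"
    proof (rule uniform_limitI)
      fix e :: real assume "e > 0"
      have "(\<lambda>n. 2 * M / r\<^sup>2 * (r / real (Suc n))) \<longlonglongrightarrow> 2 * M / r\<^sup>2 * 0"
        by (intro tendsto_mult_left LIMSEQ_Suc lim_const_over_n)
      then have "\<forall>\<^sub>F n in sequentially. 2 * M / r\<^sup>2 * cmod (h n) < e"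
        using \<open>e > 0\<close> order_tendstoD(2)[of "\<lambda>n. 2 * M / r\<^sup>2 * (r / real (Suc n))" "0" sequentially e]
        by (simp add: h(3) del: of_nat_Suc)
      then show "\<forall>\<^sub>F n in sequentially. \<forall>z\<in>V. dist (D n z) (cpartial i f z) < e"
        by (rule eventually_mono) (use bound in \<open>auto simp: dist_norm intro: le_less_trans\<close>)
    qed
    then show "\<exists>s>0. cball z s \<subseteq> V \<and> uniform_limit (cball z s) D (cpartial i f) sequentially"
      using s uniform_limit_on_subset by blast
  qed (use D in \<open>auto simp: V_def\<close>)
  moreover have "z0 \<in> V" "open V" using r by (auto simp: V_def)
  ultimately show "\<exists>V. open V \<and> z0 \<in> V \<and> cpartial i f mv_holomorphic_on V" by blast
qed

lemma cpartial_pow_eq_higher_deriv: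
  "(cpartial i ^^ k) f (z + axis i w) = (deriv ^^ k) (\<lambda>w. f (z + axis i w)) w"
proof (induction k arbitrary: w)
  case (Suc k)
  have "(cpartial i ^^ Suc k) f (z + axis i w) = deriv (\<lambda>v. (cpartial i ^^ k) f (z + axis i (w + v))) 0"
    by (simp add: cpartial_def axis_add add.assoc)
  also have "\<dots> = deriv (\<lambda>v. (cpartial i ^^ k) f (z + axis i v)) w"
    by (subst deriv_shift_0[of _ w]) (simp add: o_def)
  finally show ?case by (simp add: Suc.IH)
qed simp

lemma mv_holomorphic_on_cpartial_pow:
  "f mv_holomorphic_on U \<Longrightarrow> open U \<Longrightarrow> (cpartial i ^^ k) f mv_holomorphic_on U"
  by (induction k) (auto intro: mv_holomorphic_on_cpartial)

lemma mv_holomorphic_on_foldr_cpartial: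
  "f mv_holomorphic_on U \<Longrightarrow> open U \<Longrightarrow> foldr (\<lambda>i. cpartial i ^^ \<alpha> i) is f mv_holomorphic_on U"
  by (induction "is") (auto intro: mv_holomorphic_on_cpartial_pow)

section \<open>Cauchy estimates for iterated partial derivatives\<close>

definition polydisc :: "real \<Rightarrow> (complex^'n) set" where
  "polydisc R = {z. \<forall>i. cmod (z $ i) \<le> R}"

text \<open>The base point at an intermediate stage of a Taylor expansion made one coordinate at a
  time: the coordinates in the list have been expanded and sit at the centre, the others are still
  free. With the full list it is the origin.\<close>

definition zero_out :: "'n list \<Rightarrow> complex^'n \<Rightarrow> complex^'n" where
  "zero_out is z = (\<chi> i. if i \<in> set is then 0 else z $ i)"

lemma zero_out_Cons:
  "i \<notin> set is \<Longrightarrow> zero_out is z = zero_out (i # is) z + axis i (z $ i)"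
  by (auto simp: zero_out_def vec_eq_iff axis_def)

lemma zero_out_axis_in_polydisc:
  "0 \<le> R \<Longrightarrow> z \<in> polydisc R \<Longrightarrow> cmod w \<le> R \<Longrightarrow> zero_out (i # is) z + axis i w \<in> polydisc R"
  by (auto simp: zero_out_def polydisc_def axis_def)

lemma zero_out_update:
  assumes "i \<notin> set is"
  shows "zero_out (i # is) z + axis i w = zero_out is (\<chi> j. if j = i then w else z $ j)"
  using assms by (auto simp: zero_out_def vec_eq_iff axis_def)

lemma holomorphic_on_axis_line:
  fixes f :: "complex^'n \<Rightarrow> complex"
  assumes "f mv_holomorphic_on U" "open U" "\<And>t. t \<in> T \<Longrightarrow> z + axis i t \<in> U"
  shows "(\<lambda>t. f (z + axis i t)) holomorphic_on T"
  using holomorphic_on_line[OF assms(1,2), of T z "axis i 1"] assms(3) by (simp add: axis_eq_smult[symmetric])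

text \<open>Each further derivative costs one application of the one-variable Cauchy inequality on
  the circle of radius \<open>R\<close> in its own coordinate. The induction ranges over all
  \<open>z\<close> in the polydisc because that circle moves a coordinate.\<close>

lemma foldr_cpartial_bound:
  fixes f :: "complex^'n \<Rightarrow> complex"
  assumes f: "f mv_holomorphic_on U" "open U" and R: "R > 0" "polydisc R \<subseteq> U"
    and M: "\<And>z. z \<in> polydisc R \<Longrightarrow> cmod (f z) \<le> M"
    and "distinct is" "z \<in> polydisc R"
  shows "cmod (foldr (\<lambda>i. cpartial i ^^ \<alpha> i) is f (zero_out is z)) \<le> (\<Prod>i\<in>set is. fact (\<alpha> i) / R ^ \<alpha> i) * M"
  using assms(6,7)
proof (induction "is" arbitrary: z)
  case Nil
  then show ?case using M by (simp add: zero_out_def)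
next
  case (Cons i "is")
  let ?G = "foldr (\<lambda>i. cpartial i ^^ \<alpha> i) is f" and ?y = "zero_out (i # is) z"
  have G: "?G mv_holomorphic_on U" by (rule mv_holomorphic_on_foldr_cpartial[OF f])
  have hol: "(\<lambda>w. ?G (?y + axis i w)) holomorphic_on cball 0 R"
    using zero_out_axis_in_polydisc[OF _ Cons.prems(2)] R by (intro holomorphic_on_axis_line[OF G f(2)]) auto
  let ?B = "(\<Prod>i\<in>set is. fact (\<alpha> i) / R ^ \<alpha> i) * M"
  have "cmod ((deriv ^^ \<alpha> i) (\<lambda>w. ?G (?y + axis i w)) 0) \<le> fact (\<alpha> i) * ?B / R ^ \<alpha> i"
  proof (rule Cauchy_inequality)
    show "(\<lambda>w. ?G (?y + axis i w)) holomorphic_on ball 0 R"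
      using hol ball_subset_cball holomorphic_on_subset by blast
    show "continuous_on (cball 0 R) (\<lambda>w. ?G (?y + axis i w))"
      using hol holomorphic_on_imp_continuous_on by blast
    fix w :: complex assume w: "cmod (0 - w) = R"
    \<comment> \<open>Freeing coordinate \<open>i\<close> of the base point and giving it the value
      \<open>w\<close> amounts to replacing it in \<open>z\<close>, which brings the estimate under
      the induction hypothesis.\<close>
    have "(\<chi> j. if j = i then w else z $ j) \<in> polydisc R"
      using w Cons.prems R by (auto simp: polydisc_def)
    from Cons.IH[OF _ this] Cons.prems
    show "cmod (?G (?y + axis i w)) \<le> ?B" by (simp add: zero_out_update)
  qed (use R in auto)
  moreover have "(cpartial i ^^ \<alpha> i) ?G (?y + axis i 0) = (deriv ^^ \<alpha> i) (\<lambda>w. ?G (?y + axis i w)) 0"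
    by (rule cpartial_pow_eq_higher_deriv)
  ultimately show ?case using Cons.prems by (simp add: axis_eq_smult[of i 0] algebra_simps)
qed

lemma norm_le_card_mult:
  fixes z :: "complex^'n"
  assumes "\<And>i. cmod (z $ i) \<le> c"
  shows "norm z \<le> real CARD('n) * c"
proof -
  have "norm z \<le> (\<Sum>i\<in>UNIV. cmod (z $ i))" unfolding norm_vec_def by (rule L2_set_le_sum) simp
  also have "\<dots> \<le> real CARD('n) * c" by (rule sum_bounded_above) (rule assms)
  finally show ?thesis .
qed

section \<open>Power series\<close>

definition pr :: "'n::finite \<Rightarrow> nat" where
  "pr = (SOME p. inj p \<and> (\<forall>i. prime (p i)))"

lemma pr_props: "inj (pr :: 'n::finite \<Rightarrow> nat)" "prime (pr (i :: 'n))"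
proof -
  obtain B where B: "finite B" "card B = CARD('n)" "B \<subseteq> {p::nat. prime p}"
    using infinite_arbitrarily_large[OF primes_infinite] by blast
  obtain p :: "'n \<Rightarrow> nat" where p: "range p \<subseteq> B" "inj p"
    using card_le_inj[of "UNIV :: 'n set" B] B by auto
  then have "inj p \<and> (\<forall>i. prime (p i))" using B by auto
  then have "\<exists>p :: 'n \<Rightarrow> nat. inj p \<and> (\<forall>i. prime (p i))" by blast
  from someI_ex[OF this] show "inj (pr :: 'n \<Rightarrow> nat)" "prime (pr (i :: 'n))"
    unfolding pr_def by blast+
qed

lemma pr_ge_2: "pr i \<ge> 2"
  by (rule prime_ge_2_nat[OF pr_props(2)])

definition wt :: "('n::finite \<Rightarrow> nat) \<Rightarrow> nat" where
  "wt \<alpha> = (\<Prod>i\<in>UNIV. pr i ^ \<alpha> i)"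

lemma wt_add: "wt (\<lambda>i. \<alpha> i + \<beta> i) = wt \<alpha> * wt \<beta>"
  by (simp add: wt_def power_add prod.distrib)

lemma wt_pos: "wt \<alpha> > 0"
  unfolding wt_def by (rule prod_pos) (simp add: prime_gt_0_nat[OF pr_props(2)])

lemma wt_inj: "wt \<alpha> = wt \<beta> \<longleftrightarrow> \<alpha> = (\<beta> :: 'n::finite \<Rightarrow> nat)"
proof
  have key: "multiplicity (pr i) (wt \<alpha>) = \<alpha> i" for \<alpha> and i :: 'n
  proof -
    have "wt \<alpha> = (\<Prod>p\<in>range (pr :: 'n \<Rightarrow> nat). p ^ \<alpha> (inv_into UNIV pr p))"
      unfolding wt_def by (subst prod.reindex) (simp_all add: pr_props(1))
    then have "multiplicity (pr i) (wt \<alpha>) = \<alpha> (inv_into UNIV pr (pr i))"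
      using pr_props(2) by (subst \<open>wt \<alpha> = _\<close>, subst multiplicity_prod_prime_powers) auto
    then show ?thesis by (simp add: pr_props(1))
  qed
  assume "wt \<alpha> = wt \<beta>"
  then show "\<alpha> = \<beta>" using key by (metis ext)
qed simp

lemma two_power_mi_size_le_wt: "2 ^ mi_size \<alpha> \<le> wt \<alpha>"
  unfolding mi_size_def wt_def power_sum by (rule prod_mono) (simp add: power_mono pr_ge_2)

lemma finite_wt_le: "finite {\<alpha> :: 'n::finite \<Rightarrow> nat. wt \<alpha> \<le> N}"
  by (rule inj_on_finite[of wt _ "{..N}"]) (auto simp: inj_on_def wt_inj)

lemma finite_wt_less: "finite {\<alpha> :: 'n::finite \<Rightarrow> nat. wt \<alpha> < N}"
  by (rule finite_subset[OF _ finite_wt_le[of N]]) auto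

section \<open>Monomials on shrinking polydiscs\<close>

definition mon :: "('n::finite \<Rightarrow> nat) \<Rightarrow> complex^'n \<Rightarrow> complex" where
  "mon \<alpha> z = (\<Prod>i\<in>UNIV. z $ i ^ \<alpha> i)"

lemma mon_add: "mon (\<lambda>i. \<alpha> i + \<beta> i) z = mon \<alpha> z * mon \<beta> z"
  by (simp add: mon_def power_add prod.distrib)

lemma mv_holomorphic_on_mon: "mon \<alpha> mv_holomorphic_on U"
  unfolding mon_def by (intro mv_holomorphic_on_prod mv_holomorphic_on_power mv_holomorphic_on_nth)

text \<open>The radii differ from one coordinate to the next so that the supremum of
  \<open>mon \<alpha>\<close> depends on the weight alone: it is
  \<open>1 / wt \<alpha> ^ s\<close>.\<close>

definition wdisc :: "nat \<Rightarrow> (complex^'n) set" where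
  "wdisc s = {z. \<forall>i. cmod (z $ i) \<le> 1 / real (pr i) ^ s}"

lemma wdisc_antimono: "s \<le> t \<Longrightarrow> wdisc t \<subseteq> wdisc s"
proof
  fix z :: "complex^'n" assume "s \<le> t" "z \<in> wdisc t"
  have "1 / real (pr i) ^ t \<le> 1 / real (pr i) ^ s" for i :: 'n
    using \<open>s \<le> t\<close> pr_ge_2[of i] by (intro divide_left_mono power_increasing) auto
  then show "z \<in> wdisc s" using \<open>z \<in> wdisc t\<close> unfolding wdisc_def mem_Collect_eq by (meson order_trans)
qed

lemma cmod_mon_le:
  assumes "z \<in> wdisc s" shows "cmod (mon \<alpha> z) \<le> 1 / real (wt \<alpha>) ^ s"
proof -
  have "cmod (mon \<alpha> z) = (\<Prod>i\<in>UNIV. cmod (z $ i) ^ \<alpha> i)"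
    by (simp add: mon_def prod_norm[symmetric] norm_power)
  also have "\<dots> \<le> (\<Prod>i\<in>UNIV. (1 / real (pr i) ^ s) ^ \<alpha> i)"
    using assms by (intro prod_mono) (auto simp: wdisc_def intro!: power_mono)
  also have "\<dots> = 1 / real (wt \<alpha>) ^ s"
    by (simp add: wt_def power_divide prod_dividef prod_power_distrib power_mult[symmetric] mult.commute)
  finally show ?thesis .
qed

lemma eventually_in_wdisc: "\<forall>\<^sub>F z in nhds (0 :: complex^'n). z \<in> wdisc s"
  unfolding eventually_nhds
proof (intro exI conjI ballI)
  have "open {z :: complex^'n. cmod (z $ i) < 1 / real (pr i) ^ s}" for i
    by (rule open_Collect_less) (intro continuous_intros)+
  then show "open (\<Inter>i. {z :: complex^'n. cmod (z $ i) < 1 / real (pr i) ^ s})"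
    by (intro open_INT) auto
  show "0 \<in> (\<Inter>i. {z :: complex^'n. cmod (z $ i) < 1 / real (pr i) ^ s})"
    by (simp add: prime_gt_0_nat pr_props(2))
  show "z \<in> wdisc s" if "z \<in> (\<Inter>i. {z :: complex^'n. cmod (z $ i) < 1 / real (pr i) ^ s})" for z
    using that by (auto simp: wdisc_def less_imp_le)
qed

text \<open>The positive vertex of \<open>wdisc s\<close>, at which all monomials attain their
  bounds at once.\<close>

definition wpoint :: "nat \<Rightarrow> complex^'n" where
  "wpoint s = (\<chi> i. of_real (1 / real (pr i) ^ s))"

lemma wpoint_in_wdisc: "wpoint s \<in> wdisc s"
  by (simp add: wpoint_def wdisc_def norm_divide norm_power)

lemma mon_wpoint: "mon \<alpha> (wpoint s) = of_real (1 / real (wt \<alpha>) ^ s)"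
  by (simp add: wt_def mon_def wpoint_def power_divide prod_dividef prod_power_distrib power_mult[symmetric] mult.commute)

lemma wdisc_subset_nhd:
  fixes U :: "(complex^'n) set"
  assumes "open U" "0 \<in> U" shows "\<exists>s. wdisc s \<subseteq> U"
proof -
  obtain r where r: "r > 0" "ball 0 r \<subseteq> U" using assms open_contains_ball by blast
  obtain s where s: "real CARD('n) / r < 2 ^ s" using real_arch_pow[of 2] by auto
  have "wdisc s \<subseteq> ball (0 :: complex^'n) r"
  proof
    fix z :: "complex^'n" assume z: "z \<in> wdisc s"
    have "norm z \<le> real CARD('n) * (1 / 2 ^ s)"
    proof (rule norm_le_card_mult)
      fix i :: 'n
      have "1 / real (pr i) ^ s \<le> 1 / 2 ^ s"
        using pr_ge_2[of i] by (intro divide_left_mono power_mono) auto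
      then show "cmod (z $ i) \<le> 1 / 2 ^ s" using z unfolding wdisc_def mem_Collect_eq by (meson order_trans)
    qed
    also have "\<dots> < r" using s r by (simp add: field_simps)
    finally show "z \<in> ball 0 r" by simp
  qed
  then show ?thesis using r by blast
qed

section \<open>Weighted coefficient norms\<close>

abbreviation wnorm :: "(('n::finite \<Rightarrow> nat) \<Rightarrow> complex) \<Rightarrow> nat \<Rightarrow> real" where
  "wnorm c s \<equiv> \<Sum>\<^sub>\<infinity>\<alpha>. cmod (c \<alpha>) / real (wt \<alpha>) ^ s"

text \<open>A divergent infinite sum has the default value 0, so a bound on \<open>wnorm c s\<close>
  carries information only together with \<open>wconv c s\<close>.\<close>

definition wconv :: "(('n::finite \<Rightarrow> nat) \<Rightarrow> complex) \<Rightarrow> nat \<Rightarrow> bool" where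
  "wconv c s \<longleftrightarrow> (\<lambda>\<alpha>. cmod (c \<alpha>) / real (wt \<alpha>) ^ s) summable_on UNIV"

lemma inverse_wt_power_mono: "s \<le> t \<Longrightarrow> 1 / real (wt \<alpha>) ^ t \<le> 1 / real (wt \<alpha>) ^ s"
  using wt_pos[of \<alpha>] by (intro divide_left_mono power_increasing) auto

lemma wconv_mono: "wconv c s \<Longrightarrow> s \<le> t \<Longrightarrow> wconv c t"
  unfolding wconv_def
  by (erule summable_on_comparison_test)
    (use mult_left_mono[OF inverse_wt_power_mono norm_ge_zero, of s t] in auto)

lemma wconv_norm_summable:
  assumes "wconv c s" "z \<in> wdisc s"
  shows "(\<lambda>\<alpha>. norm (c \<alpha> * mon \<alpha> z)) summable_on UNIV"
  using assms(1) unfolding wconv_def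
  by (rule summable_on_comparison_test)
    (use mult_left_mono[OF cmod_mon_le[OF assms(2)]] in \<open>auto simp: norm_mult\<close>)

definition power_series :: "(complex^'n \<Rightarrow> complex) \<Rightarrow> (('n \<Rightarrow> nat) \<Rightarrow> complex) \<Rightarrow> nat \<Rightarrow> bool" where
  "power_series f c s \<longleftrightarrow> wconv c s \<and> (\<forall>z\<in>wdisc s. ((\<lambda>\<alpha>. c \<alpha> * mon \<alpha> z) has_sum f z) UNIV)"

lemma power_series_mono: "power_series f c s \<Longrightarrow> s \<le> t \<Longrightarrow> power_series f c t"
  unfolding power_series_def using wconv_mono wdisc_antimono by blast

lemma power_series_exists:
  assumes "wconv c s"
  shows "power_series (\<lambda>z. \<Sum>\<^sub>\<infinity>\<alpha>. c \<alpha> * mon \<alpha> z) c s"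
  unfolding power_series_def
  by (intro conjI ballI assms has_sum_infsum, rule abs_summable_summable, rule wconv_norm_summable[OF assms])

text \<open>Weights are integers, so every surviving term has weight at least \<open>N + 1\<close>.
  Raising \<open>s\<close> by \<open>k\<close> therefore shrinks the norm by
  \<open>(N + 1) ^ k\<close>, while the right-hand side shrinks only by \<open>N ^ k\<close>; the
  quotient of the two is \<open>q ^ k\<close>, which tends to 0.\<close>

lemma wconv_tail_small:
  fixes c :: "('n::finite \<Rightarrow> nat) \<Rightarrow> complex"
  assumes c: "wconv c s0" and van: "\<And>\<alpha>. wt \<alpha> \<le> N \<Longrightarrow> c \<alpha> = 0" and e: "e > 0" and N: "N > 0"
  shows "\<exists>S\<ge>s0. \<forall>s\<ge>S. wnorm c s \<le> e / real N ^ s"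
proof -
  define C where "C = wnorm c s0"
  have C0: "C \<ge> 0" unfolding C_def by (rule infsum_nonneg) simp
  define q where "q = real N / (real N + 1)"
  have q: "0 < q" "q < 1" using N by (auto simp: q_def)
  have "(\<lambda>k. C * real N ^ s0 * q ^ k) \<longlonglongrightarrow> C * real N ^ s0 * 0"
    by (intro tendsto_mult_left LIMSEQ_realpow_zero) (use q in auto)
  then have "\<forall>\<^sub>F k in sequentially. C * real N ^ s0 * q ^ k < e"
    using e order_tendstoD(2)[of _ 0 sequentially e] by simp
  then obtain K where K: "\<And>k. k \<ge> K \<Longrightarrow> C * real N ^ s0 * q ^ k < e"
    unfolding eventually_sequentially by blast
  have "wnorm c s \<le> e / real N ^ s" if "s \<ge> s0 + K" for s
  proof -
    define k where "k = s - s0"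
    have k: "s = s0 + k" "k \<ge> K" using that by (auto simp: k_def)
    have "wnorm c s \<le> (\<Sum>\<^sub>\<infinity>\<alpha>. (1 / (real N + 1) ^ k) * (cmod (c \<alpha>) / real (wt \<alpha>) ^ s0))"
    proof (rule infsum_mono)
      show "(\<lambda>\<alpha>. cmod (c \<alpha>) / real (wt \<alpha>) ^ s) summable_on UNIV"
        using wconv_mono[OF c, of s] k unfolding wconv_def by simp
      show "(\<lambda>\<alpha>. (1 / (real N + 1) ^ k) * (cmod (c \<alpha>) / real (wt \<alpha>) ^ s0)) summable_on UNIV"
        using c unfolding wconv_def by (rule summable_on_cmult_right)
      fix \<alpha> :: "'n \<Rightarrow> nat"
      show "cmod (c \<alpha>) / real (wt \<alpha>) ^ s \<le> (1 / (real N + 1) ^ k) * (cmod (c \<alpha>) / real (wt \<alpha>) ^ s0)"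
      proof (cases "wt \<alpha> \<le> N")
        case False
        then have "real N + 1 \<le> real (wt \<alpha>)" by linarith
        then have "1 / real (wt \<alpha>) ^ k \<le> 1 / (real N + 1) ^ k"
          by (intro divide_left_mono power_mono mult_pos_pos zero_less_power) auto
        then have "(1 / real (wt \<alpha>) ^ k) * (cmod (c \<alpha>) / real (wt \<alpha>) ^ s0) \<le>
            (1 / (real N + 1) ^ k) * (cmod (c \<alpha>) / real (wt \<alpha>) ^ s0)"
          by (intro mult_right_mono) auto
        then show ?thesis by (simp add: k power_add mult.commute)
      qed (simp add: van)
    qed
    also have "\<dots> = C / (real N + 1) ^ k"
      unfolding C_def by (subst infsum_cmult_right') simp
    also have "\<dots> = (C * real N ^ s0 * q ^ k) / real N ^ s"
      using N by (simp add: q_def k power_add power_divide)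
    also have "\<dots> \<le> e / real N ^ s"
      using K[OF k(2)] by (intro divide_right_mono) auto
    finally show ?thesis .
  qed
  then show ?thesis by (intro exI[of _ "s0 + K"]) auto
qed

lemma has_sum_UNIV_singleton:
  fixes c :: "'a \<Rightarrow> 'b :: {comm_monoid_add, topological_space}"
  assumes "\<And>\<alpha>. \<alpha> \<noteq> a \<Longrightarrow> c \<alpha> = 0"
  shows "(c has_sum c a) UNIV"
proof -
  have "(c has_sum c a) {a}" by (rule has_sum_finiteI) auto
  then show ?thesis
    by (rule has_sum_cong_neutral[THEN iffD1, rotated -1]) (use assms in auto)
qed

lemma has_sum_norm_le:
  fixes f :: "'a \<Rightarrow> 'b :: banach"
  assumes "(f has_sum a) A" "(g has_sum b) A" "\<And>x. norm (f x) \<le> g x"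
  shows "norm a \<le> b"
proof -
  have "(\<lambda>x. norm (f x)) summable_on A"
    by (rule summable_on_comparison_test[where f = g]) (use assms in \<open>auto simp: summable_on_def\<close>)
  then have s: "((\<lambda>x. norm (f x)) has_sum (\<Sum>\<^sub>\<infinity>x\<in>A. norm (f x))) A" by (rule has_sum_infsum)
  have "norm a \<le> (\<Sum>\<^sub>\<infinity>x\<in>A. norm (f x))" by (rule norm_has_sum_bound[OF s assms(1)])
  also have "\<dots> \<le> b" by (rule has_sum_mono[OF s assms(2,3)])
  finally show ?thesis .
qed

lemma minimal_wt:
  assumes "P \<alpha>"
  obtains \<beta> where "P \<beta>" "\<And>\<gamma>. wt \<gamma> < wt \<beta> \<Longrightarrow> \<not> P \<gamma>"
proof -
  obtain \<beta> where "P \<beta>" "\<forall>\<gamma>. P \<gamma> \<longrightarrow> wt \<beta> \<le> wt \<gamma>"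
    using ex_has_least_nat[of P \<alpha> wt] assms by blast
  then show ?thesis by (intro that[of \<beta>]) auto
qed

lemma wconv_update: "wconv c s \<Longrightarrow> wconv (c(a := x)) s"
proof -
  assume "wconv c s"
  then have "(\<lambda>\<alpha>. cmod (c \<alpha>) / real (wt \<alpha>) ^ s) summable_on (UNIV - {a})"
    unfolding wconv_def by (rule summable_on_subset_banach) auto
  then have "(\<lambda>\<alpha>. cmod ((c(a := x)) \<alpha>) / real (wt \<alpha>) ^ s) summable_on (UNIV - {a})"
    by (rule summable_on_cong[THEN iffD1, rotated]) auto
  then have "(\<lambda>\<alpha>. cmod ((c(a := x)) \<alpha>) / real (wt \<alpha>) ^ s) summable_on insert a (UNIV - {a})"
    by (subst summable_on_insert_iff) 
  then show ?thesis by (simp add: wconv_def insert_UNIV)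
qed

text \<open>At the points \<open>wpoint s\<close> a power series is a Dirichlet series, whose leading coefficient is recovered
  as \<open>s\<close> tends to infinity.\<close>

lemma power_series_coeff_zero:
  fixes c :: "('n::finite \<Rightarrow> nat) \<Rightarrow> complex"
  assumes c: "wconv c s0"
    and zero: "\<And>s. s \<ge> s0 \<Longrightarrow> ((\<lambda>\<alpha>. c \<alpha> * mon \<alpha> (wpoint s)) has_sum 0) UNIV"
  shows "c = (\<lambda>\<alpha>. 0)"
proof (rule ccontr)
  assume "c \<noteq> (\<lambda>\<alpha>. 0)"
  then obtain \<alpha> where "c \<alpha> \<noteq> 0" by auto
  then obtain a where a: "c a \<noteq> 0" "\<And>\<gamma>. wt \<gamma> < wt a \<Longrightarrow> c \<gamma> = 0"
    by (rule minimal_wt[of "\<lambda>\<alpha>. c \<alpha> \<noteq> 0"]) auto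
  define d where "d = c(a := 0)"
  have d: "wconv d s0" unfolding d_def by (rule wconv_update[OF c])
  have van: "d \<alpha> = 0" if "wt \<alpha> \<le> wt a" for \<alpha>
    using that a(2)[of \<alpha>] wt_inj[of \<alpha> a] by (auto simp: d_def le_less)
  \<comment> \<open>A vanishing series forces the leading term to be cancelled by the rest, which is
    impossible once the rest is at most half of it.\<close>
  obtain S where S: "S \<ge> s0" "wnorm d S \<le> (cmod (c a) / 2) / real (wt a) ^ S"
    using wconv_tail_small[OF d van, where e = "cmod (c a) / 2"] a(1) wt_pos[of a] by auto
  let ?t = "\<lambda>\<alpha>. mon \<alpha> (wpoint S) :: complex"
  have "((\<lambda>\<alpha>. if \<alpha> = a then - (c a * ?t a) else 0) has_sum - (c a * ?t a)) UNIV"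
    using has_sum_UNIV_singleton[of a "\<lambda>\<alpha>. if \<alpha> = a then - (c a * ?t a) else 0"] by simp
  from has_sum_add[OF zero[OF S(1)] this]
  have "((\<lambda>\<alpha>. c \<alpha> * ?t \<alpha> + (if \<alpha> = a then - (c a * ?t a) else 0)) has_sum - (c a * ?t a)) UNIV"
    by simp
  then have hs: "((\<lambda>\<alpha>. d \<alpha> * ?t \<alpha>) has_sum - (c a * ?t a)) UNIV"
    by (rule has_sum_cong[THEN iffD1, rotated]) (auto simp: d_def)
  have sm: "(\<lambda>\<alpha>. norm (d \<alpha> * ?t \<alpha>)) summable_on UNIV"
    by (rule wconv_norm_summable[OF wconv_mono[OF d S(1)] wpoint_in_wdisc])
  have "cmod (c a) / real (wt a) ^ S = norm (- (c a * ?t a))"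
    by (simp add: mon_wpoint norm_mult norm_divide norm_power)
  also have "\<dots> \<le> (\<Sum>\<^sub>\<infinity>\<alpha>. norm (d \<alpha> * ?t \<alpha>))"
    using norm_infsum_bound[OF sm] infsumI[OF hs] by simp
  also have "\<dots> = wnorm d S"
    by (simp add: mon_wpoint norm_mult norm_divide norm_power)
  also note S(2)
  finally show False using a(1) wt_pos[of a] by (simp add: field_simps)
qed

section \<open>Operations on power series\<close>

lemma power_series_add:
  assumes "power_series f c s" "power_series g d s"
  shows "power_series (\<lambda>z. f z + g z) (\<lambda>\<alpha>. c \<alpha> + d \<alpha>) s"
proof -
  have "wconv (\<lambda>\<alpha>. c \<alpha> + d \<alpha>) s"
    unfolding wconv_def
  proof (rule summable_on_comparison_test)
    show "(\<lambda>\<alpha>. cmod (c \<alpha>) / real (wt \<alpha>) ^ s + cmod (d \<alpha>) / real (wt \<alpha>) ^ s) summable_on UNIV"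
      using assms unfolding power_series_def wconv_def by (intro summable_on_add) auto
  qed (auto simp: add_divide_distrib[symmetric] intro!: divide_right_mono norm_triangle_ineq)
  moreover have "((\<lambda>\<alpha>. (c \<alpha> + d \<alpha>) * mon \<alpha> z) has_sum (f z + g z)) UNIV" if "z \<in> wdisc s" for z
    using has_sum_add[of "\<lambda>\<alpha>. c \<alpha> * mon \<alpha> z" UNIV "f z" "\<lambda>\<alpha>. d \<alpha> * mon \<alpha> z" "g z"] assms that
    by (simp add: power_series_def distrib_right)
  ultimately show ?thesis by (simp add: power_series_def)
qed

lemma power_series_cmult:
  assumes "power_series f c s"
  shows "power_series (\<lambda>z. a * f z) (\<lambda>\<alpha>. a * c \<alpha>) s"
proof -
  have "wconv (\<lambda>\<alpha>. a * c \<alpha>) s"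
    using assms summable_on_cmult_right[of "\<lambda>\<alpha>. cmod (c \<alpha>) / real (wt \<alpha>) ^ s" UNIV "cmod a"]
    unfolding power_series_def wconv_def by (simp add: norm_mult mult.assoc)
  moreover have "((\<lambda>\<alpha>. a * c \<alpha> * mon \<alpha> z) has_sum (a * f z)) UNIV" if "z \<in> wdisc s" for z
    using has_sum_cmult_right[of "\<lambda>\<alpha>. c \<alpha> * mon \<alpha> z" UNIV "f z" a] assms that
    by (simp add: power_series_def mult.assoc)
  ultimately show ?thesis by (simp add: power_series_def)
qed

lemma power_series_diff:
  assumes "power_series f c s" "power_series g d s"
  shows "power_series (\<lambda>z. f z - g z) (\<lambda>\<alpha>. c \<alpha> - d \<alpha>) s"
  using power_series_add[OF assms(1) power_series_cmult[OF assms(2), of "-1"]] by simp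

lemma power_series_unique:
  fixes f g :: "complex^'n \<Rightarrow> complex"
  assumes f: "power_series f c s" and g: "power_series g d t"
    and eq: "\<forall>\<^sub>F z in nhds 0. f z = g z"
  shows "c = d"
proof -
  obtain U where U: "open U" "0 \<in> U" "\<And>z. z \<in> U \<Longrightarrow> f z = g z"
    using eq unfolding eventually_nhds by blast
  obtain v where v: "wdisc v \<subseteq> U" using wdisc_subset_nhd[OF U(1,2)] by blast
  define m where "m = max v (max s t)"
  have ps: "power_series (\<lambda>z. f z - g z) (\<lambda>\<alpha>. c \<alpha> - d \<alpha>) m"
    by (intro power_series_diff power_series_mono[OF f] power_series_mono[OF g]) (auto simp: m_def)
  have "(\<lambda>\<alpha>. c \<alpha> - d \<alpha>) = (\<lambda>\<alpha>. 0)"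
  proof (rule power_series_coeff_zero)
    show "wconv (\<lambda>\<alpha>. c \<alpha> - d \<alpha>) m" using ps by (simp add: power_series_def)
    fix k assume k: "m \<le> k"
    have "wpoint k \<in> wdisc m" using wpoint_in_wdisc wdisc_antimono[OF k] by blast
    moreover have "f (wpoint k) - g (wpoint k) = 0"
      using U(3)[of "wpoint k"] v wpoint_in_wdisc[of k] wdisc_antimono[of v k] k by (auto simp: m_def)
    ultimately show "((\<lambda>\<alpha>. (c \<alpha> - d \<alpha>) * mon \<alpha> (wpoint k)) has_sum 0) UNIV"
      using ps unfolding power_series_def by force
  qed
  then show ?thesis by (metis eq_iff_diff_eq_0 ext)
qed

text \<open>Multiplication by a monomial translates the exponents. Since \<open>wt\<close> is
  multiplicative the norm is scaled by exactly \<open>1 / wt \<beta> ^ s\<close>, so the ratio of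
  norm to leading term is inherited by all monomial multiples of a divisor.\<close>

lemma power_series_shift:
  assumes f: "power_series f c s"
  shows "power_series (\<lambda>z. mon \<beta> z * f z)
    (\<lambda>\<alpha>. if \<beta> \<le> \<alpha> then c (\<lambda>i. \<alpha> i - \<beta> i) else 0) s" (is "power_series _ ?d s")
    and "(\<Sum>\<^sub>\<infinity>\<alpha>. cmod ((if \<beta> \<le> \<alpha> then c (\<lambda>i. \<alpha> i - \<beta> i) else 0)) / real (wt \<alpha>) ^ s)
      = wnorm c s / real (wt \<beta>) ^ s"
proof -
  let ?h = "\<lambda>\<alpha> i. \<alpha> i + \<beta> i"
  have inj: "inj ?h" by (auto simp: inj_def fun_eq_iff)
  have range: "\<alpha> \<in> range ?h" if "\<beta> \<le> \<alpha>" for \<alpha>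
    using that by (intro image_eqI[of _ _ "\<lambda>i. \<alpha> i - \<beta> i"]) (auto simp: le_fun_def)
  have le: "\<beta> \<le> ?h \<alpha>" for \<alpha> by (simp add: le_fun_def)
  have zero: "?d \<alpha> = 0" if "\<alpha> \<notin> range ?h" for \<alpha> using that range by auto
  have "(\<lambda>\<alpha>. cmod (c \<alpha>) / real (wt \<alpha>) ^ s) summable_on UNIV"
    using f by (simp add: power_series_def wconv_def)
  then have hs: "((\<lambda>\<alpha>. (cmod (c \<alpha>) / real (wt \<alpha>) ^ s) / real (wt \<beta>) ^ s) has_sum
      wnorm c s / real (wt \<beta>) ^ s) UNIV"
    using has_sum_cmult_left[OF has_sum_infsum, of "\<lambda>\<alpha>. cmod (c \<alpha>) / real (wt \<alpha>) ^ s" UNIV "1 / real (wt \<beta>) ^ s"]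
    by simp
  have "((\<lambda>\<alpha>. cmod (?d \<alpha>) / real (wt \<alpha>) ^ s) has_sum
      wnorm c s / real (wt \<beta>) ^ s) (range ?h)"
    by (subst has_sum_reindex[OF inj]) (use hs le in \<open>simp add: o_def wt_add power_mult_distrib\<close>)
  then have hs': "((\<lambda>\<alpha>. cmod (?d \<alpha>) / real (wt \<alpha>) ^ s) has_sum
      wnorm c s / real (wt \<beta>) ^ s) UNIV"
    by (rule has_sum_cong_neutral[THEN iffD1, rotated -1]) (use zero in auto)
  show "wnorm (?d) s
      = wnorm c s / real (wt \<beta>) ^ s"
    by (rule infsumI[OF hs'])
  have "((\<lambda>\<alpha>. ?d \<alpha> * mon \<alpha> z) has_sum (mon \<beta> z * f z)) UNIV" if "z \<in> wdisc s" for z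
  proof -
    have "((\<lambda>\<alpha>. mon \<beta> z * (c \<alpha> * mon \<alpha> z)) has_sum mon \<beta> z * f z) UNIV"
      using f that by (intro has_sum_cmult_right) (auto simp: power_series_def)
    then have "((\<lambda>\<alpha>. ?d \<alpha> * mon \<alpha> z) has_sum (mon \<beta> z * f z)) (range ?h)"
      by (subst has_sum_reindex[OF inj]) (use le in \<open>simp add: o_def mon_add mult_ac\<close>)
    then show ?thesis
      by (rule has_sum_cong_neutral[THEN iffD1, rotated -1]) (use zero in auto)
  qed
  then show "power_series (\<lambda>z. mon \<beta> z * f z) ?d s"
    using hs' unfolding power_series_def wconv_def summable_on_def by blast
qed

lemma power_series_mon: "power_series (mon \<beta>) (\<lambda>\<alpha>. if \<alpha> = \<beta> then 1 else 0) s"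
  unfolding power_series_def wconv_def
proof (intro conjI ballI)
  show "(\<lambda>\<alpha>. cmod (if \<alpha> = \<beta> then 1 else 0) / real (wt \<alpha>) ^ s) summable_on UNIV"
    using has_sum_UNIV_singleton[of \<beta> "\<lambda>\<alpha>. cmod (if \<alpha> = \<beta> then 1 else 0) / real (wt \<alpha>) ^ s"]
    unfolding summable_on_def by fastforce
  show "((\<lambda>\<alpha>. (if \<alpha> = \<beta> then 1 else 0) * mon \<alpha> z) has_sum mon \<beta> z) UNIV" for z
    using has_sum_UNIV_singleton[of \<beta> "\<lambda>\<alpha>. (if \<alpha> = \<beta> then 1 else 0) * mon \<alpha> z"] by simp
qed

text \<open>The Weierstrass M-test, with the summands of \<open>wnorm c s\<close> as majorants. The
  finite sets \<open>{\<alpha>. wt \<alpha> \<le> n}\<close> exhaust the exponents, which turns the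
  unordered sum into the limit of a sequence of polynomials.\<close>

lemma power_series_imp_holomorphic:
  fixes f :: "complex^'n \<Rightarrow> complex"
  assumes f: "power_series f c s"
  shows "holomorphic_near_0 f"
proof -
  define U where "U = interior (wdisc s :: (complex^'n) set)"
  have "open U" and Us: "U \<subseteq> wdisc s" by (simp_all add: U_def interior_subset)
  have "0 \<in> U"
    using eventually_in_wdisc[of s] unfolding U_def eventually_nhds interior_def by blast
  define F where "F n z = (\<Sum>\<alpha>\<in>{\<alpha>. wt \<alpha> \<le> n}. c \<alpha> * mon \<alpha> z)" for n z
  have F: "F n mv_holomorphic_on U" for n
    unfolding F_def by (intro mv_holomorphic_on_sum mv_holomorphic_on_mult mv_holomorphic_on_const mv_holomorphic_on_mon)
  let ?a = "\<lambda>\<alpha>. cmod (c \<alpha>) / real (wt \<alpha>) ^ s"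
  have a: "?a summable_on UNIV" using f by (simp add: power_series_def wconv_def)
  have bound: "cmod (F n z - f z) \<le> (\<Sum>\<^sub>\<infinity>\<alpha>. ?a \<alpha>) - (\<Sum>\<alpha>\<in>{\<alpha>. wt \<alpha> \<le> n}. ?a \<alpha>)" if z: "z \<in> U" for n z
  proof -
    let ?X = "{\<alpha> :: 'n \<Rightarrow> nat. wt \<alpha> \<le> n}"
    have fin: "finite ?X" by (rule finite_wt_le)
    have hs: "((\<lambda>\<alpha>. c \<alpha> * mon \<alpha> z) has_sum f z) UNIV" using f z Us by (auto simp: power_series_def)
    have "((\<lambda>\<alpha>. c \<alpha> * mon \<alpha> z) has_sum (f z - F n z)) (UNIV - ?X)"
      unfolding F_def by (intro has_sum_Diff hs has_sum_finite fin) auto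
    moreover have "(?a has_sum ((\<Sum>\<^sub>\<infinity>\<alpha>. ?a \<alpha>) - (\<Sum>\<alpha>\<in>?X. ?a \<alpha>))) (UNIV - ?X)"
      by (intro has_sum_Diff has_sum_infsum a has_sum_finite fin) auto
    moreover have "norm (c \<alpha> * mon \<alpha> z) \<le> ?a \<alpha>" for \<alpha>
      using mult_left_mono[OF cmod_mon_le[of z s \<alpha>], of "cmod (c \<alpha>)"] z Us by (auto simp: norm_mult)
    ultimately have "norm (f z - F n z) \<le> (\<Sum>\<^sub>\<infinity>\<alpha>. ?a \<alpha>) - (\<Sum>\<alpha>\<in>?X. ?a \<alpha>)"
      by (rule has_sum_norm_le)
    then show ?thesis by (simp add: norm_minus_commute)
  qed
  have fl: "filterlim (\<lambda>n. {\<alpha> :: 'n \<Rightarrow> nat. wt \<alpha> \<le> n}) (finite_subsets_at_top UNIV) sequentially"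
    unfolding filterlim_finite_subsets_at_top
  proof (intro allI impI)
    fix X :: "('n \<Rightarrow> nat) set" assume X: "finite X \<and> X \<subseteq> UNIV"
    have "\<forall>\<^sub>F n in sequentially. Max (insert 0 (wt ` X)) \<le> n" by (rule eventually_ge_at_top)
    then show "\<forall>\<^sub>F n in sequentially. finite {\<alpha>. wt \<alpha> \<le> n} \<and> X \<subseteq> {\<alpha>. wt \<alpha> \<le> n} \<and> {\<alpha>. wt \<alpha> \<le> n} \<subseteq> UNIV"
      by (rule eventually_mono) (use X in \<open>auto simp: finite_wt_le\<close>)
  qed
  have "(sum ?a \<longlongrightarrow> (\<Sum>\<^sub>\<infinity>\<alpha>. ?a \<alpha>)) (finite_subsets_at_top UNIV)"
    using has_sum_infsum[OF a] by (simp add: has_sum_def)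
  from filterlim_compose[OF this fl]
  have lim: "(\<lambda>n. (\<Sum>\<^sub>\<infinity>\<alpha>. ?a \<alpha>) - (\<Sum>\<alpha>\<in>{\<alpha>. wt \<alpha> \<le> n}. ?a \<alpha>)) \<longlonglongrightarrow> (\<Sum>\<^sub>\<infinity>\<alpha>. ?a \<alpha>) - (\<Sum>\<^sub>\<infinity>\<alpha>. ?a \<alpha>)"
    by (intro tendsto_intros)
  have ul: "uniform_limit U F f sequentially"
  proof (rule uniform_limitI)
    fix e :: real assume "e > 0"
    then have "\<forall>\<^sub>F n in sequentially. (\<Sum>\<^sub>\<infinity>\<alpha>. ?a \<alpha>) - (\<Sum>\<alpha>\<in>{\<alpha>. wt \<alpha> \<le> n}. ?a \<alpha>) < e"
      using order_tendstoD(2)[OF lim] by simp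
    then show "\<forall>\<^sub>F n in sequentially. \<forall>z\<in>U. dist (F n z) (f z) < e"
      by (rule eventually_mono) (use bound in \<open>auto simp: dist_norm intro: le_less_trans\<close>)
  qed
  have "f mv_holomorphic_on U"
  proof (rule mv_holomorphic_on_uniform_limit[OF F \<open>open U\<close>])
    fix z assume "z \<in> U"
    then obtain r where r: "r > 0" "cball z r \<subseteq> U"
      using \<open>open U\<close> unfolding open_contains_cball by metis
    show "\<exists>r>0. cball z r \<subseteq> U \<and> uniform_limit (cball z r) F f sequentially"
      by (intro exI[of _ r] conjI r uniform_limit_on_subset[OF ul])
  qed
  then show ?thesis using \<open>open U\<close> \<open>0 \<in> U\<close> unfolding holomorphic_near_0_def by blast
qed

section \<open>Taylor expansion\<close>

definition taylor_coeff :: "(complex^'n \<Rightarrow> complex) \<Rightarrow> ('n \<Rightarrow> nat) \<Rightarrow> complex" where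
  "taylor_coeff f \<alpha> = multi_deriv \<alpha> f 0 / of_nat (mi_fact \<alpha>)"

lemma coords_props: "distinct (coords :: 'n::finite list)" "set (coords :: 'n list) = UNIV"
proof -
  obtain xs :: "'n list" where "distinct xs \<and> set xs = UNIV"
    using finite_distinct_list[of "UNIV :: 'n set"] by auto
  from someI[of "\<lambda>xs. distinct xs \<and> set xs = UNIV", OF this]
  show "distinct (coords :: 'n list)" "set (coords :: 'n list) = UNIV"
    unfolding coords_def by auto
qed

lemma taylor_coeff_bound:
  fixes f :: "complex^'n \<Rightarrow> complex"
  assumes f: "f mv_holomorphic_on U" "open U" and R: "R > 0" "polydisc R \<subseteq> U"
    and M: "\<And>z. z \<in> polydisc R \<Longrightarrow> cmod (f z) \<le> M"
  shows "cmod (taylor_coeff f \<alpha>) \<le> M / R ^ mi_size \<alpha>"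
proof -
  have z: "(0 :: complex^'n) \<in> polydisc R" using R by (simp add: polydisc_def)
  have z0: "zero_out coords 0 = (0 :: complex^'n)" by (simp add: zero_out_def vec_eq_iff)
  have "cmod (multi_deriv \<alpha> f 0) \<le> (\<Prod>i\<in>UNIV. fact (\<alpha> i) / R ^ \<alpha> i) * M"
    using foldr_cpartial_bound[OF f R M coords_props(1) z, of \<alpha>] coords_props(2)[where 'n = 'n]
    by (simp add: multi_deriv_def z0)
  also have "(\<Prod>i\<in>UNIV. fact (\<alpha> i) / R ^ \<alpha> i) = real (mi_fact \<alpha>) / R ^ mi_size \<alpha>"
    by (simp add: mi_fact_def mi_size_def prod_dividef power_sum)
  finally have "cmod (multi_deriv \<alpha> f 0) \<le> real (mi_fact \<alpha>) / R ^ mi_size \<alpha> * M" .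
  moreover have "mi_fact \<alpha> > 0" by (simp add: mi_fact_def prod_pos)
  ultimately show ?thesis by (simp add: taylor_coeff_def norm_divide field_simps)
qed

text \<open>Cauchy estimates grow geometrically in the degree. As
  \<open>2 ^ mi_size \<alpha> \<le> wt \<alpha>\<close>, this growth is at most a fixed power of the
  weight, so every germ falls into one of the weighted spaces.\<close>

lemma inverse_power_mi_size_le:
  assumes "R > 0"
  shows "\<exists>k. \<forall>\<alpha> :: 'n::finite \<Rightarrow> nat. (1 / R) ^ mi_size \<alpha> \<le> real (wt \<alpha>) ^ k"
proof -
  obtain k where k: "1 / R < 2 ^ k" using real_arch_pow[of 2 "1 / R"] by auto
  have "(1 / R) ^ mi_size \<alpha> \<le> real (wt \<alpha>) ^ k" for \<alpha> :: "'n \<Rightarrow> nat"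
  proof -
    have "(1 / R) ^ mi_size \<alpha> \<le> (2 ^ k) ^ mi_size \<alpha>" using k assms by (intro power_mono) auto
    also have "\<dots> = real (2 ^ mi_size \<alpha>) ^ k" by (simp add: power_mult[symmetric] mult.commute)
    also have "\<dots> \<le> real (wt \<alpha>) ^ k"
      by (intro power_mono) (use two_power_mi_size_le_wt[of \<alpha>] in linarith, simp)
    finally show ?thesis .
  qed
  then show ?thesis by blast
qed

text \<open>Injectivity of \<open>wt\<close> makes this a subseries of the sum of
  \<open>1 / m ^ 2\<close>.\<close>

lemma summable_inverse_wt_square: "(\<lambda>\<alpha> :: 'n::finite \<Rightarrow> nat. 1 / real (wt \<alpha>) ^ 2) summable_on UNIV"
proof -
  have "(\<lambda>m. 1 / real m ^ 2) summable_on UNIV"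
    using inverse_power_summable[of 2, where 'a = real]
    by (subst summable_on_UNIV_nonneg_real_iff) (auto simp: field_simps)
  then have "(\<lambda>m. 1 / real m ^ 2) summable_on range (wt :: ('n \<Rightarrow> nat) \<Rightarrow> nat)"
    by (rule summable_on_subset_banach) auto
  then show ?thesis
    by (subst (asm) summable_on_reindex) (auto simp: inj_def wt_inj o_def)
qed

text \<open>One more coordinate is expanded in each induction step: the one-variable power series in
  \<open>z $ i\<close> is inserted into every term of the sum so far. Joint absolute summability,
  from the Cauchy estimates, permits merging the iterated sum into one.\<close>

lemma taylor_partial:
  fixes f :: "complex^'n \<Rightarrow> complex"
  assumes f: "f mv_holomorphic_on U" "open U" and R: "R > 0" "polydisc R \<subseteq> U"
    and M: "\<And>z. z \<in> polydisc R \<Longrightarrow> cmod (f z) \<le> M"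
    and k: "\<And>\<alpha> :: 'n \<Rightarrow> nat. (1 / R) ^ mi_size \<alpha> \<le> real (wt \<alpha>) ^ k"
    and z: "z \<in> wdisc (k + 2)" "\<And>i. cmod (z $ i) < R"
    and "distinct is"
  shows "((\<lambda>\<alpha>. foldr (\<lambda>i. cpartial i ^^ \<alpha> i) is f (zero_out is z) * (\<Prod>i\<in>set is. z $ i ^ \<alpha> i / fact (\<alpha> i)))
     has_sum f z) {\<alpha>. \<forall>i. i \<notin> set is \<longrightarrow> \<alpha> i = 0}"
  using \<open>distinct is\<close>
proof (induction "is")
  case Nil
  have "{\<alpha> :: 'n \<Rightarrow> nat. \<forall>i. \<alpha> i = 0} = {\<lambda>i. 0}" by auto
  then show ?case by (simp add: zero_out_def has_sum_finiteI)
next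
  case (Cons i "is")
  let ?D = "\<lambda>\<alpha> is. foldr (\<lambda>i. cpartial i ^^ \<alpha> i) is f"
  let ?A = "\<lambda>is. {\<alpha> :: 'n \<Rightarrow> nat. \<forall>i. i \<notin> set is \<longrightarrow> \<alpha> i = 0}"
  let ?T = "\<lambda>is \<alpha>. ?D \<alpha> is (zero_out is z) * (\<Prod>i\<in>set is. z $ i ^ \<alpha> i / fact (\<alpha> i))"
  have zR: "z \<in> polydisc R" using z(2) by (simp add: polydisc_def less_imp_le)
  have M0: "M \<ge> 0" using M[OF zR] norm_ge_zero order_trans by blast
  have ni: "i \<notin> set is" and d: "distinct is" using Cons.prems by auto
  \<comment> \<open>Of the \<open>k + 2\<close> powers of the weight gained on
    \<open>wdisc (k + 2)\<close>, \<open>k\<close> pay for the Cauchy factor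
    \<open>(1 / R) ^ mi_size \<alpha>\<close> and 2 are left for summability.\<close>
  have bound: "norm (?T (i # is) \<alpha>) \<le> M * (1 / real (wt \<alpha>) ^ 2)" if \<alpha>: "\<alpha> \<in> ?A (i # is)" for \<alpha>
  proof -
    let ?S = "set (i # is)"
    have "norm (?T (i # is) \<alpha>) \<le> ((\<Prod>j\<in>?S. fact (\<alpha> j) / R ^ \<alpha> j) * M) * (\<Prod>j\<in>?S. cmod (z $ j) ^ \<alpha> j / fact (\<alpha> j))"
      using foldr_cpartial_bound[OF f R M Cons.prems zR, of \<alpha>]
      by (simp only: norm_mult prod_norm[symmetric] norm_divide norm_power norm_fact)
        (intro mult_right_mono prod_nonneg; simp)
    also have "\<dots> = M * (\<Prod>j\<in>?S. (fact (\<alpha> j) / R ^ \<alpha> j) * (cmod (z $ j) ^ \<alpha> j / fact (\<alpha> j)))"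
      by (simp only: prod.distrib mult_ac)
    also have "(\<Prod>j\<in>?S. (fact (\<alpha> j) / R ^ \<alpha> j) * (cmod (z $ j) ^ \<alpha> j / fact (\<alpha> j)))
        = (\<Prod>j\<in>?S. (1 / R) ^ \<alpha> j * cmod (z $ j) ^ \<alpha> j)"
      by (intro prod.cong) (auto simp: power_divide)
    also have "\<dots> = (\<Prod>j\<in>UNIV. (1 / R) ^ \<alpha> j * cmod (z $ j) ^ \<alpha> j)"
      using \<alpha> by (intro prod.mono_neutral_left) auto
    also have "\<dots> = (1 / R) ^ mi_size \<alpha> * cmod (mon \<alpha> z)"
      by (simp add: prod.distrib mi_size_def power_sum mon_def prod_norm[symmetric] norm_power)
    also have "M * \<dots> \<le> M * (real (wt \<alpha>) ^ k * (1 / real (wt \<alpha>) ^ (k + 2)))"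
      using k cmod_mon_le[OF z(1)] M0 by (intro mult_left_mono mult_mono) auto
    also have "\<dots> = M * (1 / real (wt \<alpha>) ^ 2)"
      using wt_pos[of \<alpha>] by (simp add: power_add power2_eq_square)
    finally show ?thesis .
  qed
  have summable: "?T (i # is) summable_on ?A (i # is)"
  proof (rule abs_summable_summable, rule Infinite_Sum.abs_summable_on_comparison_test')
    show "(\<lambda>\<alpha>. M * (1 / real (wt \<alpha>) ^ 2)) summable_on ?A (i # is)"
      by (rule summable_on_subset_banach[OF summable_on_cmult_right[OF summable_inverse_wt_square]]) simp
  qed (rule bound)
  \<comment> \<open>An exponent supported on \<open>i # is\<close> is an exponent supported on
    \<open>is\<close> together with its entry at \<open>i\<close>.\<close>
  let ?h = "\<lambda>(\<beta>, m). \<beta>(i := m)"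
  have bij: "bij_betw ?h (?A is \<times> UNIV) (?A (i # is))"
  proof (rule bij_betwI[where g = "\<lambda>\<alpha>. (\<alpha>(i := 0), \<alpha> i)"])
    show "(\<lambda>\<alpha>. (\<alpha>(i := 0), \<alpha> i)) (?h x) = x" if "x \<in> ?A is \<times> UNIV" for x
      using that ni by (auto simp: fun_eq_iff)
  qed (auto simp: ni)
  have T: "?T (i # is) (?h (\<beta>, m)) =
      ((deriv ^^ m) (\<lambda>w. ?D \<beta> is (zero_out (i # is) z + axis i w)) 0 / fact m * (z $ i - 0) ^ m) *
        (\<Prod>j\<in>set is. z $ j ^ \<beta> j / fact (\<beta> j))" for \<beta> m
  proof -
    have D: "?D (\<beta>(i := m)) is = ?D \<beta> is"
      using ni by (intro foldr_cong) auto
    have P: "(\<Prod>j\<in>set is. z $ j ^ (\<beta>(i := m)) j / fact ((\<beta>(i := m)) j)) = (\<Prod>j\<in>set is. z $ j ^ \<beta> j / fact (\<beta> j))"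
      using ni by (intro prod.cong) auto
    have "(cpartial i ^^ m) (?D \<beta> is) (zero_out (i # is) z + axis i 0) =
        (deriv ^^ m) (\<lambda>w. ?D \<beta> is (zero_out (i # is) z + axis i w)) 0"
      by (rule cpartial_pow_eq_higher_deriv)
    then have C: "(cpartial i ^^ m) (?D \<beta> is) (zero_out (i # is) z) =
        (deriv ^^ m) (\<lambda>w. ?D \<beta> is (zero_out (i # is) z + axis i w)) 0"
      by (simp add: axis_eq_smult[of i 0])
    have "?T (i # is) (?h (\<beta>, m)) = (cpartial i ^^ m) (?D (\<beta>(i := m)) is) (zero_out (i # is) z) *
        (z $ i ^ m / fact m * (\<Prod>j\<in>set is. z $ j ^ (\<beta>(i := m)) j / fact ((\<beta>(i := m)) j)))"
      using ni by simp
    also have "\<dots> = (cpartial i ^^ m) (?D \<beta> is) (zero_out (i # is) z) *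
        (z $ i ^ m / fact m * (\<Prod>j\<in>set is. z $ j ^ \<beta> j / fact (\<beta> j)))"
      unfolding D P ..
    finally show ?thesis unfolding C by simp
  qed
  have inner: "((\<lambda>m. ?T (i # is) (?h (\<beta>, m))) has_sum ?T is \<beta>) UNIV" if \<beta>: "\<beta> \<in> ?A is" for \<beta>
  proof -
    have "(\<lambda>m. norm (?T (i # is) (?h (\<beta>, m)))) summable_on UNIV"
    proof (rule Infinite_Sum.abs_summable_on_comparison_test')
      have inj: "inj (\<lambda>m. \<beta>(i := m))" by (auto simp: inj_def fun_eq_iff split: if_splits)
      have "(\<lambda>\<alpha>. M * (1 / real (wt \<alpha>) ^ 2)) summable_on range (\<lambda>m. \<beta>(i := m))"
        by (rule summable_on_subset_banach[OF summable_on_cmult_right[OF summable_inverse_wt_square]]) simp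
      then show "(\<lambda>m. M * (1 / real (wt (\<beta>(i := m))) ^ 2)) summable_on UNIV"
        by (subst (asm) summable_on_reindex[OF inj]) (simp add: o_def)
      show "norm (?T (i # is) (?h (\<beta>, m))) \<le> M * (1 / real (wt (\<beta>(i := m))) ^ 2)" for m
        using bound[of "\<beta>(i := m)"] \<beta> by auto
    qed
    then have sm: "(\<lambda>m. ?T (i # is) (?h (\<beta>, m))) summable_on UNIV" by (rule abs_summable_summable)
    let ?g = "\<lambda>w. ?D \<beta> is (zero_out (i # is) z + axis i w)"
    have "?g holomorphic_on ball 0 R"
      using zero_out_axis_in_polydisc[OF _ zR] R
      by (intro holomorphic_on_axis_line[OF mv_holomorphic_on_foldr_cpartial[OF f] f(2)]) auto
    from holomorphic_power_series[OF this, of "z $ i"]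
    have "(\<lambda>m. (deriv ^^ m) ?g 0 / fact m * (z $ i - 0) ^ m) sums ?D \<beta> is (zero_out is z)"
      using z(2) zero_out_Cons[OF ni, of z] by simp
    then have "(\<lambda>m. ?T (i # is) (?h (\<beta>, m))) sums ?T is \<beta>"
      unfolding T by (rule sums_mult2)
    \<comment> \<open>One-variable theory yields the value of the ordered series, the bound yields
      unordered summability; uniqueness of limits identifies the two.\<close>
    from sums_unique2[OF has_sum_imp_sums[OF has_sum_infsum[OF sm]] this]
    show ?thesis using has_sum_infsum[OF sm] by (rule subst)
  qed
  have "((\<lambda>x. ?T (i # is) (?h x)) has_sum f z) (?A is \<times> UNIV)"
  proof (rule has_sum_SigmaI)
    show "(?T is has_sum f z) (?A is)" by (rule Cons.IH[OF d])
    show "(\<lambda>x. ?T (i # is) (?h x)) summable_on (?A is \<times> UNIV)"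
      by (rule summable_on_reindex_bij_betw[OF bij, THEN iffD2, OF summable])
  qed (rule inner)
  then show ?case by (rule has_sum_reindex_bij_betw[OF bij, THEN iffD1])
qed

lemma polydisc_subset_open:
  fixes U :: "(complex^'n) set"
  assumes "open U" "0 \<in> U"
  shows "\<exists>R>0. polydisc R \<subseteq> U"
proof -
  obtain r where r: "r > 0" "ball 0 r \<subseteq> U" using assms open_contains_ball by blast
  define R where "R = r / (2 * real CARD('n))"
  have "polydisc R \<subseteq> ball (0 :: complex^'n) r"
  proof
    fix z :: "complex^'n" assume z: "z \<in> polydisc R"
    have "norm z \<le> real CARD('n) * R" using z by (intro norm_le_card_mult) (simp add: polydisc_def)
    also have "\<dots> < r" using r by (simp add: R_def)
    finally show "z \<in> ball 0 r" by simp
  qed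
  moreover have "R > 0" using r by (simp add: R_def)
  ultimately show ?thesis using r by blast
qed

lemma compact_polydisc: "compact (polydisc R :: (complex^'n) set)"
  unfolding compact_eq_bounded_closed
proof
  have "norm z \<le> real CARD('n) * R" if "z \<in> polydisc R" for z :: "complex^'n"
    using that by (intro norm_le_card_mult) (simp add: polydisc_def)
  then show "bounded (polydisc R :: (complex^'n) set)" unfolding bounded_iff by blast
  have "closed (\<Inter>i. {z :: complex^'n. cmod (z $ i) \<le> R})"
    by (intro closed_INT ballI closed_Collect_le continuous_intros)
  moreover have "(polydisc R :: (complex^'n) set) = (\<Inter>i. {z. cmod (z $ i) \<le> R})"
    by (simp add: polydisc_def set_eq_iff)
  ultimately show "closed (polydisc R :: (complex^'n) set)" by simp
qed

lemma holomorphic_imp_power_series: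
  fixes f :: "complex^'n \<Rightarrow> complex"
  assumes "holomorphic_near_0 f"
  shows "\<exists>s. power_series f (taylor_coeff f) s"
proof -
  obtain U where U: "open U" "0 \<in> U" "f mv_holomorphic_on U"
    using assms unfolding holomorphic_near_0_def by blast
  obtain R where R: "R > 0" "polydisc R \<subseteq> U" using polydisc_subset_open[OF U(1,2)] by blast
  have "compact (f ` polydisc R)"
    by (intro compact_continuous_image continuous_on_subset[OF mv_holomorphic_on_imp_continuous_on[OF U(3)] R(2)] compact_polydisc)
  then obtain M where "\<forall>x\<in>f ` polydisc R. cmod x \<le> M" using compact_imp_bounded bounded_iff by metis
  then have M: "\<And>z. z \<in> polydisc R \<Longrightarrow> cmod (f z) \<le> M" by blast
  have M0: "M \<ge> 0" using order_trans[OF norm_ge_zero M[of 0]] R by (simp add: polydisc_def)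
  obtain k where k: "\<And>\<alpha> :: 'n \<Rightarrow> nat. (1 / R) ^ mi_size \<alpha> \<le> real (wt \<alpha>) ^ k"
    using inverse_power_mi_size_le[OF R(1)] by blast
  have "open (\<Inter>i. {z :: complex^'n. cmod (z $ i) < R})"
    by (intro open_INT ballI open_Collect_less continuous_intros) auto
  then obtain s0 where s0: "wdisc s0 \<subseteq> (\<Inter>i. {z :: complex^'n. cmod (z $ i) < R})"
    using wdisc_subset_nhd[of "\<Inter>i. {z :: complex^'n. cmod (z $ i) < R}"] R by auto
  \<comment> \<open>\<open>s0\<close> brings all coordinates below \<open>R\<close>, where the
    one-variable expansions converge; \<open>k + 2\<close> provides absolute summability.\<close>
  define s where "s = max s0 (k + 2)"
  have "wconv (taylor_coeff f) s"
  proof -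
    have "wconv (taylor_coeff f) (k + 2)"
      unfolding wconv_def
    proof (rule summable_on_comparison_test)
      show "(\<lambda>\<alpha> :: 'n \<Rightarrow> nat. M * (1 / real (wt \<alpha>) ^ 2)) summable_on UNIV"
        by (rule summable_on_cmult_right[OF summable_inverse_wt_square])
      fix \<alpha> :: "'n \<Rightarrow> nat"
      have "cmod (taylor_coeff f \<alpha>) \<le> M * (1 / R) ^ mi_size \<alpha>"
        using taylor_coeff_bound[OF U(3,1) R M] by (simp add: power_divide)
      also have "\<dots> \<le> M * real (wt \<alpha>) ^ k" by (rule mult_left_mono[OF k M0])
      finally have "cmod (taylor_coeff f \<alpha>) / real (wt \<alpha>) ^ (k + 2) \<le> M * real (wt \<alpha>) ^ k / real (wt \<alpha>) ^ (k + 2)"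
        by (rule divide_right_mono) simp
      also have "\<dots> = M * (1 / real (wt \<alpha>) ^ 2)" using wt_pos[of \<alpha>] by (simp add: power_add power2_eq_square)
      finally show "cmod (taylor_coeff f \<alpha>) / real (wt \<alpha>) ^ (k + 2) \<le> M * (1 / real (wt \<alpha>) ^ 2)" .
    qed simp
    then show ?thesis by (rule wconv_mono) (simp add: s_def)
  qed
  moreover have "((\<lambda>\<alpha>. taylor_coeff f \<alpha> * mon \<alpha> z) has_sum f z) UNIV" if z: "z \<in> wdisc s" for z
  proof -
    have z1: "z \<in> wdisc (k + 2)" using z wdisc_antimono[of "k + 2" s] by (auto simp: s_def)
    have z2: "cmod (z $ i) < R" for i using z wdisc_antimono[of s0 s] s0 by (auto simp: s_def)
    have z0: "zero_out coords z = 0" by (simp add: zero_out_def vec_eq_iff coords_props)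
    have eq: "multi_deriv \<alpha> f 0 * (\<Prod>i\<in>UNIV. z $ i ^ \<alpha> i / fact (\<alpha> i)) = taylor_coeff f \<alpha> * mon \<alpha> z" for \<alpha>
      by (simp add: taylor_coeff_def mon_def mi_fact_def prod_dividef of_nat_prod)
    show ?thesis
      using taylor_partial[OF U(3,1) R M k z1 z2 coords_props(1)]
      by (simp add: coords_props z0 multi_deriv_def[symmetric] eq)
  qed
  ultimately show ?thesis unfolding power_series_def by blast
qed

lemma taylor_coeff_eqI:
  assumes "power_series f c s"
  shows "taylor_coeff f = c"
proof -
  obtain t where "power_series f (taylor_coeff f) t"
    using holomorphic_imp_power_series[OF power_series_imp_holomorphic[OF assms]] by blast
  from power_series_unique[OF this assms] show ?thesis by simp
qed

section \<open>Dickson's lemma\<close>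

lemma nat_seq_mono_subseq:
  fixes a :: "nat \<Rightarrow> nat"
  shows "\<exists>\<phi> :: nat \<Rightarrow> nat. strict_mono \<phi> \<and> mono (\<lambda>n. a (\<phi> n))"
proof -
  obtain \<phi> :: "nat \<Rightarrow> nat" where \<phi>: "strict_mono \<phi>" "monoseq (\<lambda>n. a (\<phi> n))" using seq_monosub by blast
  show ?thesis
  proof (cases "incseq (\<lambda>n. a (\<phi> n))")
    case False
    then have dec: "decseq (\<lambda>n. a (\<phi> n))" using \<phi>(2) by (simp add: monoseq_iff)
    \<comment> \<open>A decreasing sequence of naturals is constant from the index where it attains
      its minimum.\<close>
    obtain N where N: "\<And>n. a (\<phi> N) \<le> a (\<phi> n)"
      using ex_has_least_nat[of "\<lambda>_. True" 0 "\<lambda>n. a (\<phi> n)"] by auto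
    have "a (\<phi> (n + N)) = a (\<phi> N)" for n
      using N[of "n + N"] decseqD[OF dec, of N "n + N"] by simp
    then have "mono (\<lambda>n. a (\<phi> (n + N)))" by (simp add: mono_def)
    moreover have "strict_mono (\<lambda>n. \<phi> (n + N))" using \<phi>(1) by (simp add: strict_mono_def)
    ultimately show ?thesis by (intro exI[of _ "\<lambda>n. \<phi> (n + N)"]) auto
  qed (use \<phi>(1) in blast)
qed

lemma multiindex_seq_mono_subseq:
  fixes a :: "nat \<Rightarrow> 'n \<Rightarrow> nat"
  assumes "finite S"
  shows "\<exists>\<phi> :: nat \<Rightarrow> nat. strict_mono \<phi> \<and> (\<forall>i\<in>S. mono (\<lambda>n. a (\<phi> n) i))"
  using assms
proof (induction S rule: finite_induct)
  case empty
  show ?case by (intro exI[of _ id]) (auto simp: strict_mono_def)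
next
  case (insert j S)
  then obtain \<phi> :: "nat \<Rightarrow> nat" where \<phi>: "strict_mono \<phi>" "\<forall>i\<in>S. mono (\<lambda>n. a (\<phi> n) i)" by blast
  obtain \<psi> :: "nat \<Rightarrow> nat" where \<psi>: "strict_mono \<psi>" "mono (\<lambda>n. a (\<phi> (\<psi> n)) j)"
    using nat_seq_mono_subseq[of "\<lambda>n. a (\<phi> n) j"] by blast
  have "strict_mono (\<lambda>n. \<phi> (\<psi> n))" using \<phi>(1) \<psi>(1) by (simp add: strict_mono_def)
  moreover have "mono (\<lambda>n. a (\<phi> (\<psi> n)) i)" if "i \<in> S" for i
    using \<phi>(2) that \<psi>(1) by (auto simp: mono_def strict_mono_less_eq)
  ultimately show ?case using \<psi>(2) by (intro exI[of _ "\<lambda>n. \<phi> (\<psi> n)"]) simp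
qed

lemma mi_size_strict_mono:
  assumes "\<alpha> \<le> \<beta>" "\<alpha> \<noteq> \<beta>" shows "mi_size \<alpha> < mi_size \<beta>"
  unfolding mi_size_def
proof (rule sum_strict_mono_ex1)
  show "\<forall>i\<in>UNIV. \<alpha> i \<le> \<beta> i" using assms by (simp add: le_fun_def)
  show "\<exists>i\<in>UNIV. \<alpha> i < \<beta> i" using assms by (metis UNIV_I ext le_fun_def le_neq_implies_less)
qed simp

text \<open>\<open>F\<close> consists of the minimal elements. An element of least degree below a
  given one is minimal, so \<open>F\<close> dominates from below; an infinite \<open>F\<close> would
  contain a sequence increasing in every coordinate along a subsequence, and thus two distinct
  comparable minimal elements.\<close>

lemma dickson:
  fixes M :: "('n::finite \<Rightarrow> nat) set"
  obtains F where "finite F" "F \<subseteq> M" "\<And>\<alpha>. \<alpha> \<in> M \<Longrightarrow> \<exists>\<beta>\<in>F. \<beta> \<le> \<alpha>"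
proof -
  define F where "F = {\<alpha>\<in>M. \<forall>\<beta>\<in>M. \<beta> \<le> \<alpha> \<longrightarrow> \<beta> = \<alpha>}"
  have "\<exists>\<beta>\<in>F. \<beta> \<le> \<alpha>" if "\<alpha> \<in> M" for \<alpha>
  proof -
    obtain \<beta> where \<beta>: "\<beta> \<in> M" "\<beta> \<le> \<alpha>" "\<And>\<gamma>. \<gamma> \<in> M \<Longrightarrow> \<gamma> \<le> \<alpha> \<Longrightarrow> mi_size \<beta> \<le> mi_size \<gamma>"
      using ex_has_least_nat[of "\<lambda>\<beta>. \<beta> \<in> M \<and> \<beta> \<le> \<alpha>" \<alpha> mi_size] \<open>\<alpha> \<in> M\<close> by blast
    have "\<gamma> = \<beta>" if "\<gamma> \<in> M" "\<gamma> \<le> \<beta>" for \<gamma>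
      using \<beta>(3)[OF that(1)] mi_size_strict_mono[OF that(2)] \<beta>(2) that(2) order_trans[OF that(2) \<beta>(2)]
      by (meson leD)
    then show ?thesis using \<beta> by (auto simp: F_def)
  qed
  moreover have "finite F"
  proof (rule ccontr)
    assume "infinite F"
    then obtain a :: "nat \<Rightarrow> 'n \<Rightarrow> nat" where a: "inj a" "range a \<subseteq> F"
      using infinite_countable_subset by blast
    obtain \<phi> :: "nat \<Rightarrow> nat" where \<phi>: "strict_mono \<phi>" "\<And>i. mono (\<lambda>n. a (\<phi> n) i)"
      using multiindex_seq_mono_subseq[of "UNIV :: 'n set" a] by auto
    have "a (\<phi> 0) \<le> a (\<phi> 1)" unfolding le_fun_def using \<phi>(2) by (auto simp: mono_def)
    moreover have "a (\<phi> 0) \<in> F" "a (\<phi> 1) \<in> F" using a(2) by auto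
    ultimately have "a (\<phi> 0) = a (\<phi> 1)" unfolding F_def by blast
    then have "\<phi> 0 = \<phi> 1" using a(1) by (simp add: inj_def)
    then show False using \<phi>(1) by (metis strict_mono_eq zero_neq_one)
  qed
  ultimately show ?thesis using that[of F] by (auto simp: F_def)
qed

section \<open>Division by an ideal\<close>

text \<open>Forward substitution for the system whose equation at \<alpha> has the coefficient
  \<open>K \<beta> \<alpha>\<close> at the unknown \<beta>, with unit diagonal and no entries from
  heavier \<beta>; the result is the inverse matrix. It is written out as a matrix, and not only
  through its action, because its rows become the finitely supported functionals.\<close>

function tri :: "(('n::finite \<Rightarrow> nat) \<Rightarrow> ('n \<Rightarrow> nat) \<Rightarrow> complex) \<Rightarrow> ('n \<Rightarrow> nat) \<Rightarrow> ('n \<Rightarrow> nat) \<Rightarrow> complex" where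
  "tri K \<alpha> \<gamma> = (if \<gamma> = \<alpha> then 1 else 0) - (\<Sum>\<beta>\<in>{\<beta>. wt \<beta> < wt \<alpha>}. K \<beta> \<alpha> * tri K \<beta> \<gamma>)"
  by pat_completeness auto
termination by (relation "Wellfounded.measure (\<lambda>(K, \<alpha>, \<gamma>). wt \<alpha>)") auto

declare tri.simps [simp del]

definition solve :: "(('n::finite \<Rightarrow> nat) \<Rightarrow> ('n \<Rightarrow> nat) \<Rightarrow> complex) \<Rightarrow> (('n \<Rightarrow> nat) \<Rightarrow> complex) \<Rightarrow> ('n \<Rightarrow> nat) \<Rightarrow> complex" where
  "solve K c \<alpha> = (\<Sum>\<gamma>\<in>{\<gamma>. wt \<gamma> \<le> wt \<alpha>}. tri K \<alpha> \<gamma> * c \<gamma>)"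

lemma tri_eq_0: "wt \<alpha> < wt \<gamma> \<Longrightarrow> tri K \<alpha> \<gamma> = 0"
proof (induction K \<alpha> \<gamma> rule: tri.induct)
  case (1 K \<alpha> \<gamma>)
  have "(\<Sum>\<beta>\<in>{\<beta>. wt \<beta> < wt \<alpha>}. K \<beta> \<alpha> * tri K \<beta> \<gamma>) = 0"
    using 1 by (intro sum.neutral) auto
  then show ?case using 1(2) by (subst tri.simps) auto
qed

lemma solve_rec:
  fixes \<alpha> :: "'n::finite \<Rightarrow> nat"
  shows "solve K c \<alpha> = c \<alpha> - (\<Sum>\<beta>\<in>{\<beta>. wt \<beta> < wt \<alpha>}. K \<beta> \<alpha> * solve K c \<beta>)"
proof -
  let ?L = "{\<beta> :: 'n \<Rightarrow> nat. wt \<beta> < wt \<alpha>}" and ?X = "{\<gamma> :: 'n \<Rightarrow> nat. wt \<gamma> \<le> wt \<alpha>}"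
  have fin: "finite ?L" "finite ?X" by (rule finite_wt_less finite_wt_le)+
  have "solve K c \<alpha> = (\<Sum>\<gamma>\<in>?X. (if \<gamma> = \<alpha> then 1 else 0) * c \<gamma>)
      - (\<Sum>\<gamma>\<in>?X. \<Sum>\<beta>\<in>?L. K \<beta> \<alpha> * tri K \<beta> \<gamma> * c \<gamma>)"
    unfolding solve_def by (subst tri.simps) (simp only: left_diff_distrib sum_subtractf sum_distrib_right)
  also have "(\<Sum>\<gamma>\<in>?X. (if \<gamma> = \<alpha> then 1 else 0) * c \<gamma>) = c \<alpha>"
  proof -
    have "(if \<gamma> = \<alpha> then 1 else 0) * c \<gamma> = (if \<gamma> = \<alpha> then c \<gamma> else 0)" for \<gamma> by simp
    then show ?thesis using sum.delta[OF fin(2), of \<alpha> c] by (simp only:) simp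
  qed
  also have "(\<Sum>\<gamma>\<in>?X. \<Sum>\<beta>\<in>?L. K \<beta> \<alpha> * tri K \<beta> \<gamma> * c \<gamma>) = (\<Sum>\<beta>\<in>?L. \<Sum>\<gamma>\<in>?X. K \<beta> \<alpha> * tri K \<beta> \<gamma> * c \<gamma>)"
    by (rule sum.swap)
  also have "\<dots> = (\<Sum>\<beta>\<in>?L. K \<beta> \<alpha> * solve K c \<beta>)"
  proof (rule sum.cong[OF refl])
    fix \<beta> assume \<beta>: "\<beta> \<in> ?L"
    \<comment> \<open>Row \<beta> of the inverse lives on weights up to \<open>wt \<beta>\<close>,
      so extending the range to \<open>wt \<alpha>\<close> has added only zeros.\<close>
    have "(\<Sum>\<gamma>\<in>?X. K \<beta> \<alpha> * tri K \<beta> \<gamma> * c \<gamma>) = (\<Sum>\<gamma>\<in>{\<gamma>. wt \<gamma> \<le> wt \<beta>}. K \<beta> \<alpha> * tri K \<beta> \<gamma> * c \<gamma>)"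
      by (rule sum.mono_neutral_right) (use \<beta> fin in \<open>auto simp: tri_eq_0 not_le\<close>)
    then show "(\<Sum>\<gamma>\<in>?X. K \<beta> \<alpha> * tri K \<beta> \<gamma> * c \<gamma>) = K \<beta> \<alpha> * solve K c \<beta>"
      by (simp add: solve_def sum_distrib_left mult.assoc)
  qed
  finally show ?thesis .
qed

lemma wt_le_eq_insert: "{\<beta>. wt \<beta> \<le> wt \<alpha>} = insert \<alpha> {\<beta>. wt \<beta> < wt (\<alpha> :: 'n::finite \<Rightarrow> nat)}"
  by (auto simp: le_less wt_inj)

lemma solve_sum:
  assumes "K \<alpha> \<alpha> = 1"
  shows "c \<alpha> = (\<Sum>\<beta>\<in>{\<beta>. wt \<beta> \<le> wt \<alpha>}. K \<beta> \<alpha> * solve K c \<beta>)"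
  using assms solve_rec[of K c \<alpha>] by (simp add: wt_le_eq_insert finite_wt_less)

text \<open>Taking the diagonal 1 out of the bound 3/2 leaves at most 1/2 for the off-diagonal
  entries of each divisor. A weighted partial sum \<open>A\<close> of the solution then satisfies
  \<open>A \<le> C + A / 2\<close>, that is \<open>A \<le> 2 * C\<close>. The estimate is made on
  initial segments of the weight, which the recursion does not leave and where \<open>A\<close> is
  finite and may be subtracted.\<close>

lemma wconv_solve:
  fixes K :: "('n::finite \<Rightarrow> nat) \<Rightarrow> ('n \<Rightarrow> nat) \<Rightarrow> complex"
  assumes K1: "\<And>\<beta>. K \<beta> \<beta> = 1" and Ks: "\<And>\<beta>. wconv (K \<beta>) s"
    and Kb: "\<And>\<beta>. wnorm (K \<beta>) s \<le> (3/2) / real (wt \<beta>) ^ s"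
    and c: "wconv c s"
  shows "wconv (solve K c) s"
proof -
  let ?u = "solve K c" and ?w = "\<lambda>\<alpha> :: 'n \<Rightarrow> nat. real (wt \<alpha>) ^ s"
  define C where "C = (\<Sum>\<^sub>\<infinity>\<alpha>. cmod (c \<alpha>) / ?w \<alpha>)"
  have w: "?w \<alpha> > 0" for \<alpha> using wt_pos[of \<alpha>] by simp
  have part: "(\<Sum>\<alpha>\<in>{\<alpha>. wt \<alpha> \<le> N}. cmod (?u \<alpha>) / ?w \<alpha>) \<le> 2 * C" for N
  proof -
    let ?X = "{\<alpha> :: 'n \<Rightarrow> nat. wt \<alpha> \<le> N}"
    have fin: "finite ?X" by (rule finite_wt_le)
    have row: "(\<Sum>\<alpha>\<in>?X - {\<beta>}. cmod (K \<beta> \<alpha>) / ?w \<alpha>) \<le> (1/2) / ?w \<beta>" if "\<beta> \<in> ?X" for \<beta>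
    proof -
      have "(\<Sum>\<alpha>\<in>?X. cmod (K \<beta> \<alpha>) / ?w \<alpha>) \<le> (3/2) / ?w \<beta>"
        using Kb[of \<beta>] finite_sum_le_infsum[OF Ks[of \<beta>, unfolded wconv_def] fin] by force
      then show ?thesis using that fin K1[of \<beta>] by (simp add: sum.remove[of ?X \<beta>] add_divide_distrib[symmetric] field_simps)
    qed
    have "(\<Sum>\<alpha>\<in>?X. cmod (?u \<alpha>) / ?w \<alpha>)
        \<le> (\<Sum>\<alpha>\<in>?X. cmod (c \<alpha>) / ?w \<alpha> + (\<Sum>\<beta>\<in>?X - {\<alpha>}. cmod (?u \<beta>) * (cmod (K \<beta> \<alpha>) / ?w \<alpha>)))"
    proof (rule sum_mono)
      fix \<alpha> assume \<alpha>: "\<alpha> \<in> ?X"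
      have "cmod (?u \<alpha>) \<le> cmod (c \<alpha>) + (\<Sum>\<beta>\<in>{\<beta>. wt \<beta> < wt \<alpha>}. cmod (K \<beta> \<alpha>) * cmod (?u \<beta>))"
        unfolding solve_rec[of K c \<alpha>]
        by (rule order_trans[OF norm_triangle_ineq4]) (simp add: norm_mult[symmetric] sum_norm_le)
      also have "(\<Sum>\<beta>\<in>{\<beta>. wt \<beta> < wt \<alpha>}. cmod (K \<beta> \<alpha>) * cmod (?u \<beta>)) \<le> (\<Sum>\<beta>\<in>?X - {\<alpha>}. cmod (K \<beta> \<alpha>) * cmod (?u \<beta>))"
        using \<alpha> fin by (intro sum_mono2) auto
      finally have "cmod (?u \<alpha>) / ?w \<alpha> \<le> (cmod (c \<alpha>) + (\<Sum>\<beta>\<in>?X - {\<alpha>}. cmod (K \<beta> \<alpha>) * cmod (?u \<beta>))) / ?w \<alpha>"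
        by (simp add: divide_right_mono)
      then show "cmod (?u \<alpha>) / ?w \<alpha> \<le> cmod (c \<alpha>) / ?w \<alpha> + (\<Sum>\<beta>\<in>?X - {\<alpha>}. cmod (?u \<beta>) * (cmod (K \<beta> \<alpha>) / ?w \<alpha>))"
        by (simp add: add_divide_distrib sum_divide_distrib mult.commute)
    qed
    also have "\<dots> = (\<Sum>\<alpha>\<in>?X. cmod (c \<alpha>) / ?w \<alpha>) + (\<Sum>\<alpha>\<in>?X. \<Sum>\<beta>\<in>?X - {\<alpha>}. cmod (?u \<beta>) * (cmod (K \<beta> \<alpha>) / ?w \<alpha>))"
      by (rule sum.distrib)
    also have "(\<Sum>\<alpha>\<in>?X. \<Sum>\<beta>\<in>?X - {\<alpha>}. cmod (?u \<beta>) * (cmod (K \<beta> \<alpha>) / ?w \<alpha>))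
        = (\<Sum>\<beta>\<in>?X. \<Sum>\<alpha>\<in>?X - {\<beta>}. cmod (?u \<beta>) * (cmod (K \<beta> \<alpha>) / ?w \<alpha>))"
    proof -
      have "(\<Sum>\<alpha>\<in>?X. \<Sum>\<beta>\<in>{\<beta>\<in>?X. \<beta> \<noteq> \<alpha>}. cmod (?u \<beta>) * (cmod (K \<beta> \<alpha>) / ?w \<alpha>))
        = (\<Sum>\<beta>\<in>?X. \<Sum>\<alpha>\<in>{\<alpha>\<in>?X. \<beta> \<noteq> \<alpha>}. cmod (?u \<beta>) * (cmod (K \<beta> \<alpha>) / ?w \<alpha>))"
        by (rule sum.swap_restrict[OF fin fin])
      moreover have "{\<beta>\<in>?X. \<beta> \<noteq> \<alpha>} = ?X - {\<alpha>}" "{\<beta>\<in>?X. \<alpha> \<noteq> \<beta>} = ?X - {\<alpha>}" for \<alpha> by auto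
      ultimately show ?thesis by simp
    qed
    also have "\<dots> \<le> (\<Sum>\<beta>\<in>?X. cmod (?u \<beta>) * ((1/2) / ?w \<beta>))"
      unfolding sum_distrib_left[symmetric] by (intro sum_mono mult_left_mono row) auto
    also have "\<dots> = (1/2) * (\<Sum>\<beta>\<in>?X. cmod (?u \<beta>) / ?w \<beta>)" by (simp add: sum_distrib_left)
    also have "(\<Sum>\<alpha>\<in>?X. cmod (c \<alpha>) / ?w \<alpha>) \<le> C"
      unfolding C_def using c by (intro finite_sum_le_infsum fin) (auto simp: wconv_def)
    finally show ?thesis by simp
  qed
  show ?thesis
    unfolding wconv_def
  proof (rule nonneg_bdd_above_summable_on)
    show "bdd_above (sum (\<lambda>\<alpha>. cmod (?u \<alpha>) / ?w \<alpha>) ` {F. F \<subseteq> UNIV \<and> finite F})"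
    proof (rule bdd_aboveI2)
      fix F :: "('n \<Rightarrow> nat) set" assume "F \<in> {F. F \<subseteq> UNIV \<and> finite F}"
      then have F: "finite F" by simp
      define N where "N = Max (insert 0 (wt ` F))"
      have "(\<Sum>\<alpha>\<in>F. cmod (?u \<alpha>) / ?w \<alpha>) \<le> (\<Sum>\<alpha>\<in>{\<alpha>. wt \<alpha> \<le> N}. cmod (?u \<alpha>) / ?w \<alpha>)"
        using F by (intro sum_mono2 finite_wt_le) (auto simp: N_def)
      also note part[of N]
      finally show "(\<Sum>\<alpha>\<in>F. cmod (?u \<alpha>) / ?w \<alpha>) \<le> 2 * C" .
    qed
  qed simp
qed

text \<open>The double series over divisors and exponents converges absolutely because of
  \<open>Kb\<close> and \<open>wconv_solve\<close>. Summed first over exponents it gives the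
  left-hand side; summed first over divisors, each sum is finite and is one equation of the
  triangular system, so the total is the power series of \<open>f\<close>.\<close>

lemma solve_expansion:
  fixes K :: "('n::finite \<Rightarrow> nat) \<Rightarrow> ('n \<Rightarrow> nat) \<Rightarrow> complex"
  assumes K1: "\<And>\<beta>. K \<beta> \<beta> = 1" and K0: "\<And>\<alpha> \<beta>. wt \<alpha> < wt \<beta> \<Longrightarrow> K \<beta> \<alpha> = 0"
    and G: "\<And>\<beta>. power_series (G \<beta>) (K \<beta>) s"
    and Kb: "\<And>\<beta>. wnorm (K \<beta>) s \<le> (3/2) / real (wt \<beta>) ^ s"
    and f: "power_series f c s" and z: "z \<in> wdisc s"
  shows "((\<lambda>\<beta>. solve K c \<beta> * G \<beta> z) has_sum f z) UNIV"
proof -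
  let ?u = "solve K c" and ?w = "\<lambda>\<alpha> :: 'n \<Rightarrow> nat. real (wt \<alpha>) ^ s"
  have Ks: "wconv (K \<beta>) s" for \<beta> using G by (simp add: power_series_def)
  have u: "wconv ?u s" using f by (intro wconv_solve K1 Ks Kb) (simp add: power_series_def)
  let ?t = "\<lambda>(\<beta>, \<alpha>). ?u \<beta> * (K \<beta> \<alpha> * mon \<alpha> z)"
  have "(\<lambda>(\<beta>, \<alpha>). cmod (?u \<beta>) * (cmod (K \<beta> \<alpha>) / ?w \<alpha>)) summable_on (UNIV \<times> UNIV)"
  proof (rule summable_on_SigmaI)
    show "((\<lambda>\<alpha>. case (\<beta>, \<alpha>) of (\<beta>, \<alpha>) \<Rightarrow> cmod (?u \<beta>) * (cmod (K \<beta> \<alpha>) / ?w \<alpha>)) has_sum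
       cmod (?u \<beta>) * (\<Sum>\<^sub>\<infinity>\<alpha>. cmod (K \<beta> \<alpha>) / ?w \<alpha>)) UNIV" for \<beta>
      unfolding prod.case by (intro has_sum_cmult_right has_sum_infsum Ks[unfolded wconv_def])
    show "(\<lambda>\<beta>. cmod (?u \<beta>) * (\<Sum>\<^sub>\<infinity>\<alpha>. cmod (K \<beta> \<alpha>) / ?w \<alpha>)) summable_on UNIV"
    proof (rule summable_on_comparison_test)
      show "(\<lambda>\<beta>. (3/2) * (cmod (?u \<beta>) / ?w \<beta>)) summable_on UNIV"
        using u unfolding wconv_def by (rule summable_on_cmult_right)
      show "cmod (?u \<beta>) * (\<Sum>\<^sub>\<infinity>\<alpha>. cmod (K \<beta> \<alpha>) / ?w \<alpha>) \<le> (3/2) * (cmod (?u \<beta>) / ?w \<beta>)" for \<beta>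
        using mult_left_mono[OF Kb[of \<beta>], of "cmod (?u \<beta>)"] by (simp add: mult.commute)
    qed (auto intro!: mult_nonneg_nonneg infsum_nonneg)
  qed auto
  then have "(\<lambda>x. norm (?t x)) summable_on (UNIV \<times> UNIV)"
  proof (rule Infinite_Sum.abs_summable_on_comparison_test')
    fix x :: "('n \<Rightarrow> nat) \<times> ('n \<Rightarrow> nat)"
    show "norm (?t x) \<le> (case x of (\<beta>, \<alpha>) \<Rightarrow> cmod (?u \<beta>) * (cmod (K \<beta> \<alpha>) / ?w \<alpha>))"
      using mult_left_mono[OF mult_left_mono[OF cmod_mon_le[OF z, of "snd x"], of "cmod (K (fst x) (snd x))"],
          of "cmod (?u (fst x))"]
      by (auto simp: case_prod_unfold norm_mult)
  qed
  then have "?t summable_on (UNIV \<times> UNIV)" by (rule abs_summable_summable)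
  then obtain S where S: "(?t has_sum S) (UNIV \<times> UNIV)" by (auto simp: summable_on_def)
  have rows: "((\<lambda>\<beta>. ?u \<beta> * G \<beta> z) has_sum S) UNIV"
  proof (rule has_sum_SigmaD[OF S])
    show "((\<lambda>\<alpha>. ?t (\<beta>, \<alpha>)) has_sum ?u \<beta> * G \<beta> z) UNIV" for \<beta>
      unfolding prod.case using G z by (intro has_sum_cmult_right) (simp add: power_series_def)
  qed
  have "((\<lambda>(\<alpha>, \<beta>). ?t (\<beta>, \<alpha>)) has_sum S) (UNIV \<times> UNIV)" using S by (rule has_sum_swap[THEN iffD1])
  then have "((\<lambda>\<alpha>. c \<alpha> * mon \<alpha> z) has_sum S) UNIV"
  proof (rule has_sum_SigmaD)
    fix \<alpha> :: "'n \<Rightarrow> nat"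
    have "((\<lambda>\<beta>. ?t (\<beta>, \<alpha>)) has_sum (\<Sum>\<beta>\<in>{\<beta>. wt \<beta> \<le> wt \<alpha>}. ?t (\<beta>, \<alpha>))) {\<beta>. wt \<beta> \<le> wt \<alpha>}"
      by (intro has_sum_finite finite_wt_le)
    also have "(\<Sum>\<beta>\<in>{\<beta>. wt \<beta> \<le> wt \<alpha>}. ?t (\<beta>, \<alpha>)) = c \<alpha> * mon \<alpha> z"
      using solve_sum[of K \<alpha> c, OF K1] by (simp add: sum_distrib_left mult_ac)
    finally have "((\<lambda>\<beta>. ?t (\<beta>, \<alpha>)) has_sum c \<alpha> * mon \<alpha> z) UNIV"
      by (rule has_sum_cong_neutral[THEN iffD1, rotated -1]) (auto simp: K0 not_le)
    then show "((\<lambda>\<beta>. case (\<alpha>, \<beta>) of (\<alpha>, \<beta>) \<Rightarrow> ?t (\<beta>, \<alpha>)) has_sum c \<alpha> * mon \<alpha> z) UNIV" by simp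
  qed
  moreover have "((\<lambda>\<alpha>. c \<alpha> * mon \<alpha> z) has_sum f z) UNIV" using f z by (simp add: power_series_def)
  ultimately show ?thesis using rows has_sum_unique by metis
qed

text \<open>The leading term contributes exactly \<open>1 / wt a ^ s\<close>, and the rest is at
  most half of that for large \<open>s\<close>. What \<open>wconv_solve\<close> exploits is that the
  excess over 1 is below 1.\<close>

lemma leading_coeff_bound:
  assumes c: "wconv c s0" and a: "c a = 1" "\<And>\<beta>. wt \<beta> < wt a \<Longrightarrow> c \<beta> = 0"
  shows "\<exists>S\<ge>s0. \<forall>s\<ge>S. wnorm c s \<le> (3/2) / real (wt a) ^ s"
proof -
  define d where "d = c(a := 0)"
  have d: "wconv d s0" unfolding d_def by (rule wconv_update[OF c])
  have van: "d \<alpha> = 0" if "wt \<alpha> \<le> wt a" for \<alpha>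
    using that a(2)[of \<alpha>] wt_inj[of \<alpha> a] by (auto simp: d_def le_less)
  obtain S where S: "S \<ge> s0" "\<And>s. s \<ge> S \<Longrightarrow> wnorm d s \<le> (1/2) / real (wt a) ^ s"
    using wconv_tail_small[OF d van, where e = "1/2"] wt_pos[of a] by auto
  have "wnorm c s \<le> (3/2) / real (wt a) ^ s" if s: "s \<ge> S" for s
  proof -
    have "((\<lambda>\<alpha>. cmod (d \<alpha>) / real (wt \<alpha>) ^ s) has_sum wnorm d s) UNIV"
      using wconv_mono[OF d] S(1) s by (intro has_sum_infsum) (auto simp: wconv_def)
    from has_sum_add[OF this has_sum_UNIV_singleton[of a "\<lambda>\<alpha>. if \<alpha> = a then 1 / real (wt a) ^ s else 0"]]
    have "((\<lambda>\<alpha>. cmod (d \<alpha>) / real (wt \<alpha>) ^ s + (if \<alpha> = a then 1 / real (wt a) ^ s else 0)) has_sum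
        wnorm d s + 1 / real (wt a) ^ s) UNIV" by simp
    then have "((\<lambda>\<alpha>. cmod (c \<alpha>) / real (wt \<alpha>) ^ s) has_sum
        wnorm d s + 1 / real (wt a) ^ s) UNIV"
      by (rule has_sum_cong[THEN iffD1, rotated]) (auto simp: d_def a(1))
    then have "wnorm c s = wnorm d s + 1 / real (wt a) ^ s"
      by (rule infsumI)
    then show ?thesis using S(2)[OF s] by simp
  qed
  then show ?thesis using S(1) by blast
qed

lemma has_sum_finite_sum:
  fixes f :: "'i \<Rightarrow> 'a \<Rightarrow> 'b :: {topological_comm_monoid_add}"
  assumes "finite F" "\<And>i. i \<in> F \<Longrightarrow> (f i has_sum S i) A"
  shows "((\<lambda>x. \<Sum>i\<in>F. f i x) has_sum (\<Sum>i\<in>F. S i)) A"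
  using assms by (induction F rule: finite_induct) (auto intro: has_sum_add)

text \<open>An ideal of germs, presented by all functions representing its members;
  \<open>local\<close> expresses that membership depends on the germ only.\<close>

locale holomorphic_ideal =
  fixes J :: "(complex^'n \<Rightarrow> complex) set"
  assumes hol: "f \<in> J \<Longrightarrow> holomorphic_near_0 f"
    and zero: "(\<lambda>z. 0) \<in> J"
    and add: "f \<in> J \<Longrightarrow> g \<in> J \<Longrightarrow> (\<lambda>z. f z + g z) \<in> J"
    and mult: "f \<in> J \<Longrightarrow> holomorphic_near_0 h \<Longrightarrow> (\<lambda>z. h z * f z) \<in> J"
    and local: "f \<in> J \<Longrightarrow> \<forall>\<^sub>F z in nhds 0. g z = f z \<Longrightarrow> g \<in> J"
begin

text \<open>The initial exponents of the ideal for a local monomial order: leading means of least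
  weight. Normalising the leading coefficient to 1 makes the diagonal of the division system
  1.\<close>

definition leading :: "('n \<Rightarrow> nat) set" where
  "leading = {\<alpha>. \<exists>f\<in>J. taylor_coeff f \<alpha> = 1 \<and> (\<forall>\<beta>. wt \<beta> < wt \<alpha> \<longrightarrow> taylor_coeff f \<beta> = 0)}"

lemma leadingI:
  assumes "f \<in> J" "taylor_coeff f = c" "c \<alpha> = 1" "\<And>\<beta>. wt \<beta> < wt \<alpha> \<Longrightarrow> c \<beta> = 0"
  shows "\<alpha> \<in> leading"
  using assms by (auto simp: leading_def)

lemma sum: "finite A \<Longrightarrow> (\<And>i. i \<in> A \<Longrightarrow> f i \<in> J) \<Longrightarrow> (\<lambda>z. \<Sum>i\<in>A. f i z) \<in> J"
  by (induction A rule: finite_induct) (auto intro: zero add)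

lemma diff: "f \<in> J \<Longrightarrow> g \<in> J \<Longrightarrow> (\<lambda>z. f z - g z) \<in> J"
  using add[OF _ mult[OF _ holomorphic_near_0_const[of "-1"]]] by fastforce

text \<open>Grauert-Hironaka division. Every exponent \<beta> receives a divisor
  \<open>G \<beta>\<close> with leading exponent \<beta>: a monomial multiple of one of finitely
  many members of \<open>J\<close> if \<beta> is in \<open>leading\<close>, and the bare monomial
  otherwise. The divisors with \<beta> in \<open>leading\<close> are regrouped into finitely many
  quotients, the monomials form \<open>r\<close>. It is essential that \<open>K\<close> is chosen
  before \<open>f\<close>: the remainder coefficients are then fixed linear functionals of
  \<open>f\<close>.\<close>

lemma division:
  obtains K s where
    "\<And>f. holomorphic_near_0 f \<Longrightarrow> \<exists>r t. power_series r (\<lambda>\<alpha>. if \<alpha> \<in> leading then 0 else solve K (taylor_coeff f) \<alpha>) t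
       \<and> (\<lambda>z. f z - r z) \<in> J"
proof -
  obtain F where F: "finite F" "F \<subseteq> leading" "\<And>\<alpha>. \<alpha> \<in> leading \<Longrightarrow> \<exists>\<beta>\<in>F. \<beta> \<le> \<alpha>"
    using dickson by blast
  have "\<forall>a\<in>F. \<exists>f. f \<in> J \<and> taylor_coeff f a = 1 \<and> (\<forall>\<beta>. wt \<beta> < wt a \<longrightarrow> taylor_coeff f \<beta> = 0)"
    using F(2) unfolding leading_def by blast
  from bchoice[OF this] obtain g where g: "\<And>a. a \<in> F \<Longrightarrow> g a \<in> J" "\<And>a. a \<in> F \<Longrightarrow> taylor_coeff (g a) a = 1"
    "\<And>a \<beta>. a \<in> F \<Longrightarrow> wt \<beta> < wt a \<Longrightarrow> taylor_coeff (g a) \<beta> = 0" by blast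
  have "\<forall>\<alpha>\<in>leading. \<exists>\<beta>. \<beta> \<in> F \<and> \<beta> \<le> \<alpha>" using F(3) by blast
  from bchoice[OF this] obtain b where b: "\<And>\<alpha>. \<alpha> \<in> leading \<Longrightarrow> b \<alpha> \<in> F" "\<And>\<alpha>. \<alpha> \<in> leading \<Longrightarrow> b \<alpha> \<le> \<alpha>"
    by blast
  have "\<exists>S. \<forall>s\<ge>S. power_series (g a) (taylor_coeff (g a)) s \<and>
      wnorm (taylor_coeff (g a)) s \<le> (3/2) / real (wt a) ^ s" if a: "a \<in> F" for a
  proof -
    obtain s0 where s0: "power_series (g a) (taylor_coeff (g a)) s0"
      using holomorphic_imp_power_series[OF hol[OF g(1)[OF a]]] by blast
    then have "wconv (taylor_coeff (g a)) s0" by (simp add: power_series_def)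
    from leading_coeff_bound[OF this g(2)[OF a] g(3)[OF a]]
    obtain S where S: "S \<ge> s0" "\<And>s. s \<ge> S \<Longrightarrow> wnorm (taylor_coeff (g a)) s \<le> (3/2) / real (wt a) ^ s"
      by blast
    have "power_series (g a) (taylor_coeff (g a)) s" if "s \<ge> S" for s
      using power_series_mono[OF s0] S(1) that by simp
    then show ?thesis using S(2) by blast
  qed
  then have "\<forall>a\<in>F. \<exists>S. \<forall>s\<ge>S. power_series (g a) (taylor_coeff (g a)) s \<and>
      wnorm (taylor_coeff (g a)) s \<le> (3/2) / real (wt a) ^ s" by blast
  from bchoice[OF this] obtain S0 where S0: "\<And>a s. a \<in> F \<Longrightarrow> s \<ge> S0 a \<Longrightarrow> power_series (g a) (taylor_coeff (g a)) s"
    "\<And>a s. a \<in> F \<Longrightarrow> s \<ge> S0 a \<Longrightarrow> wnorm (taylor_coeff (g a)) s \<le> (3/2) / real (wt a) ^ s"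
    by blast
  define s0 where "s0 = Max (insert 0 (S0 ` F))"
  have s0: "S0 a \<le> s0" if "a \<in> F" for a using that F(1) by (auto simp: s0_def)
  \<comment> \<open>The cofactor exponent, to be used when \<open>b \<beta> \<le> \<beta>\<close>;
    elsewhere the truncated difference is meaningless.\<close>
  define sh where "sh \<beta> = (\<lambda>i. \<beta> i - b \<beta> i)" for \<beta>
  have sh: "\<beta> = (\<lambda>i. sh \<beta> i + b \<beta> i)" if "\<beta> \<in> leading" for \<beta>
    using b(2)[OF that] by (auto simp: sh_def le_fun_def fun_eq_iff)
  define G where "G \<beta> = (if \<beta> \<in> leading then (\<lambda>z. mon (sh \<beta>) z * g (b \<beta>) z) else mon \<beta>)" for \<beta>
  define K where "K \<beta> = (if \<beta> \<in> leading then (\<lambda>\<alpha>. if sh \<beta> \<le> \<alpha> then taylor_coeff (g (b \<beta>)) (\<lambda>i. \<alpha> i - sh \<beta> i) else 0)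
      else (\<lambda>\<alpha>. if \<alpha> = \<beta> then 1 else 0))" for \<beta>
  have K1: "K \<beta> \<beta> = 1" for \<beta>
  proof (cases "\<beta> \<in> leading")
    case True
    have "sh \<beta> \<le> \<beta>" "(\<lambda>i. \<beta> i - sh \<beta> i) = b \<beta>"
      using b(2)[OF True] by (auto simp: sh_def le_fun_def)
    then show ?thesis using True g(2)[OF b(1)[OF True]] by (simp add: K_def)
  qed (simp add: K_def)
  have K0: "K \<beta> \<alpha> = 0" if "wt \<alpha> < wt \<beta>" for \<alpha> \<beta>
  proof (cases "\<beta> \<in> leading \<and> sh \<beta> \<le> \<alpha>")
    case True
    then have "\<alpha> = (\<lambda>i. sh \<beta> i + (\<alpha> i - sh \<beta> i))" by (auto simp: le_fun_def)
    then have "wt \<alpha> = wt (sh \<beta>) * wt (\<lambda>i. \<alpha> i - sh \<beta> i)" using wt_add[of "sh \<beta>"] by metis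
    moreover have "wt \<beta> = wt (sh \<beta>) * wt (b \<beta>)" using sh[of \<beta>] True wt_add[of "sh \<beta>" "b \<beta>"] by metis
    ultimately have "wt (\<lambda>i. \<alpha> i - sh \<beta> i) < wt (b \<beta>)" using that by simp
    then show ?thesis using True g(3)[OF b(1)] by (simp add: K_def)
  qed (use that in \<open>auto simp: K_def\<close>)
  have G: "power_series (G \<beta>) (K \<beta>) s"
    and Kb: "wnorm (K \<beta>) s \<le> (3/2) / real (wt \<beta>) ^ s" if s: "s \<ge> s0" for s \<beta>
  proof -
    show "power_series (G \<beta>) (K \<beta>) s"
    proof (cases "\<beta> \<in> leading")
      case True
      have "power_series (g (b \<beta>)) (taylor_coeff (g (b \<beta>))) s"
        using S0(1)[OF b(1)[OF True]] s0[OF b(1)[OF True]] s by simp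
      from power_series_shift(1)[OF this] show ?thesis using True by (simp add: G_def K_def)
    qed (simp add: G_def K_def power_series_mon)
    show "wnorm (K \<beta>) s \<le> (3/2) / real (wt \<beta>) ^ s"
    proof (cases "\<beta> \<in> leading")
      case True
      have s1: "s \<ge> S0 (b \<beta>)" using s0[OF b(1)[OF True]] s by simp
      have "wnorm (K \<beta>) s =
          wnorm (taylor_coeff (g (b \<beta>))) s / real (wt (sh \<beta>)) ^ s"
        using power_series_shift(2)[OF S0(1)[OF b(1)[OF True] s1], of "sh \<beta>"] True by (simp add: K_def)
      also have "\<dots> \<le> ((3/2) / real (wt (b \<beta>)) ^ s) / real (wt (sh \<beta>)) ^ s"
        using S0(2)[OF b(1)[OF True] s1] by (rule divide_right_mono) simp
      also have "\<dots> = (3/2) / real (wt \<beta>) ^ s"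
      proof -
        have "wt \<beta> = wt (sh \<beta>) * wt (b \<beta>)" using sh[of \<beta>] True wt_add[of "sh \<beta>" "b \<beta>"] by metis
        then show ?thesis by (simp add: power_mult_distrib)
      qed
      finally show ?thesis .
    next
      case False
      have "((\<lambda>\<alpha>. cmod (K \<beta> \<alpha>) / real (wt \<alpha>) ^ s) has_sum cmod (K \<beta> \<beta>) / real (wt \<beta>) ^ s) UNIV"
        by (rule has_sum_UNIV_singleton) (use False in \<open>simp add: K_def\<close>)
      then have "wnorm (K \<beta>) s = cmod (K \<beta> \<beta>) / real (wt \<beta>) ^ s" by (rule infsumI)
      then show ?thesis using wt_pos[of \<beta>] by (simp add: K1 field_simps)
    qed
  qed
  have "\<exists>r t. power_series r (\<lambda>\<alpha>. if \<alpha> \<in> leading then 0 else solve K (taylor_coeff f) \<alpha>) t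
       \<and> (\<lambda>z. f z - r z) \<in> J" if hf: "holomorphic_near_0 f" for f
  proof -
    obtain t where t: "power_series f (taylor_coeff f) t" using holomorphic_imp_power_series[OF hf] by blast
    \<comment> \<open>The polydisc has to shrink with \<open>f\<close> although \<open>K\<close> is
      fixed, which is why \<open>G\<close> and \<open>Kb\<close> were proved for all
      \<open>s \<ge> s0\<close>.\<close>
    define s where "s = max s0 t"
    have s: "s \<ge> s0" and f: "power_series f (taylor_coeff f) s" using power_series_mono[OF t] by (auto simp: s_def)
    define u where "u = solve K (taylor_coeff f)"
    have u: "wconv u s"
      unfolding u_def using G[OF s] f by (intro wconv_solve K1 Kb[OF s]) (auto simp: power_series_def)
    define rc where "rc \<alpha> = (if \<alpha> \<in> leading then 0 else u \<alpha>)" for \<alpha>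
    have "wconv rc s" using u unfolding wconv_def
      by (rule summable_on_comparison_test) (auto simp: rc_def)
    then obtain r where r: "power_series r rc s" using power_series_exists by blast
    \<comment> \<open>The quotient by \<open>g a\<close>: its coefficient at \<gamma> is the
      solution at \<open>\<gamma> + a\<close>, provided that this exponent was assigned to
      \<open>a\<close>. The assignment \<open>b\<close> keeps an exponent divisible by several
      generators from being counted twice.\<close>
    define q where "q a \<gamma> = (let \<beta> = (\<lambda>i. \<gamma> i + a i) in if \<beta> \<in> leading \<and> b \<beta> = a then u \<beta> else 0)" for a \<gamma>
    have inj: "inj (\<lambda>\<gamma> i. \<gamma> i + a i)" for a :: "'n \<Rightarrow> nat" by (auto simp: inj_def fun_eq_iff)
    have qc: "wconv (q a) s" for a
      unfolding wconv_def
    proof (rule summable_on_comparison_test)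
      have "(\<lambda>\<beta>. cmod (u \<beta>) / real (wt \<beta>) ^ s) summable_on range (\<lambda>\<gamma> i. \<gamma> i + a i)"
        using u unfolding wconv_def by (rule summable_on_subset_banach) simp
      then have "(\<lambda>\<gamma>. cmod (u (\<lambda>i. \<gamma> i + a i)) / real (wt (\<lambda>i. \<gamma> i + a i)) ^ s) summable_on UNIV"
        by (subst (asm) summable_on_reindex[OF inj]) (simp add: o_def)
      then show "(\<lambda>\<gamma>. real (wt a) ^ s * (cmod (u (\<lambda>i. \<gamma> i + a i)) / real (wt (\<lambda>i. \<gamma> i + a i)) ^ s)) summable_on UNIV"
        by (rule summable_on_cmult_right)
      show "cmod (q a \<gamma>) / real (wt \<gamma>) ^ s \<le> real (wt a) ^ s * (cmod (u (\<lambda>i. \<gamma> i + a i)) / real (wt (\<lambda>i. \<gamma> i + a i)) ^ s)" for \<gamma>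
        using wt_pos[of a] by (auto simp: q_def Let_def wt_add power_mult_distrib divide_right_mono)
    qed simp
    define Q where "Q a z = (\<Sum>\<^sub>\<infinity>\<gamma>. q a \<gamma> * mon \<gamma> z)" for a z
    have Q: "power_series (Q a) (q a) s" for a unfolding Q_def by (rule power_series_exists[OF qc])
    have eq: "f z = (\<Sum>a\<in>F. Q a z * g a z) + r z" if z: "z \<in> wdisc s" for z
    proof -
      have "((\<lambda>\<beta>. if \<beta> \<in> leading \<and> b \<beta> = a then u \<beta> * G \<beta> z else 0) has_sum Q a z * g a z) UNIV" for a
      proof -
        have "((\<lambda>\<gamma>. q a \<gamma> * mon \<gamma> z * g a z) has_sum Q a z * g a z) UNIV"
          using Q z by (intro has_sum_cmult_left) (auto simp: power_series_def)
        moreover have "q a \<gamma> * mon \<gamma> z * g a z = (if (\<lambda>i. \<gamma> i + a i) \<in> leading \<and> b (\<lambda>i. \<gamma> i + a i) = a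
            then u (\<lambda>i. \<gamma> i + a i) * G (\<lambda>i. \<gamma> i + a i) z else 0)" for \<gamma>
          by (auto simp: q_def Let_def G_def sh_def)
        ultimately have "((\<lambda>\<beta>. if \<beta> \<in> leading \<and> b \<beta> = a then u \<beta> * G \<beta> z else 0) has_sum Q a z * g a z) (range (\<lambda>\<gamma> i. \<gamma> i + a i))"
          by (subst has_sum_reindex[OF inj]) (simp add: o_def)
        moreover have "\<beta> \<in> range (\<lambda>\<gamma> i. \<gamma> i + a i)" if "\<beta> \<in> leading" "b \<beta> = a" for \<beta>
          using sh[OF that(1)] that(2) by (intro image_eqI[of _ _ "sh \<beta>"]) auto
        ultimately show ?thesis
          by (elim has_sum_cong_neutral[THEN iffD1, rotated -1]) auto
      qed
      from has_sum_finite_sum[OF F(1) this]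
      have 1: "((\<lambda>\<beta>. \<Sum>a\<in>F. if \<beta> \<in> leading \<and> b \<beta> = a then u \<beta> * G \<beta> z else 0) has_sum (\<Sum>a\<in>F. Q a z * g a z)) UNIV" .
      have 2: "((\<lambda>\<beta>. rc \<beta> * mon \<beta> z) has_sum r z) UNIV" using r z by (simp add: power_series_def)
      \<comment> \<open>Every exponent is used once: by the single generator
        \<open>b \<beta>\<close>, or by the remainder.\<close>
      have "(\<Sum>a\<in>F. if \<beta> \<in> leading \<and> b \<beta> = a then u \<beta> * G \<beta> z else 0) + rc \<beta> * mon \<beta> z = u \<beta> * G \<beta> z" for \<beta>
      proof (cases "\<beta> \<in> leading")
        case True
        then have "(\<Sum>a\<in>F. if \<beta> \<in> leading \<and> b \<beta> = a then u \<beta> * G \<beta> z else 0) = (\<Sum>a\<in>F. if b \<beta> = a then u \<beta> * G \<beta> z else 0)"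
          by simp
        also have "\<dots> = u \<beta> * G \<beta> z" using b(1)[OF True] F(1) by (simp add: sum.delta)
        finally show ?thesis using True by (simp add: rc_def)
      qed (simp add: rc_def G_def)
      then have "((\<lambda>\<beta>. u \<beta> * G \<beta> z) has_sum (\<Sum>a\<in>F. Q a z * g a z) + r z) UNIV"
        using has_sum_add[OF 1 2] by simp
      moreover have "((\<lambda>\<beta>. u \<beta> * G \<beta> z) has_sum f z) UNIV"
        unfolding u_def by (rule solve_expansion[OF K1 K0 G[OF s] Kb[OF s] f z])
      ultimately show ?thesis by (rule has_sum_unique[rotated])
    qed
    have "(\<lambda>z. \<Sum>a\<in>F. Q a z * g a z) \<in> J"
      by (intro sum F(1) mult g(1) power_series_imp_holomorphic[OF Q])
    moreover have "\<forall>\<^sub>F z in nhds 0. f z - r z = (\<Sum>a\<in>F. Q a z * g a z)"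
      using eventually_in_wdisc[of s] by (rule eventually_mono) (simp add: eq)
    ultimately have "(\<lambda>z. f z - r z) \<in> J" by (rule local)
    moreover have "rc = (\<lambda>\<alpha>. if \<alpha> \<in> leading then 0 else solve K (taylor_coeff f) \<alpha>)"
      by (auto simp: rc_def u_def)
    ultimately show ?thesis using r by blast
  qed
  then show ?thesis by (rule that)
qed

text \<open>This is the closedness of ideals under coefficientwise convergence, in dual form: every
  ideal is the common kernel of finitely supported functionals.\<close>

theorem separation:
  "\<exists>\<Xi>. (\<forall>\<xi>\<in>\<Xi>. finite {\<alpha>. \<xi> \<alpha> \<noteq> 0}) \<and>
    (\<forall>f. holomorphic_near_0 f \<longrightarrow> (f \<in> J \<longleftrightarrow> (\<forall>\<xi>\<in>\<Xi>. (\<Sum>\<^sub>\<infinity>\<alpha>. \<xi> \<alpha> * taylor_coeff f \<alpha>) = 0)))"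
proof -
  obtain K where K: "\<And>f. holomorphic_near_0 f \<Longrightarrow>
      \<exists>r t. power_series r (\<lambda>\<alpha>. if \<alpha> \<in> leading then 0 else solve K (taylor_coeff f) \<alpha>) t \<and> (\<lambda>z. f z - r z) \<in> J"
    using division by blast
  \<comment> \<open>Row \<alpha> of the inverse matrix; paired with the Taylor coefficients of
    \<open>f\<close> it yields the entry \<alpha> of the solution, which for \<alpha> outside
    \<open>leading\<close> is a remainder coefficient.\<close>
  define \<xi> where "\<xi> \<alpha> = (\<lambda>\<gamma>. if wt \<gamma> \<le> wt \<alpha> then tri K \<alpha> \<gamma> else 0)" for \<alpha>
  have solve: "(\<Sum>\<^sub>\<infinity>\<gamma>. \<xi> \<alpha> \<gamma> * c \<gamma>) = solve K c \<alpha>" for \<alpha> c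
  proof -
    have "(\<Sum>\<^sub>\<infinity>\<gamma>. \<xi> \<alpha> \<gamma> * c \<gamma>) = (\<Sum>\<^sub>\<infinity>\<gamma>\<in>{\<gamma>. wt \<gamma> \<le> wt \<alpha>}. tri K \<alpha> \<gamma> * c \<gamma>)"
      by (rule infsum_cong_neutral) (auto simp: \<xi>_def)
    also have "\<dots> = solve K c \<alpha>" by (simp add: finite_wt_le solve_def)
    finally show ?thesis .
  qed
  have "f \<in> J \<longleftrightarrow> (\<forall>\<xi>\<in>\<xi> ` (- leading). (\<Sum>\<^sub>\<infinity>\<alpha>. \<xi> \<alpha> * taylor_coeff f \<alpha>) = 0)" if f: "holomorphic_near_0 f" for f
  proof -
    obtain r t where r: "power_series r (\<lambda>\<alpha>. if \<alpha> \<in> leading then 0 else solve K (taylor_coeff f) \<alpha>) t"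
      and fr: "(\<lambda>z. f z - r z) \<in> J" using K[OF f] by blast
    let ?c = "\<lambda>\<alpha>. if \<alpha> \<in> leading then 0 else solve K (taylor_coeff f) \<alpha>"
    have "f \<in> J \<longleftrightarrow> (\<forall>\<alpha>\<in>- leading. solve K (taylor_coeff f) \<alpha> = 0)"
    proof
      assume "f \<in> J"
      then have "(\<lambda>z. f z - (f z - r z)) \<in> J" using fr by (rule diff)
      then have rJ: "r \<in> J" by simp
      show "\<forall>\<alpha>\<in>- leading. solve K (taylor_coeff f) \<alpha> = 0"
      proof (rule ccontr)
        assume "\<not> ?thesis"
        then obtain \<alpha>0 where "\<alpha>0 \<notin> leading" "solve K (taylor_coeff f) \<alpha>0 \<noteq> 0" by auto
        then have "?c \<alpha>0 \<noteq> 0" by simp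
        then obtain \<alpha> where \<alpha>: "?c \<alpha> \<noteq> 0" "\<And>\<gamma>. wt \<gamma> < wt \<alpha> \<Longrightarrow> ?c \<gamma> = 0"
          by (rule minimal_wt[of "\<lambda>\<alpha>. ?c \<alpha> \<noteq> 0"]) blast
        \<comment> \<open>Normalised as \<open>leading\<close> demands, \<open>r\<close> puts its
          own leading exponent into \<open>leading\<close>, where all its coefficients are
          0.\<close>
        have "(\<lambda>z. (1 / ?c \<alpha>) * r z) \<in> J" using mult[OF rJ holomorphic_near_0_const] .
        moreover have "taylor_coeff (\<lambda>z. (1 / ?c \<alpha>) * r z) = (\<lambda>\<gamma>. (1 / ?c \<alpha>) * ?c \<gamma>)"
          by (rule taylor_coeff_eqI[OF power_series_cmult[OF r]])
        ultimately have "\<alpha> \<in> leading"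
          by (rule leadingI) (use \<alpha> in \<open>simp_all del: if_split\<close>)
        then show False using \<alpha>(1) by simp
      qed
    next
      assume "\<forall>\<alpha>\<in>- leading. solve K (taylor_coeff f) \<alpha> = 0"
      then have "?c = (\<lambda>\<alpha>. 0)" by auto
      then have "power_series r (\<lambda>\<alpha>. 0) t" using r by simp
      then have "r z = 0" if "z \<in> wdisc t" for z
      proof -
        have "((\<lambda>\<alpha>. 0) has_sum r z) (UNIV :: ('n \<Rightarrow> nat) set)"
          using \<open>power_series r (\<lambda>\<alpha>. 0) t\<close> that by (simp add: power_series_def)
        moreover have "((\<lambda>\<alpha>. 0) has_sum (0 :: complex)) (UNIV :: ('n \<Rightarrow> nat) set)" by (rule has_sum_0) simp
        ultimately show ?thesis by (rule has_sum_unique)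
      qed
      then have "\<forall>\<^sub>F z in nhds 0. f z = f z - r z"
        using eventually_in_wdisc[of t] by (auto elim: eventually_mono)
      from local[OF fr this] show "f \<in> J" .
    qed
    then show ?thesis by (simp add: solve)
  qed
  moreover have "finite {\<gamma>. \<xi> \<alpha> \<gamma> \<noteq> 0}" for \<alpha>
    by (rule finite_subset[OF _ finite_wt_le[of "wt \<alpha>"]]) (auto simp: \<xi>_def)
  ultimately show ?thesis by (intro exI[of _ "\<xi> ` (- leading)"]) blast
qed

end

section \<open>The Bergman space\<close>

lemma distr_lborel_eqI:
  assumes T: "T \<in> borel_measurable borel"
    and eq: "\<And>F :: 'a::euclidean_space \<Rightarrow> ennreal. F \<in> borel_measurable borel \<Longrightarrow> (\<integral>\<^sup>+x. F (T x) \<partial>lborel) = (\<integral>\<^sup>+x. F x \<partial>lborel)"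
  shows "distr lborel borel T = lborel"
proof (rule measure_eqI)
  fix A assume "A \<in> sets (distr lborel borel T)"
  then have A: "A \<in> sets borel" by simp
  have "emeasure (distr lborel borel T) A = (\<integral>\<^sup>+x. indicator A x \<partial>distr lborel borel T)"
    using A by simp
  also have "\<dots> = (\<integral>\<^sup>+x. indicator A (T x) \<partial>lborel)" using T A by (subst nn_integral_distr) auto
  also have "\<dots> = (\<integral>\<^sup>+x. indicator A x \<partial>lborel)" using A by (intro eq) auto
  also have "\<dots> = emeasure lborel A" using A by simp
  finally show "emeasure (distr lborel borel T) A = emeasure lborel A" .
qed simp

lemma distr_lborel_compose:
  assumes "S \<in> borel_measurable borel" "distr lborel borel S = lborel"
    and "T \<in> borel_measurable borel" "distr lborel borel T = lborel"
  shows "distr lborel borel (\<lambda>x. S (T x)) = lborel"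
proof -
  have "distr (distr lborel borel T) borel S = distr lborel borel (S \<circ> T)"
    by (rule distr_distr) (use assms in auto)
  then show ?thesis using assms by (simp add: o_def)
qed

lemma distr_lborel_id: "distr lborel borel (\<lambda>x. x) = (lborel :: 'a::euclidean_space measure)"
  by (rule distr_lborel_eqI) auto

text \<open>By Fubini the coordinate along \<open>b'\<close> may be integrated first. With all other
  coordinates fixed, \<open>x \<bullet> b\<close> is constant and the shear is a translation of that
  coordinate.\<close>

lemma lborel_shear:
  fixes b b' :: "'a::euclidean_space" and c :: real
  assumes b: "b \<in> Basis" "b' \<in> Basis" "b \<noteq> b'"
  shows "distr lborel borel (\<lambda>x. x + (c * (x \<bullet> b)) *\<^sub>R b') = lborel"
proof (rule distr_lborel_eqI)
  show T: "(\<lambda>x. x + (c * (x \<bullet> b)) *\<^sub>R b') \<in> borel_measurable borel"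
    by (intro borel_measurable_continuous_onI continuous_intros)
  fix F :: "'a \<Rightarrow> ennreal" assume F[measurable]: "F \<in> borel_measurable borel"
  interpret product_sigma_finite "\<lambda>_ :: 'a. lborel :: real measure" by standard
  let ?I = "Basis - {b'}"
  have I: "finite ?I" "b' \<notin> ?I" "insert b' ?I = Basis" using b by auto
  let ?\<Phi> = "\<lambda>f :: 'a \<Rightarrow> real. \<Sum>b\<in>Basis. f b *\<^sub>R b"
  have red: "(\<integral>\<^sup>+x. H x \<partial>lborel) = (\<integral>\<^sup>+x. (\<integral>\<^sup>+y. H ((\<Sum>k\<in>?I. x k *\<^sub>R k) + y *\<^sub>R b') \<partial>lborel) \<partial>Pi\<^sub>M ?I (\<lambda>_. lborel))"
    if H[measurable]: "H \<in> borel_measurable borel" for H :: "'a \<Rightarrow> ennreal"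
  proof -
    have ins: "?\<Phi> (x(b' := y)) = (\<Sum>k\<in>?I. x k *\<^sub>R k) + y *\<^sub>R b'" for x y
      using b by (simp add: sum.remove[of Basis b'])
    have "(\<integral>\<^sup>+x. H x \<partial>lborel) = (\<integral>\<^sup>+x. H (?\<Phi> x) \<partial>Pi\<^sub>M Basis (\<lambda>_. lborel))"
      by (subst lborel_eq, subst nn_integral_distr) auto
    also have "\<dots> = (\<integral>\<^sup>+x. (\<integral>\<^sup>+y. H (?\<Phi> (x(b' := y))) \<partial>lborel) \<partial>Pi\<^sub>M ?I (\<lambda>_. lborel))"
      using product_nn_integral_insert[OF I(1,2), of "\<lambda>x. H (?\<Phi> x)"] unfolding I(3) by simp
    finally show ?thesis unfolding ins .
  qed
  have "(\<integral>\<^sup>+y. F ((\<Sum>k\<in>?I. x k *\<^sub>R k) + y *\<^sub>R b' + (c * (((\<Sum>k\<in>?I. x k *\<^sub>R k) + y *\<^sub>R b') \<bullet> b)) *\<^sub>R b') \<partial>lborel)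
      = (\<integral>\<^sup>+y. F ((\<Sum>k\<in>?I. x k *\<^sub>R k) + y *\<^sub>R b') \<partial>lborel)" for x
  proof -
    have "((\<Sum>k\<in>?I. x k *\<^sub>R k) + y *\<^sub>R b') \<bullet> b = (\<Sum>k\<in>?I. x k *\<^sub>R k) \<bullet> b" for y
      using b by (simp add: inner_add_left inner_Basis)
    then have "(\<integral>\<^sup>+y. F ((\<Sum>k\<in>?I. x k *\<^sub>R k) + y *\<^sub>R b' + (c * (((\<Sum>k\<in>?I. x k *\<^sub>R k) + y *\<^sub>R b') \<bullet> b)) *\<^sub>R b') \<partial>lborel)
      = (\<integral>\<^sup>+y. F ((\<Sum>k\<in>?I. x k *\<^sub>R k) + (c * ((\<Sum>k\<in>?I. x k *\<^sub>R k) \<bullet> b) + 1 * y) *\<^sub>R b') \<partial>lborel)"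
      by (intro nn_integral_cong arg_cong[of _ _ F]) (simp add: algebra_simps)
    also have "\<dots> = (\<integral>\<^sup>+y. F ((\<Sum>k\<in>?I. x k *\<^sub>R k) + y *\<^sub>R b') \<partial>lborel)"
    proof -
      have "(\<lambda>y. F ((\<Sum>k\<in>?I. x k *\<^sub>R k) + y *\<^sub>R b')) \<in> borel_measurable borel"
        by measurable
      from nn_integral_real_affine[OF this, of 1 "c * ((\<Sum>k\<in>?I. x k *\<^sub>R k) \<bullet> b)"]
      show ?thesis by simp
    qed
    finally show ?thesis .
  qed
  then show "(\<integral>\<^sup>+x. F (x + (c * (x \<bullet> b)) *\<^sub>R b') \<partial>lborel) = (\<integral>\<^sup>+x. F x \<partial>lborel)"
    using red[of "\<lambda>x. F (x + (c * (x \<bullet> b)) *\<^sub>R b')"] red[OF F] measurable_compose[OF T F] by simp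
qed

definition rot :: "'n set \<Rightarrow> complex \<Rightarrow> complex^'n \<Rightarrow> complex^'n" where
  "rot A u x = (\<chi> j. if j \<in> A then u * x $ j else x $ j)"

lemma borel_measurable_rot:
  fixes A :: "'n::finite set"
  shows "rot A u \<in> borel_measurable borel"
proof (rule borel_measurable_continuous_onI)
  have "continuous_on UNIV (\<lambda>x :: complex^'n. if j \<in> A then u * x $ j else x $ j)" for j
    by (cases "j \<in> A") (simp_all, (intro continuous_intros)+)
  then have "continuous_on UNIV (\<lambda>x :: complex^'n. \<chi> j. if j \<in> A then u * x $ j else x $ j)"
    by (rule continuous_on_vec_lambda)
  then show "continuous_on UNIV (rot A u :: complex^'n \<Rightarrow> _)" unfolding rot_def[abs_def] .
qed

text \<open>A plane rotation whose sine does not vanish is a product of three shears.\<close>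

lemma lborel_rot_single:
  assumes "cmod u = 1"
  shows "distr lborel borel (rot {i} u) = (lborel :: (complex^'n) measure)"
proof -
  have main: "distr lborel borel (rot {i} u) = (lborel :: (complex^'n) measure)" if u: "cmod u = 1" "Im u \<noteq> 0" for u
  proof -
    define e f where "e = (axis i 1 :: complex^'n)" and "f = (axis i \<i> :: complex^'n)"
    have ef: "e \<in> Basis" "f \<in> Basis" "e \<noteq> f"
      by (auto simp: e_def f_def Basis_vec_def Basis_complex_def axis_eq_axis)
    \<comment> \<open>For \<open>u = exp (\<i> * \<theta>)\<close> this is minus the tangent of
      \<theta>/2, the slope in the classical factorisation of a rotation as shear, shear by the
      sine, and the first shear again.\<close>
    define a where "a = (Re u - 1) / Im u"
    define S where "S = (\<lambda>x :: complex^'n. x + (a * (x \<bullet> f)) *\<^sub>R e)"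
    define T where "T = (\<lambda>x :: complex^'n. x + (Im u * (x \<bullet> e)) *\<^sub>R f)"
    have S: "S \<in> borel_measurable borel" "distr lborel borel S = lborel"
      unfolding S_def using lborel_shear[OF ef(2,1)] ef(3)
      by (auto intro!: borel_measurable_continuous_onI continuous_intros)
    have T: "T \<in> borel_measurable borel" "distr lborel borel T = lborel"
      unfolding T_def using lborel_shear[OF ef]
      by (auto intro!: borel_measurable_continuous_onI continuous_intros)
    have ST: "distr lborel borel (\<lambda>x. S (T x)) = lborel"
      by (rule distr_lborel_compose[OF S T])
    have m: "(\<lambda>x. S (T x)) \<in> borel_measurable borel" using measurable_compose[OF T(1) S(1)] .
    have "distr lborel borel (\<lambda>x. S (T (S x))) = lborel"
      by (rule distr_lborel_compose[OF m ST S])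
    moreover have "S (T (S x)) = rot {i} u x" for x
    proof -
      have a1: "1 + a * Im u = Re u" using u by (simp add: a_def)
      have n: "(Re u)\<^sup>2 + (Im u)\<^sup>2 = 1" using u(1) by (simp add: cmod_def)
      have a2: "a + a * Re u = - Im u"
      proof -
        have "(a + a * Re u) * Im u = (Re u - 1) * (1 + Re u)" using u(2) by (simp add: a_def field_simps)
        also have "\<dots> = - Im u * Im u" using n by (simp add: algebra_simps power2_eq_square)
        finally show ?thesis using u(2) mult_right_cancel by blast
      qed
      have inn: "x \<bullet> e = Re (x $ i)" "x \<bullet> f = Im (x $ i)" for x :: "complex^'n"
        by (simp_all add: e_def f_def inner_axis inner_complex_def)
      have Sn: "S x $ j = (if j = i then x $ j + of_real (a * Im (x $ i)) else x $ j)" for x j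
        by (simp add: S_def inn) (simp add: e_def axis_def scaleR_conv_of_real)
      have Tn: "T x $ j = (if j = i then x $ j + of_real (Im u * Re (x $ i)) * \<i> else x $ j)" for x j
        by (simp add: T_def inn) (simp add: f_def axis_def scaleR_conv_of_real)
      define p q where "p = Re (x $ i)" and "q = Im (x $ i)"
      have R1: "Re (S x $ i) = p + a * q" "Im (S x $ i) = q" by (simp_all add: Sn p_def q_def)
      have R2: "Re (T (S x) $ i) = p + a * q" "Im (T (S x) $ i) = q + Im u * (p + a * q)"
        using R1 by (simp_all add: Tn)
      have R3: "Re (S (T (S x)) $ i) = p + a * q + a * (q + Im u * (p + a * q))"
        "Im (S (T (S x)) $ i) = q + Im u * (p + a * q)"
        using R2 by (simp_all add: Sn)
      have "p + a * q + a * (q + Im u * (p + a * q)) = p * (1 + a * Im u) + q * (a + a * (1 + a * Im u))"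
        by (simp add: algebra_simps)
      also have "\<dots> = Re u * p - Im u * q" unfolding a1 a2 by (simp add: algebra_simps)
      finally have re: "Re (S (T (S x)) $ i) = Re (u * x $ i)" by (simp add: R3 p_def q_def)
      have "q + Im u * (p + a * q) = q * (1 + a * Im u) + Im u * p" by (simp add: algebra_simps)
      then have "Im (S (T (S x)) $ i) = Im (u * x $ i)" unfolding R3 a1 by (simp add: p_def q_def algebra_simps)
      with re have "S (T (S x)) $ i = u * x $ i" by (simp add: complex_eq_iff)
      moreover have "S (T (S x)) $ j = x $ j" if "j \<noteq> i" for j using that by (simp add: Sn Tn)
      ultimately show ?thesis by (auto simp: rot_def vec_eq_iff)
    qed
    ultimately show ?thesis by simp
  qed
  show ?thesis
  proof (cases "Im u = 0")
    case True
    then have "\<bar>Re u\<bar> = 1" using assms by (simp add: cmod_def)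
    then consider "u = 1" | "u = -1" using True by (auto simp: complex_eq_iff abs_if split: if_splits)
    then show ?thesis
    proof cases
      case 1
      then have "rot {i} u = (\<lambda>x :: complex^'n. x)" by (auto simp: rot_def vec_eq_iff fun_eq_iff)
      then show ?thesis by (simp add: distr_lborel_id)
    next
      case 2
      \<comment> \<open>The half turn has sine 0 and so escapes the shear formula, but it is the
        square of a quarter turn.\<close>
      then have "rot {i} u = (\<lambda>x :: complex^'n. rot {i} \<i> (rot {i} \<i> x))"
        by (auto simp: rot_def vec_eq_iff fun_eq_iff mult.assoc[symmetric])
      then show ?thesis
        using distr_lborel_compose[OF borel_measurable_rot main borel_measurable_rot main, of \<i> \<i>] by simp
    qed
  qed (use main assms in blast)
qed

lemma lborel_rotation:
  assumes "cmod u = 1"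
  shows "distr lborel borel (\<lambda>x. u *s x) = (lborel :: (complex^'n) measure)"
proof -
  have "distr lborel borel (rot A u) = (lborel :: (complex^'n) measure)" if "finite A" for A :: "'n set"
    using that
  proof (induction A rule: finite_induct)
    case empty
    have "rot {} u = (\<lambda>x :: complex^'n. x)" by (auto simp: rot_def vec_eq_iff fun_eq_iff)
    then show ?case by (simp add: distr_lborel_id)
  next
    case (insert i A)
    have "rot (insert i A) u = (\<lambda>x :: complex^'n. rot {i} u (rot A u x))"
      using insert.hyps by (auto simp: rot_def vec_eq_iff fun_eq_iff)
    then show ?case
      using distr_lborel_compose[OF borel_measurable_rot lborel_rot_single[OF assms] borel_measurable_rot insert.IH]
      by simp
  qed
  moreover have "rot UNIV u = (\<lambda>x :: complex^'n. u *s x)" by (auto simp: rot_def vec_eq_iff fun_eq_iff)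
  ultimately show ?thesis by (metis finite)
qed

section \<open>Mean values and the size of holomorphic functions\<close>

lemma cmod_le_circle_mean:
  assumes g: "g holomorphic_on cball 0 1"
  shows "ennreal (cmod (g 0)) \<le> (\<integral>\<^sup>+x. ennreal (cmod (g (exp (2 * of_real pi * \<i> * of_real x)))) * indicator {0..1} x \<partial>lborel)"
proof -
  let ?e = "\<lambda>x :: real. exp (2 * of_real pi * \<i> * of_real x)"
  have e: "?e x \<in> cball 0 1" for x by (simp add: norm_exp_eq_Re)
  have d: "vector_derivative (circlepath 0 1) (at x within {0..1}) = 2 * pi * \<i> * ?e x" if "x \<in> {0..1}" for x
    using vector_derivative_circlepath01[of x 0 1] that by simp
  have c: "circlepath 0 1 x = ?e x" for x by (simp add: circlepath)
  have "((\<lambda>u. g u / (u - 0)) has_contour_integral (2 * of_real pi * \<i> * g 0)) (circlepath 0 1)"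
    by (rule Cauchy_integral_circlepath_simple[OF g]) simp
  then have "((\<lambda>x. g (?e x) / ?e x * (2 * pi * \<i> * ?e x)) has_integral (2 * of_real pi * \<i> * g 0)) {0..1}"
    unfolding has_contour_integral_def
    by (rule has_integral_eq[rotated]) (simp add: d c)
  then have "((\<lambda>x. (2 * pi * \<i>) * g (?e x)) has_integral (2 * of_real pi * \<i> * g 0)) {0..1}"
    by (rule has_integral_eq[rotated]) (simp add: mult_ac)
  from has_integral_mult_right[OF this, of "1 / (2 * pi * \<i>)"]
  have hi: "((\<lambda>x. g (?e x)) has_integral g 0) {0..1}" by simp
  have "continuous_on {0..1} (\<lambda>x. g (?e x))"
    by (rule continuous_on_compose2[OF holomorphic_on_imp_continuous_on[OF g]])
      (use e in \<open>auto intro!: continuous_intros\<close>)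
  then have int: "(\<lambda>x. cmod (g (?e x))) integrable_on {0..1}"
    by (intro integrable_continuous_real continuous_intros)
  have "cmod (integral {0..1} (\<lambda>x. g (?e x))) \<le> integral {0..1} (\<lambda>x. cmod (g (?e x)))"
    by (rule integral_norm_bound_integral) (use hi int in auto)
  then have "cmod (g 0) \<le> integral {0..1} (\<lambda>x. cmod (g (?e x)))" using integral_unique[OF hi] by simp
  then have "ennreal (cmod (g 0)) \<le> ennreal (integral {0..1} (\<lambda>x. cmod (g (?e x))))" by (rule ennreal_leI)
  also have "\<dots> = (\<integral>\<^sup>+x. ennreal (cmod (g (?e x))) * indicator {0..1} x \<partial>lborel)"
    by (rule nn_integral_has_integral_lebesgue'[symmetric]) (use int in auto)
  finally show ?thesis .
qed

lemma borel_measurable_extend_zero: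
  assumes "f mv_holomorphic_on D" "open D" "\<And>z. z \<notin> D \<Longrightarrow> f z = 0"
  shows "f \<in> borel_measurable borel"
proof -
  have "(\<lambda>z. indicator D z *\<^sub>R f z) \<in> borel_measurable borel"
    using assms by (intro borel_measurable_continuous_on_indicator mv_holomorphic_on_imp_continuous_on) auto
  moreover have "(\<lambda>z. indicator D z *\<^sub>R f z) = f" using assms(3) by (auto simp: indicator_def)
  ultimately show ?thesis by simp
qed

text \<open>For each \<open>w\<close> in the ball the one-variable mean value inequality is applied
  to the square of \<open>f\<close> on the disc \<open>z + t *s w\<close>; squaring \<open>f\<close>
  itself keeps the integrand holomorphic. After integrating over \<open>w\<close> and exchanging the
  integrals, rotation invariance makes all angles contribute equally.\<close>

lemma sub_mean_value:
  fixes f :: "complex^'n \<Rightarrow> complex"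
  assumes f: "f mv_holomorphic_on D" "open D" "\<And>z. z \<notin> D \<Longrightarrow> f z = 0" and r: "cball z r \<subseteq> D"
  shows "ennreal ((cmod (f z))\<^sup>2) * emeasure lborel (ball (0 :: complex^'n) r) \<le> (\<integral>\<^sup>+w. ennreal ((cmod (f w))\<^sup>2) \<partial>lborel)"
proof -
  let ?e = "\<lambda>x :: real. exp (2 * of_real pi * \<i> * of_real x)"
  define H where "H w = ennreal ((cmod (f (z + w)))\<^sup>2) * indicator (ball 0 r) w" for w
  have fm[measurable]: "f \<in> borel_measurable borel" by (rule borel_measurable_extend_zero[OF f])
  have [measurable]: "ball (0 :: complex^'n) r \<in> sets borel" by simp
  have Hm[measurable]: "H \<in> borel_measurable borel" unfolding H_def by measurable
  have point: "ennreal ((cmod (f z))\<^sup>2) * indicator (ball 0 r) w \<le> (\<integral>\<^sup>+x. H (?e x *s w) * indicator {0..1} x \<partial>lborel)" for w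
  proof (cases "w \<in> ball 0 r")
    case True
    have "z + t *s w \<in> D" if "t \<in> cball 0 1" for t :: complex
    proof -
      have "cmod t * norm w \<le> 1 * norm w" using that by (intro mult_right_mono) auto
      then have "z + t *s w \<in> cball z r" using True by (simp add: dist_norm norm_vector_smult)
      then show ?thesis using r by blast
    qed
    then have "(\<lambda>t. f (z + t *s w) * f (z + t *s w)) holomorphic_on cball 0 1"
      by (intro holomorphic_on_mult holomorphic_on_line[OF f(1,2)])
    from cmod_le_circle_mean[OF this]
    have "ennreal ((cmod (f z))\<^sup>2) \<le> (\<integral>\<^sup>+x. ennreal ((cmod (f (z + ?e x *s w)))\<^sup>2) * indicator {0..1} x \<partial>lborel)"
      by (simp add: norm_mult power2_eq_square)
    moreover have "?e x *s w \<in> ball 0 r" for x using True by (simp add: norm_vector_smult norm_exp_eq_Re)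
    ultimately show ?thesis using True by (simp add: H_def)
  qed simp
  have "ennreal ((cmod (f z))\<^sup>2) * emeasure lborel (ball (0 :: complex^'n) r)
      = (\<integral>\<^sup>+w. ennreal ((cmod (f z))\<^sup>2) * indicator (ball 0 r) (w :: complex^'n) \<partial>lborel)"
    by (subst nn_integral_cmult_indicator) auto
  also have "\<dots> \<le> (\<integral>\<^sup>+w. \<integral>\<^sup>+x. H (?e x *s w) * indicator {0..1} x \<partial>lborel \<partial>lborel)"
    by (intro nn_integral_mono point)
  also have "\<dots> = (\<integral>\<^sup>+x. \<integral>\<^sup>+w. H (?e x *s w) * indicator {0..1} x \<partial>lborel \<partial>lborel)"
  proof (rule lborel_pair.Fubini')
    have "continuous_on UNIV (\<lambda>p :: real \<times> (complex^'n). ?e (fst p) *s snd p)"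
      unfolding vector_scalar_mult_def by (intro continuous_intros continuous_on_vec_lambda)
    then have m: "(\<lambda>p :: real \<times> (complex^'n). ?e (fst p) *s snd p) \<in> borel_measurable borel"
      by (rule borel_measurable_continuous_onI)
    have [measurable]: "(\<lambda>p :: real \<times> (complex^'n). H (?e (fst p) *s snd p)) \<in> borel_measurable (borel \<Otimes>\<^sub>M borel)"
      using measurable_compose[OF m Hm] by (simp add: borel_prod)
    show "case_prod (\<lambda>x w. H (?e x *s w) * indicator {0..1} x) \<in> borel_measurable (lborel \<Otimes>\<^sub>M lborel)"
      unfolding case_prod_unfold by measurable
  qed
  also have "\<dots> = (\<integral>\<^sup>+x. (\<integral>\<^sup>+w. H w \<partial>lborel) * indicator {0..1::real} x \<partial>lborel)"
  proof (rule nn_integral_cong)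
    fix x :: real
    have mm: "(\<lambda>w :: complex^'n. ?e x *s w) \<in> borel_measurable borel"
      unfolding vector_scalar_mult_def
      by (intro borel_measurable_continuous_onI continuous_on_vec_lambda continuous_intros)
    have "(\<integral>\<^sup>+w. H w \<partial>lborel) = (\<integral>\<^sup>+w. H w \<partial>distr lborel borel (\<lambda>w. ?e x *s w))"
      by (subst lborel_rotation) (simp_all add: norm_exp_eq_Re)
    also have "\<dots> = (\<integral>\<^sup>+w. H (?e x *s w) \<partial>lborel)"
      using mm by (subst nn_integral_distr) auto
    finally show "(\<integral>\<^sup>+w. H (?e x *s w) * indicator {0..1} x \<partial>lborel) = (\<integral>\<^sup>+w. H w \<partial>lborel) * indicator {0..1} x"
      using measurable_compose[OF mm Hm] by (subst nn_integral_multc) auto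
  qed
  also have "\<dots> = (\<integral>\<^sup>+w. H w \<partial>lborel)" by (subst nn_integral_cmult_indicator) auto
  also have "\<dots> \<le> (\<integral>\<^sup>+w. ennreal ((cmod (f (z + w)))\<^sup>2) \<partial>lborel)"
    by (intro nn_integral_mono) (auto simp: H_def indicator_def)
  also have "\<dots> = (\<integral>\<^sup>+w. ennreal ((cmod (f w))\<^sup>2) \<partial>distr lborel borel ((+) z))"
    by (subst nn_integral_distr) auto
  also have "\<dots> = (\<integral>\<^sup>+w. ennreal ((cmod (f w))\<^sup>2) \<partial>lborel)" by (simp add: lborel_distr_plus)
  finally show ?thesis .
qed

section \<open>Inner product and norm on the Bergman space\<close>

lemma bergman_iff:
  "f \<in> bergman D \<longleftrightarrow> f mv_holomorphic_on D \<and> (\<forall>z. z \<notin> D \<longrightarrow> f z = 0) \<and> integrable lborel (\<lambda>z. (cmod (f z))\<^sup>2)"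
proof -
  have "(\<lambda>z. indicator D z *\<^sub>R (cmod (f z))\<^sup>2) = (\<lambda>z. (cmod (f z))\<^sup>2)" if "\<forall>z. z \<notin> D \<longrightarrow> f z = 0"
    using that by (auto simp: indicator_def fun_eq_iff)
  then show ?thesis unfolding bergman_def set_integrable_def by auto
qed

lemma bergman_inner_eq:
  assumes "f \<in> bergman D"
  shows "bergman_inner D f g = (LINT z|lborel. f z * cnj (g z))"
proof -
  have "(\<lambda>z. indicator D z *\<^sub>R (f z * cnj (g z))) = (\<lambda>z. f z * cnj (g z))"
    using assms by (auto simp: bergman_iff indicator_def fun_eq_iff)
  then show ?thesis by (simp add: bergman_inner_def set_lebesgue_integral_def)
qed

lemma bergman_norm_eq:
  assumes "f \<in> bergman D"
  shows "bergman_norm D f = sqrt (LINT z|lborel. (cmod (f z))\<^sup>2)"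
proof -
  have "(\<lambda>z. indicator D z *\<^sub>R (cmod (f z))\<^sup>2) = (\<lambda>z. (cmod (f z))\<^sup>2)"
    using assms by (auto simp: bergman_iff indicator_def fun_eq_iff)
  then show ?thesis by (simp add: bergman_norm_def set_lebesgue_integral_def)
qed

lemma bergman_norm_nonneg: "bergman_norm D f \<ge> 0"
  by (simp add: bergman_norm_def set_lebesgue_integral_def)

lemma bergman_norm_nn_integral:
  assumes "f \<in> bergman D"
  shows "(\<integral>\<^sup>+z. ennreal ((cmod (f z))\<^sup>2) \<partial>lborel) = ennreal ((bergman_norm D f)\<^sup>2)"
  using assms by (subst nn_integral_eq_integral) (auto simp: bergman_iff bergman_norm_eq)

lemma bergman_norm_eq_inner:
  assumes "f \<in> bergman D"
  shows "bergman_inner D f f = of_real ((bergman_norm D f)\<^sup>2)"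
proof -
  have "(LINT z|lborel. f z * cnj (f z)) = (LINT z|lborel. of_real ((cmod (f z))\<^sup>2))"
    by (simp add: complex_norm_square[symmetric] del: of_real_power)
  also have "\<dots> = of_real (LINT z|lborel. (cmod (f z))\<^sup>2)" by (rule integral_complex_of_real)
  finally show ?thesis using assms by (simp add: bergman_inner_eq bergman_norm_eq)
qed

lemma bergman_measurable:
  "open D \<Longrightarrow> f \<in> bergman D \<Longrightarrow> f \<in> borel_measurable borel"
  by (rule borel_measurable_extend_zero[of f D]) (auto simp: bergman_iff)

lemma bergman_integrable_product:
  assumes D: "open D" and f: "f \<in> bergman D" and g: "g \<in> bergman D"
  shows "integrable lborel (\<lambda>z. f z * cnj (g z))"
proof (rule Bochner_Integration.integrable_bound)
  show "integrable lborel (\<lambda>z. (cmod (f z))\<^sup>2 + (cmod (g z))\<^sup>2)"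
    using f g by (auto simp: bergman_iff)
  show "(\<lambda>z. f z * cnj (g z)) \<in> borel_measurable lborel"
    using bergman_measurable[OF D f] measurable_compose[OF bergman_measurable[OF D g]
        borel_measurable_continuous_onI[OF continuous_on_cnj[OF continuous_on_id]]]
    by (intro borel_measurable_times) simp_all
  show "AE z in lborel. norm (f z * cnj (g z)) \<le> norm ((cmod (f z))\<^sup>2 + (cmod (g z))\<^sup>2)"
  proof (rule AE_I2)
    fix z
    have "2 * (cmod (f z) * cmod (g z)) \<le> (cmod (f z))\<^sup>2 + (cmod (g z))\<^sup>2"
      using sum_squares_bound[of "cmod (f z)" "cmod (g z)"] by simp
    moreover have "0 \<le> cmod (f z) * cmod (g z)" by simp
    ultimately have "cmod (f z) * cmod (g z) \<le> (cmod (f z))\<^sup>2 + (cmod (g z))\<^sup>2" by linarith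
    then show "norm (f z * cnj (g z)) \<le> norm ((cmod (f z))\<^sup>2 + (cmod (g z))\<^sup>2)"
      by (simp add: norm_mult)
  qed
qed

lemma bergman_zero: "(\<lambda>z. 0) \<in> bergman D"
  by (simp add: bergman_iff mv_holomorphic_on_const)

lemma bergman_scale: "f \<in> bergman D \<Longrightarrow> (\<lambda>z. c * f z) \<in> bergman D"
  by (auto simp: bergman_iff mv_holomorphic_on_cmult norm_mult power_mult_distrib)

lemma bergman_add:
  assumes D: "open D" and f: "f \<in> bergman D" and g: "g \<in> bergman D"
  shows "(\<lambda>z. f z + g z) \<in> bergman D"
proof -
  have "integrable lborel (\<lambda>z. (cmod (f z + g z))\<^sup>2)"
  proof (rule Bochner_Integration.integrable_bound)
    show "integrable lborel (\<lambda>z. 2 * (cmod (f z))\<^sup>2 + 2 * (cmod (g z))\<^sup>2)"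
      using f g by (auto simp: bergman_iff)
    show "(\<lambda>z. (cmod (f z + g z))\<^sup>2) \<in> borel_measurable lborel"
      using bergman_measurable[OF D f] bergman_measurable[OF D g] by measurable
    show "AE z in lborel. norm ((cmod (f z + g z))\<^sup>2) \<le> norm (2 * (cmod (f z))\<^sup>2 + 2 * (cmod (g z))\<^sup>2)"
    proof (rule AE_I2)
      fix z
      have "(cmod (f z + g z))\<^sup>2 \<le> (cmod (f z) + cmod (g z))\<^sup>2"
        by (intro power_mono norm_triangle_ineq) simp
      also have "\<dots> \<le> 2 * (cmod (f z))\<^sup>2 + 2 * (cmod (g z))\<^sup>2"
        using sum_squares_bound[of "cmod (f z)" "cmod (g z)"] by (simp add: power2_sum)
      finally show "norm ((cmod (f z + g z))\<^sup>2) \<le> norm (2 * (cmod (f z))\<^sup>2 + 2 * (cmod (g z))\<^sup>2)" by simp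
    qed
  qed
  then show ?thesis using f g by (auto simp: bergman_iff mv_holomorphic_on_add)
qed

lemma bergman_diff:
  assumes D: "open D" and f: "f \<in> bergman D" and g: "g \<in> bergman D"
  shows "(\<lambda>z. f z - g z) \<in> bergman D"
  using bergman_add[OF D f bergman_scale[OF g, of "-1"]] by simp

lemma bergman_pointwise_bound:
  fixes D :: "(complex^'n) set"
  assumes D: "open D" and f: "f \<in> bergman D" and r: "r > 0" "cball z r \<subseteq> D"
  shows "cmod (f z) \<le> bergman_norm D f / sqrt (measure lborel (ball (0 :: complex^'n) r))"
proof -
  let ?v = "measure lborel (ball (0 :: complex^'n) r)"
  have v: "?v > 0" using r by (simp add: content_ball_pos)
  have em: "emeasure lborel (ball (0 :: complex^'n) r) = ennreal ?v"
    by (rule emeasure_eq_ennreal_measure) (use emeasure_bounded_finite[of "ball (0 :: complex^'n) r"] in auto)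
  have "ennreal ((cmod (f z))\<^sup>2 * ?v) \<le> ennreal ((bergman_norm D f)\<^sup>2)"
    using sub_mean_value[of f D z r] f D r(2)
    by (simp add: bergman_iff[of f] bergman_norm_nn_integral[OF f] em ennreal_mult)
  then have "(cmod (f z))\<^sup>2 * ?v \<le> (bergman_norm D f)\<^sup>2" by (simp add: ennreal_le_iff)
  then have "(cmod (f z))\<^sup>2 \<le> (bergman_norm D f / sqrt ?v)\<^sup>2" using v by (simp add: power_divide field_simps)
  then show ?thesis by (rule power2_le_imp_le) (simp add: bergman_norm_nonneg)
qed

text \<open>The pointwise bound makes a norm-Cauchy sequence locally uniformly Cauchy, so its
  pointwise limit is holomorphic on \<open>D\<close>. Square integrability of the difference and
  convergence in norm then come from Fatou's lemma.\<close>

lemma bergman_complete: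
  fixes D :: "(complex^'n) set"
  assumes D: "open D" and s: "\<And>n. s n \<in> bergman D"
    and Cauchy: "\<And>e. e > 0 \<Longrightarrow> \<exists>N. \<forall>m\<ge>N. \<forall>n\<ge>N. bergman_norm D (\<lambda>z. s m z - s n z) < e"
  shows "\<exists>f\<in>bergman D. (\<lambda>n. bergman_norm D (\<lambda>z. s n z - f z)) \<longlonglongrightarrow> 0"
proof -
  define f where "f z = lim (\<lambda>n. s n z)" for z
  have unif: "\<exists>r>0. cball z0 r \<subseteq> D \<and> uniform_limit (cball z0 r) s f sequentially" if z0: "z0 \<in> D" for z0
  proof -
    obtain R where R: "R > 0" "cball z0 R \<subseteq> D" using D z0 open_contains_cball by blast
    define r where "r = R / 2"
    have r: "r > 0" using R by (simp add: r_def)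
    have sub: "cball z r \<subseteq> D" if "z \<in> cball z0 r" for z
    proof
      fix y assume "y \<in> cball z r"
      then have "y \<in> cball z0 R" using that dist_triangle[of z0 y z] by (simp add: r_def)
      then show "y \<in> D" using R by blast
    qed
    let ?v = "sqrt (measure lborel (ball (0 :: complex^'n) r))"
    have v: "?v > 0" using r by (simp add: content_ball_pos)
    have "uniformly_Cauchy_on (cball z0 r) s"
    proof (rule uniformly_Cauchy_onI)
      fix e :: real assume "e > 0"
      then have "e * ?v > 0" using v by simp
      then obtain N where N: "\<And>m n. m \<ge> N \<Longrightarrow> n \<ge> N \<Longrightarrow> bergman_norm D (\<lambda>z. s m z - s n z) < e * ?v"
        using Cauchy by blast
      have "dist (s m z) (s n z) < e" if "z \<in> cball z0 r" "m \<ge> N" "n \<ge> N" for m n z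
      proof -
        have "cmod (s m z - s n z) \<le> bergman_norm D (\<lambda>z. s m z - s n z) / ?v"
          by (rule bergman_pointwise_bound[OF D bergman_diff[OF D s s] r sub[OF that(1)]])
        also have "\<dots> < e" using N[OF that(2,3)] v by (simp add: field_simps)
        finally show ?thesis by (simp add: dist_norm)
      qed
      then show "\<exists>M. \<forall>x\<in>cball z0 r. \<forall>m\<ge>M. \<forall>n\<ge>M. dist (s m x) (s n x) < e" by blast
    qed
    then have "uniform_limit (cball z0 r) s f sequentially"
      unfolding f_def uniformly_convergent_uniform_limit_iff[symmetric] by (rule Cauchy_uniformly_convergent)
    moreover have "cball z0 r \<subseteq> D" using sub[of z0] r by simp
    ultimately show ?thesis using r by blast
  qed
  have hol: "f mv_holomorphic_on D"
    by (rule mv_holomorphic_on_uniform_limit[OF _ D unif]) (use s in \<open>auto simp: bergman_iff\<close>)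
  have f0: "f z = 0" if "z \<notin> D" for z using s that by (simp add: f_def bergman_iff)
  have lim: "(\<lambda>n. s n z) \<longlonglongrightarrow> f z" for z
  proof (cases "z \<in> D")
    case True
    then obtain r where "r > 0" "uniform_limit (cball z r) s f sequentially" using unif by blast
    then show ?thesis using tendsto_uniform_limitI by fastforce
  next
    case False
    then show ?thesis using s f0 by (simp add: bergman_iff)
  qed
  have fm[measurable]: "f \<in> borel_measurable borel" by (rule borel_measurable_extend_zero[OF hol D f0])
  have sm[measurable]: "s n \<in> borel_measurable borel" for n by (rule bergman_measurable[OF D s])
  have fatou: "(\<integral>\<^sup>+z. ennreal ((cmod (s n z - f z))\<^sup>2) \<partial>lborel) \<le> ennreal (e\<^sup>2)"
    if e: "e > 0" and N: "\<And>m. m \<ge> N \<Longrightarrow> bergman_norm D (\<lambda>z. s n z - s m z) < e" for n e N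
  proof -
    have "(\<integral>\<^sup>+z. ennreal ((cmod (s n z - f z))\<^sup>2) \<partial>lborel)
        = (\<integral>\<^sup>+z. liminf (\<lambda>m. ennreal ((cmod (s n z - s m z))\<^sup>2)) \<partial>lborel)"
    proof (rule nn_integral_cong)
      fix z
      have "(\<lambda>m. ennreal ((cmod (s n z - s m z))\<^sup>2)) \<longlonglongrightarrow> ennreal ((cmod (s n z - f z))\<^sup>2)"
        by (intro tendsto_ennrealI tendsto_intros lim)
      then show "ennreal ((cmod (s n z - f z))\<^sup>2) = liminf (\<lambda>m. ennreal ((cmod (s n z - s m z))\<^sup>2))"
        using lim_imp_Liminf[OF sequentially_bot] by metis
    qed
    also have "\<dots> \<le> liminf (\<lambda>m. \<integral>\<^sup>+z. ennreal ((cmod (s n z - s m z))\<^sup>2) \<partial>lborel)"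
      by (rule nn_integral_liminf) measurable
    also have "\<dots> \<le> ennreal (e\<^sup>2)"
    proof (rule Liminf_le)
      have "(\<integral>\<^sup>+z. ennreal ((cmod (s n z - s m z))\<^sup>2) \<partial>lborel) \<le> ennreal (e\<^sup>2)" if "m \<ge> N" for m
        using N[OF that] bergman_norm_nonneg[of D "\<lambda>z. s n z - s m z"]
        by (subst bergman_norm_nn_integral[OF bergman_diff[OF D s s]]) (intro ennreal_leI power_mono, auto)
      then show "\<forall>\<^sub>F m in sequentially. (\<integral>\<^sup>+z. ennreal ((cmod (s n z - s m z))\<^sup>2) \<partial>lborel) \<le> ennreal (e\<^sup>2)"
        using eventually_sequentially by blast
    qed simp
    finally show ?thesis .
  qed
  have diff: "(\<lambda>z. s n z - f z) \<in> bergman D \<and> bergman_norm D (\<lambda>z. s n z - f z) \<le> e"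
    if e: "e > 0" and N: "\<And>m. m \<ge> N \<Longrightarrow> bergman_norm D (\<lambda>z. s n z - s m z) < e" for n e N
  proof
    have "integrable lborel (\<lambda>z. (cmod (s n z - f z))\<^sup>2)"
    proof (rule integrableI_bounded)
      show "(\<lambda>z. (cmod (s n z - f z))\<^sup>2) \<in> borel_measurable lborel" by measurable
      show "(\<integral>\<^sup>+z. ennreal (norm ((cmod (s n z - f z))\<^sup>2)) \<partial>lborel) < \<infinity>"
        using le_less_trans[OF fatou[of e N n, OF e N] ennreal_less_top] by simp
    qed
    then show b: "(\<lambda>z. s n z - f z) \<in> bergman D"
      using s[of n] hol f0 by (auto simp: bergman_iff mv_holomorphic_on_diff)
    have "ennreal ((bergman_norm D (\<lambda>z. s n z - f z))\<^sup>2) \<le> ennreal (e\<^sup>2)"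
      using fatou[of e N n, OF e N] unfolding bergman_norm_nn_integral[OF b] .
    then have "(bergman_norm D (\<lambda>z. s n z - f z))\<^sup>2 \<le> e\<^sup>2"
      by (rule ennreal_le_iff[THEN iffD1, rotated]) simp
    then show "bergman_norm D (\<lambda>z. s n z - f z) \<le> e"
      by (rule power2_le_imp_le) (use e in simp)
  qed
  \<comment> \<open>So far only differences \<open>s n - f\<close> are known to lie in the space;
    subtracting one of them from \<open>s N1\<close> gives \<open>f\<close> itself.\<close>
  obtain N1 where N1: "\<And>m n. m \<ge> N1 \<Longrightarrow> n \<ge> N1 \<Longrightarrow> bergman_norm D (\<lambda>z. s m z - s n z) < 1"
    using Cauchy[of 1] by auto
  have "(\<lambda>z. s N1 z - f z) \<in> bergman D" using diff[OF zero_less_one, of N1 N1] N1[OF order_refl] by blast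
  from bergman_diff[OF D s this, of N1] have fb: "f \<in> bergman D" by simp
  have "(\<lambda>n. bergman_norm D (\<lambda>z. s n z - f z)) \<longlonglongrightarrow> 0"
  proof (rule LIMSEQ_I)
    fix e :: real assume "e > 0"
    then have e2: "e / 2 > 0" by simp
    then obtain N where N: "\<And>m n. m \<ge> N \<Longrightarrow> n \<ge> N \<Longrightarrow> bergman_norm D (\<lambda>z. s m z - s n z) < e / 2"
      using Cauchy by blast
    have "norm (bergman_norm D (\<lambda>z. s n z - f z) - 0) < e" if "n \<ge> N" for n
    proof -
      have "bergman_norm D (\<lambda>z. s n z - f z) \<le> e / 2" using diff[OF e2, of N n] N[OF that] by blast
      then show ?thesis using bergman_norm_nonneg[of D "\<lambda>z. s n z - f z"] \<open>e > 0\<close> by simp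
    qed
    then show "\<exists>no. \<forall>n\<ge>no. norm (bergman_norm D (\<lambda>z. s n z - f z) - 0) < e" by blast
  qed
  then show ?thesis using fb by blast
qed

section \<open>Hilbert spaces of functions\<close>

text \<open>Hilbert space axioms relative to a carrier set of functions with pointwise operations.
  Definiteness is literal equality of functions, not equality almost everywhere; for the Bergman
  space the pointwise bound delivers it.\<close>

locale hilbert_function_space =
  fixes V :: "('x \<Rightarrow> complex) set" and ip :: "('x \<Rightarrow> complex) \<Rightarrow> ('x \<Rightarrow> complex) \<Rightarrow> complex"
    and nrm :: "('x \<Rightarrow> complex) \<Rightarrow> real"
  assumes zero_mem: "(\<lambda>x. 0) \<in> V"
    and add_mem: "f \<in> V \<Longrightarrow> g \<in> V \<Longrightarrow> (\<lambda>x. f x + g x) \<in> V"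
    and scale_mem: "f \<in> V \<Longrightarrow> (\<lambda>x. c * f x) \<in> V"
    and ip_add: "f \<in> V \<Longrightarrow> g \<in> V \<Longrightarrow> h \<in> V \<Longrightarrow> ip (\<lambda>x. f x + g x) h = ip f h + ip g h"
    and ip_scale: "f \<in> V \<Longrightarrow> h \<in> V \<Longrightarrow> ip (\<lambda>x. c * f x) h = c * ip f h"
    and ip_cnj: "f \<in> V \<Longrightarrow> g \<in> V \<Longrightarrow> ip g f = cnj (ip f g)"
    and ip_self: "f \<in> V \<Longrightarrow> ip f f = of_real ((nrm f)\<^sup>2)"
    and nrm_nonneg: "0 \<le> nrm f"
    and nrm_eq_0: "f \<in> V \<Longrightarrow> nrm f = 0 \<Longrightarrow> f = (\<lambda>x. 0)"
    and complete: "(\<And>n. s n \<in> V) \<Longrightarrow> (\<And>e. e > 0 \<Longrightarrow> \<exists>N. \<forall>m\<ge>N. \<forall>n\<ge>N. nrm (\<lambda>x. s m x - s n x) < e) \<Longrightarrow>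
      \<exists>f\<in>V. (\<lambda>n. nrm (\<lambda>x. s n x - f x)) \<longlonglongrightarrow> 0"
begin

lemma diff_mem: "f \<in> V \<Longrightarrow> g \<in> V \<Longrightarrow> (\<lambda>x. f x - g x) \<in> V"
  using add_mem[OF _ scale_mem[of g "-1"], of f] by simp

lemma ip_diff: "f \<in> V \<Longrightarrow> g \<in> V \<Longrightarrow> h \<in> V \<Longrightarrow> ip (\<lambda>x. f x - g x) h = ip f h - ip g h"
  using ip_add[OF _ scale_mem[of g "-1"], of f h] ip_scale[of g h "-1"] by simp

lemma ip_add_right: "f \<in> V \<Longrightarrow> g \<in> V \<Longrightarrow> h \<in> V \<Longrightarrow> ip h (\<lambda>x. f x + g x) = ip h f + ip h g"
  using ip_add[of f g h] ip_cnj[of _ h] add_mem[of f g] by simp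

lemma ip_diff_right: "f \<in> V \<Longrightarrow> g \<in> V \<Longrightarrow> h \<in> V \<Longrightarrow> ip h (\<lambda>x. f x - g x) = ip h f - ip h g"
  using ip_diff[of f g h] ip_cnj[of _ h] diff_mem[of f g] by simp

lemma ip_scale_right: "f \<in> V \<Longrightarrow> h \<in> V \<Longrightarrow> ip h (\<lambda>x. c * f x) = cnj c * ip h f"
  using ip_scale[of f h c] ip_cnj[of _ h] scale_mem[of f c] by simp

lemma nrm_scale: "f \<in> V \<Longrightarrow> (nrm (\<lambda>x. c * f x))\<^sup>2 = (cmod c)\<^sup>2 * (nrm f)\<^sup>2"
proof -
  assume f: "f \<in> V"
  have "of_real ((nrm (\<lambda>x. c * f x))\<^sup>2) = ip (\<lambda>x. c * f x) (\<lambda>x. c * f x)"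
    by (rule ip_self[OF scale_mem[OF f], symmetric])
  also have "\<dots> = c * cnj c * ip f f"
    using f by (simp add: ip_scale ip_scale_right scale_mem)
  also have "\<dots> = of_real ((cmod c)\<^sup>2 * (nrm f)\<^sup>2)"
    unfolding ip_self[OF f] of_real_mult complex_norm_square ..
  finally show ?thesis by (simp only: of_real_eq_iff)
qed

lemma nrm_diff_expand:
  assumes "f \<in> V" "g \<in> V"
  shows "(nrm (\<lambda>x. f x - g x))\<^sup>2 = (nrm f)\<^sup>2 + (nrm g)\<^sup>2 - 2 * Re (ip f g)"
proof -
  have "complex_of_real ((nrm (\<lambda>x. f x - g x))\<^sup>2) = ip (\<lambda>x. f x - g x) (\<lambda>x. f x - g x)"
    by (rule ip_self[OF diff_mem[OF assms], symmetric])
  also have "\<dots> = ip f f + ip g g - (ip f g + ip g f)"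
    using assms by (simp add: diff_mem ip_diff ip_diff_right)
  also have "ip f g + ip g f = of_real (2 * Re (ip f g))"
    using assms ip_cnj[of f g] complex_add_cnj by simp
  finally have "complex_of_real ((nrm (\<lambda>x. f x - g x))\<^sup>2) =
      of_real ((nrm f)\<^sup>2 + (nrm g)\<^sup>2 - 2 * Re (ip f g))"
    using assms by (simp add: ip_self)
  then show ?thesis by (simp only: of_real_eq_iff)
qed

lemma nrm_add_expand:
  assumes "f \<in> V" "g \<in> V"
  shows "(nrm (\<lambda>x. f x + g x))\<^sup>2 = (nrm f)\<^sup>2 + (nrm g)\<^sup>2 + 2 * Re (ip f g)"
  using nrm_diff_expand[OF assms(1) scale_mem[OF assms(2), of "-1"]] nrm_scale[OF assms(2), of "-1"]
    ip_scale_right[OF assms(2,1), of "-1"] by simp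

lemma nrm_minus_commute:
  assumes "f \<in> V" "g \<in> V"
  shows "nrm (\<lambda>x. f x - g x) = nrm (\<lambda>x. g x - f x)"
proof (rule power2_eq_imp_eq)
  have "(\<lambda>x. - 1 * (g x - f x)) = (\<lambda>x. f x - g x)" by (simp add: fun_eq_iff)
  then show "(nrm (\<lambda>x. f x - g x))\<^sup>2 = (nrm (\<lambda>x. g x - f x))\<^sup>2"
    using nrm_scale[OF diff_mem[OF assms(2,1)], of "-1"] by simp
qed (rule nrm_nonneg)+

text \<open>If no translate of \<open>f\<close> along the line \<open>\<complex> g\<close> is shorter than \<open>sqrt d\<close>, then \<open>f\<close> is almost orthogonal
  to \<open>g\<close>; with \<open>d = 0\<close> this is the Cauchy--Schwarz inequality.\<close>

lemma ip_bound_of_distance: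
  assumes f: "f \<in> V" and g: "g \<in> V" and d: "\<And>c. d \<le> (nrm (\<lambda>x. f x - c * g x))\<^sup>2"
  shows "(cmod (ip f g))\<^sup>2 \<le> ((nrm f)\<^sup>2 - d) * (nrm g)\<^sup>2"
proof (cases "nrm g = 0")
  case True
  then have "g = (\<lambda>x. 0 * g x)" using nrm_eq_0[OF g] by auto
  then have "ip f g = 0" using ip_scale_right[OF g f, of 0] by simp
  then show ?thesis using True by simp
next
  case False
  \<comment> \<open>The coefficient of the orthogonal projection of \<open>f\<close> to the line
    spanned by \<open>g\<close>, which makes the distance smallest.\<close>
  define c where "c = ip f g / of_real ((nrm g)\<^sup>2)"
  have "cmod c = cmod (ip f g) / (nrm g)\<^sup>2"
    unfolding c_def norm_divide norm_of_real by simp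
  then have cc: "(cmod c)\<^sup>2 * (nrm g)\<^sup>2 = (cmod (ip f g))\<^sup>2 / (nrm g)\<^sup>2"
    using False by (simp add: power_divide power2_eq_square)
  have "cnj c * ip f g = (ip f g * cnj (ip f g)) / of_real ((nrm g)\<^sup>2)"
    by (simp add: c_def)
  also have "\<dots> = of_real ((cmod (ip f g))\<^sup>2 / (nrm g)\<^sup>2)"
    unfolding complex_norm_square[symmetric] of_real_divide ..
  finally have "cnj c * ip f g = of_real ((cmod (ip f g))\<^sup>2 / (nrm g)\<^sup>2)" .
  then have re: "Re (ip f (\<lambda>x. c * g x)) = (cmod (ip f g))\<^sup>2 / (nrm g)\<^sup>2"
    using f g by (simp add: ip_scale_right)
  have "d \<le> (nrm f)\<^sup>2 + (cmod (ip f g))\<^sup>2 / (nrm g)\<^sup>2 - 2 * ((cmod (ip f g))\<^sup>2 / (nrm g)\<^sup>2)"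
    using d[of c] nrm_diff_expand[OF f scale_mem[OF g, of c]] nrm_scale[OF g, of c] cc re by simp
  then have "(cmod (ip f g))\<^sup>2 / (nrm g)\<^sup>2 \<le> (nrm f)\<^sup>2 - d" by simp
  then show ?thesis using False by (simp add: field_simps)
qed

lemma cauchy_schwarz:
  assumes "f \<in> V" "g \<in> V"
  shows "cmod (ip f g) \<le> nrm f * nrm g"
proof (rule power2_le_imp_le)
  show "(cmod (ip f g))\<^sup>2 \<le> (nrm f * nrm g)\<^sup>2"
    using ip_bound_of_distance[OF assms, of 0] by (simp add: power_mult_distrib)
qed (simp add: nrm_nonneg)

lemma ip_tendsto:
  assumes "\<And>n. s n \<in> V" "p \<in> V" "g \<in> V" "(\<lambda>n. nrm (\<lambda>x. s n x - p x)) \<longlonglongrightarrow> 0"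
  shows "(\<lambda>n. ip g (s n)) \<longlonglongrightarrow> ip g p"
proof -
  have "(\<lambda>n. ip g (s n) - ip g p) \<longlonglongrightarrow> 0"
  proof (rule Lim_null_comparison)
    show "\<forall>\<^sub>F n in sequentially. norm (ip g (s n) - ip g p) \<le> nrm g * nrm (\<lambda>x. s n x - p x)"
      using cauchy_schwarz[OF assms(3) diff_mem[OF assms(1,2)]] assms by (simp add: ip_diff_right)
    show "(\<lambda>n. nrm g * nrm (\<lambda>x. s n x - p x)) \<longlonglongrightarrow> 0"
      using tendsto_mult_left[OF assms(4), of "nrm g"] by simp
  qed
  then show ?thesis by (rule LIM_zero_cancel)
qed

definition lin_subspace :: "('x \<Rightarrow> complex) set \<Rightarrow> bool" where
  "lin_subspace S \<longleftrightarrow> S \<subseteq> V \<and> (\<lambda>x. 0) \<in> S \<and> (\<forall>f\<in>S. \<forall>g\<in>S. (\<lambda>x. f x + g x) \<in> S) \<and> (\<forall>f\<in>S. \<forall>c. (\<lambda>x. c * f x) \<in> S)"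

text \<open>\<open>S\<close> need not be closed, so \<open>p\<close> is the nearest point of its
  closure, handed over with a sequence from \<open>S\<close> converging to it. A minimising sequence
  is Cauchy by the parallelogram law, since midpoints stay in \<open>S\<close>. Each of its errors
  is nearly orthogonal to \<open>S\<close> by \<open>ip_bound_of_distance\<close>, and the defect
  vanishes in the limit.\<close>

lemma projection:
  assumes S: "lin_subspace S" and h: "h \<in> V"
  shows "\<exists>p\<in>V. \<exists>s. (\<forall>n. s n \<in> S) \<and> (\<lambda>n. nrm (\<lambda>x. s n x - p x)) \<longlonglongrightarrow> 0 \<and>
    (\<forall>f\<in>S. ip f (\<lambda>x. h x - p x) = 0)"
proof -
  have SV: "f \<in> V" if "f \<in> S" for f using S that by (auto simp: lin_subspace_def)
  have S0: "(\<lambda>x. 0) \<in> S" and Sadd: "\<And>f g. f \<in> S \<Longrightarrow> g \<in> S \<Longrightarrow> (\<lambda>x. f x + g x) \<in> S"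
    and Sscale: "\<And>f c. f \<in> S \<Longrightarrow> (\<lambda>x. c * f x) \<in> S" using S by (auto simp: lin_subspace_def)
  let ?D = "(\<lambda>f. (nrm (\<lambda>x. h x - f x))\<^sup>2) ` S"
  define d where "d = Inf ?D"
  have bdd: "bdd_below ?D" by (rule bdd_belowI2[of _ 0]) simp
  have dle: "d \<le> (nrm (\<lambda>x. h x - f x))\<^sup>2" if "f \<in> S" for f
    unfolding d_def using bdd that by (intro cInf_lower) auto
  have "\<exists>f. f \<in> S \<and> (nrm (\<lambda>x. h x - f x))\<^sup>2 < d + 1 / real (Suc n)" for n
  proof -
    have "Inf ?D < d + 1 / real (Suc n)" by (simp add: d_def)
    then show ?thesis using cInf_lessD[of ?D] S0 by auto
  qed
  then obtain s where s: "\<And>n. s n \<in> S" "\<And>n. (nrm (\<lambda>x. h x - s n x))\<^sup>2 < d + 1 / real (Suc n)" by metis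
  let ?e = "\<lambda>n x. h x - s n x"
  have e: "?e n \<in> V" for n using diff_mem[OF h SV[OF s(1)]] .
  have close: "(nrm (\<lambda>x. s m x - s n x))\<^sup>2 \<le> 2 / real (Suc m) + 2 / real (Suc n)" for m n
  proof -
    have eq: "(\<lambda>x. ?e n x - ?e m x) = (\<lambda>x. s m x - s n x)" by (simp add: fun_eq_iff)
    have "(nrm (\<lambda>x. s m x - s n x))\<^sup>2 = (nrm (?e n))\<^sup>2 + (nrm (?e m))\<^sup>2 - 2 * Re (ip (?e n) (?e m))"
      using nrm_diff_expand[OF e[of n] e[of m]] unfolding eq .
    moreover have "(nrm (\<lambda>x. ?e n x + ?e m x))\<^sup>2 = (nrm (?e n))\<^sup>2 + (nrm (?e m))\<^sup>2 + 2 * Re (ip (?e n) (?e m))"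
      by (rule nrm_add_expand[OF e e])
    moreover have "4 * d \<le> (nrm (\<lambda>x. ?e n x + ?e m x))\<^sup>2"
    proof -
      let ?a = "\<lambda>x. (1 / 2) * (s n x + s m x)"
      have a: "?a \<in> S" by (intro Sscale Sadd s)
      have "(\<lambda>x. ?e n x + ?e m x) = (\<lambda>x. 2 * (h x - ?a x))" by (simp add: fun_eq_iff algebra_simps)
      then have "(nrm (\<lambda>x. ?e n x + ?e m x))\<^sup>2 = 4 * (nrm (\<lambda>x. h x - ?a x))\<^sup>2"
        using nrm_scale[OF diff_mem[OF h SV[OF a]], of 2] by simp
      then show ?thesis using dle[OF a] by simp
    qed
    ultimately have "(nrm (\<lambda>x. s m x - s n x))\<^sup>2 \<le> 2 * (nrm (?e n))\<^sup>2 + 2 * (nrm (?e m))\<^sup>2 - 4 * d" by linarith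
    then show ?thesis using s(2)[of n] s(2)[of m] by simp
  qed
  have "\<exists>p\<in>V. (\<lambda>n. nrm (\<lambda>x. s n x - p x)) \<longlonglongrightarrow> 0"
  proof (rule complete)
    show "s n \<in> V" for n by (rule SV[OF s(1)])
    fix \<epsilon> :: real assume \<epsilon>: "\<epsilon> > 0"
    obtain N where N: "4 / \<epsilon>\<^sup>2 < real N" using reals_Archimedean2 by blast
    have "nrm (\<lambda>x. s m x - s n x) < \<epsilon>" if "m \<ge> N" "n \<ge> N" for m n
    proof (rule power2_less_imp_less)
      have "4 / \<epsilon>\<^sup>2 > 0" using \<epsilon> by simp
      then have N0: "real N > 0" using N by linarith
      have "2 / real (Suc k) \<le> 2 / real N" if "k \<ge> N" for k
        using that N0 by (intro divide_left_mono) auto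
      from this[OF that(1)] this[OF that(2)] close[of m n]
      have "(nrm (\<lambda>x. s m x - s n x))\<^sup>2 \<le> 4 / real N" by simp
      also have "\<dots> < \<epsilon>\<^sup>2" using N N0 \<epsilon> by (simp add: field_simps)
      finally show "(nrm (\<lambda>x. s m x - s n x))\<^sup>2 < \<epsilon>\<^sup>2" .
    qed (use \<epsilon> in simp)
    then show "\<exists>N. \<forall>m\<ge>N. \<forall>n\<ge>N. nrm (\<lambda>x. s m x - s n x) < \<epsilon>" by blast
  qed
  then obtain p where p: "p \<in> V" "(\<lambda>n. nrm (\<lambda>x. s n x - p x)) \<longlonglongrightarrow> 0" by blast
  have "ip f (\<lambda>x. h x - p x) = 0" if f: "f \<in> S" for f
  proof -
    have "(\<lambda>n. ip f (?e n)) \<longlonglongrightarrow> ip f (\<lambda>x. h x - p x)"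
    proof (rule ip_tendsto[OF e diff_mem[OF h p(1)] SV[OF f]])
      show "(\<lambda>n. nrm (\<lambda>x. ?e n x - (h x - p x))) \<longlonglongrightarrow> 0"
        using p(2) nrm_minus_commute[OF SV[OF s(1)] p(1)] by simp
    qed
    moreover have "(\<lambda>n. ip f (?e n)) \<longlonglongrightarrow> 0"
    proof (rule Lim_null_comparison)
      have "norm (ip f (?e n)) \<le> sqrt (1 / real (Suc n)) * nrm f" for n
      proof (rule power2_le_imp_le)
        have "d \<le> (nrm (\<lambda>x. ?e n x - c * f x))\<^sup>2" for c
          using dle[OF Sadd[OF s(1) Sscale[OF f]], of n c] by (simp add: diff_diff_eq)
        then have "(cmod (ip (?e n) f))\<^sup>2 \<le> ((nrm (?e n))\<^sup>2 - d) * (nrm f)\<^sup>2"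
          by (rule ip_bound_of_distance[OF e SV[OF f]])
        also have "\<dots> \<le> (1 / real (Suc n)) * (nrm f)\<^sup>2"
          using s(2)[of n] by (intro mult_right_mono) auto
        finally show "(norm (ip f (?e n)))\<^sup>2 \<le> (sqrt (1 / real (Suc n)) * nrm f)\<^sup>2"
          using ip_cnj[OF e SV[OF f], of n] by (simp add: power_mult_distrib)
      qed (simp add: nrm_nonneg)
      then show "\<forall>\<^sub>F n in sequentially. norm (ip f (?e n)) \<le> sqrt (1 / real (Suc n)) * nrm f" by simp
      have "(\<lambda>n. sqrt (1 / real (Suc n)) * nrm f) \<longlonglongrightarrow> sqrt 0 * nrm f"
        by (intro tendsto_mult_right tendsto_real_sqrt LIMSEQ_Suc lim_const_over_n)
      then show "(\<lambda>n. sqrt (1 / real (Suc n)) * nrm f) \<longlonglongrightarrow> 0" by simp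
    qed
    ultimately show ?thesis by (rule LIMSEQ_unique)
  qed
  then show ?thesis using p s(1) by blast
qed

lemma eq_of_ip_eq:
  assumes "g \<in> V" "g' \<in> V" "\<And>f. f \<in> V \<Longrightarrow> ip f g = ip f g'"
  shows "g = g'"
proof -
  let ?d = "\<lambda>x. g x - g' x"
  have d: "?d \<in> V" using assms diff_mem by blast
  have "ip ?d ?d = 0" using assms d by (simp add: ip_diff_right)
  then have "nrm ?d = 0" using ip_self[OF d] by simp
  from nrm_eq_0[OF d this] show ?thesis by (simp add: fun_eq_iff)
qed

text \<open>Boundedness makes the kernel closed under norm limits, so the component \<open>e\<close>
  of some \<open>h\<close> orthogonal to the kernel is not itself in the kernel; every
  \<open>f\<close> is a multiple of \<open>e\<close> up to an element of the kernel.\<close>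

theorem riesz:
  assumes add: "\<And>f g. f \<in> V \<Longrightarrow> g \<in> V \<Longrightarrow> \<phi> (\<lambda>x. f x + g x) = \<phi> f + \<phi> g"
    and scale: "\<And>f c. f \<in> V \<Longrightarrow> \<phi> (\<lambda>x. c * f x) = c * \<phi> f"
    and bound: "\<And>f. f \<in> V \<Longrightarrow> cmod (\<phi> f) \<le> C * nrm f"
  shows "\<exists>!g. g \<in> V \<and> (\<forall>f\<in>V. ip f g = \<phi> f)"
proof (rule ex_ex1I)
  have diff: "\<phi> (\<lambda>x. f x - g x) = \<phi> f - \<phi> g" if "f \<in> V" "g \<in> V" for f g
    using add[OF that(1) scale_mem[OF that(2), of "-1"]] scale[OF that(2), of "-1"] by simp
  show "\<exists>g. g \<in> V \<and> (\<forall>f\<in>V. ip f g = \<phi> f)"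
  proof (cases "\<forall>f\<in>V. \<phi> f = 0")
    case True
    have "ip f (\<lambda>x. 0) = 0" if "f \<in> V" for f using ip_scale_right[OF zero_mem that, of 0] by simp
    then show ?thesis using True zero_mem by auto
  next
    case False
    then obtain h where h: "h \<in> V" "\<phi> h \<noteq> 0" by blast
    define S where "S = {f\<in>V. \<phi> f = 0}"
    have "\<phi> (\<lambda>x. 0) = 0" using scale[OF zero_mem, of 0] by simp
    then have "lin_subspace S"
      unfolding lin_subspace_def S_def by (auto simp: zero_mem add_mem scale_mem add scale)
    then obtain p and s :: "nat \<Rightarrow> _" where p: "p \<in> V" and s: "\<And>n. s n \<in> S"
      and lim: "(\<lambda>n. nrm (\<lambda>x. s n x - p x)) \<longlonglongrightarrow> 0"
      and orth: "\<And>f. f \<in> S \<Longrightarrow> ip f (\<lambda>x. h x - p x) = 0" using projection[OF _ h(1)] by blast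
    have sV: "s n \<in> V" "\<phi> (s n) = 0" for n using s by (auto simp: S_def)
    have "cmod (\<phi> p) \<le> C * nrm (\<lambda>x. s n x - p x)" for n
      using bound[OF diff_mem[OF sV(1) p]] diff[OF sV(1) p] sV(2) by simp
    moreover have "(\<lambda>n. C * nrm (\<lambda>x. s n x - p x)) \<longlonglongrightarrow> 0"
      using tendsto_mult_left[OF lim, of C] by simp
    ultimately have "cmod (\<phi> p) \<le> 0" by (intro LIMSEQ_le_const) auto
    then have \<phi>p: "\<phi> p = 0" by simp
    define e where "e = (\<lambda>x. h x - p x)"
    have e: "e \<in> V" unfolding e_def using h(1) p by (rule diff_mem)
    have \<phi>e: "\<phi> e \<noteq> 0" using diff[OF h(1) p] \<phi>p h(2) by (simp add: e_def)
    have "ip e e \<noteq> 0"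
    proof
      assume "ip e e = 0"
      then have "nrm e = 0" using ip_self[OF e] by simp
      then have "e = (\<lambda>x. 0 * e x)" using nrm_eq_0[OF e] by auto
      then have "\<phi> e = 0 * \<phi> e" using scale[OF e, of 0] by simp
      then show False using \<phi>e by simp
    qed
    \<comment> \<open>Conjugated because \<open>ip\<close> is conjugate-linear in its second
      argument; the value is forced by the case \<open>f = e\<close>.\<close>
    define c where "c = cnj (\<phi> e / ip e e)"
    have "ip f (\<lambda>x. c * e x) = \<phi> f" if f: "f \<in> V" for f
    proof -
      define a where "a = \<phi> f / \<phi> e"
      let ?k = "\<lambda>x. f x - a * e x"
      have "\<phi> ?k = 0"
        using diff[OF f scale_mem[OF e, of a]] scale[OF e, of a] \<phi>e by (simp add: a_def)
      then have "?k \<in> S" using diff_mem[OF f scale_mem[OF e, of a]] by (simp add: S_def)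
      then have "ip ?k e = 0" using orth unfolding e_def by blast
      then have "ip f e = a * ip e e"
        using ip_diff[OF f scale_mem[OF e, of a] e] ip_scale[OF e e, of a] by simp
      then show ?thesis
        unfolding ip_scale_right[OF e f] using \<phi>e \<open>ip e e \<noteq> 0\<close> by (simp add: c_def a_def)
    qed
    then show ?thesis using scale_mem[OF e] by blast
  qed
  show "g = g'" if "g \<in> V \<and> (\<forall>f\<in>V. ip f g = \<phi> f)" "g' \<in> V \<and> (\<forall>f\<in>V. ip f g' = \<phi> f)" for g g'
    by (rule eq_of_ip_eq) (use that in auto)
qed

text \<open>The residual \<open>h - p\<close> of the projection annihilates \<open>S\<close>, hence
  lies in \<open>W\<close> and is orthogonal to \<open>h\<close>. It is also orthogonal to
  \<open>p\<close>, a limit of members of \<open>S\<close>. So it is orthogonal to itself, and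
  \<open>h = p\<close> is approximated from \<open>S\<close>.\<close>

theorem dense_of_annihilator_subset:
  assumes S: "lin_subspace S"
    and ann: "\<And>f. f \<in> V \<Longrightarrow> (\<And>g. g \<in> S \<Longrightarrow> ip f g = 0) \<Longrightarrow> f \<in> W"
    and h: "h \<in> V" "\<And>f. f \<in> W \<Longrightarrow> ip f h = 0" and e: "\<epsilon> > 0"
  shows "\<exists>g\<in>S. nrm (\<lambda>x. h x - g x) < \<epsilon>"
proof -
  obtain p s where p: "p \<in> V" and s: "\<And>n. s n \<in> S" and lim: "(\<lambda>n. nrm (\<lambda>x. s n x - p x)) \<longlonglongrightarrow> 0"
    and orth: "\<And>f. f \<in> S \<Longrightarrow> ip f (\<lambda>x. h x - p x) = 0" using projection[OF S h(1)] by blast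
  have SV: "f \<in> V" if "f \<in> S" for f using S that by (auto simp: lin_subspace_def)
  let ?r = "\<lambda>x. h x - p x"
  have r: "?r \<in> V" using h(1) p by (rule diff_mem)
  have orth': "ip ?r g = 0" if "g \<in> S" for g using orth[OF that] ip_cnj[OF SV[OF that] r] by simp
  have "?r \<in> W" by (rule ann[OF r orth'])
  then have "ip ?r h = 0" by (rule h(2))
  moreover have "ip ?r p = 0"
    using ip_tendsto[OF SV[OF s] p r lim] orth'[OF s] by (simp add: LIMSEQ_const_iff)
  ultimately have "ip ?r ?r = 0" using ip_diff_right[OF h(1) p r] by simp
  then have "nrm ?r = 0" using ip_self[OF r] by simp
  from nrm_eq_0[OF r this] have hp: "h = p" by (simp add: fun_eq_iff)
  obtain n where "nrm (\<lambda>x. s n x - p x) < \<epsilon>"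
    using order_tendstoD(2)[OF lim e] unfolding eventually_sequentially by blast
  then show ?thesis using s[of n] nrm_minus_commute[OF SV[OF s] p, of n] hp by auto
qed

end

section \<open>Finitely supported functionals and the ideal\<close>

lemma finite_mi_size_le: "finite {\<alpha> :: 'n::finite \<Rightarrow> nat. mi_size \<alpha> \<le> k}"
proof (rule finite_subset)
  show "{\<alpha> :: 'n \<Rightarrow> nat. mi_size \<alpha> \<le> k} \<subseteq> PiE UNIV (\<lambda>_. {..k})"
  proof
    fix \<alpha> :: "'n \<Rightarrow> nat" assume "\<alpha> \<in> {\<alpha>. mi_size \<alpha> \<le> k}"
    moreover have "\<alpha> i \<le> mi_size \<alpha>" for i unfolding mi_size_def by (rule member_le_sum) auto
    ultimately show "\<alpha> \<in> PiE UNIV (\<lambda>_. {..k})" by (auto intro: order_trans)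
  qed
  show "finite (PiE (UNIV :: 'n set) (\<lambda>_. {..k}))" by (rule finite_PiE) auto
qed

lemma ell0_iff_finite_support: "\<xi> \<in> ell0 \<longleftrightarrow> finite {\<alpha>. \<xi> \<alpha> \<noteq> 0}"
proof
  assume "\<xi> \<in> ell0"
  then obtain k where "\<And>\<alpha>. mi_size \<alpha> > k \<Longrightarrow> \<xi> \<alpha> = 0" by (auto simp: ell0_def)
  then have "{\<alpha>. \<xi> \<alpha> \<noteq> 0} \<subseteq> {\<alpha>. mi_size \<alpha> \<le> k}" by (auto simp: not_less[symmetric])
  then show "finite {\<alpha>. \<xi> \<alpha> \<noteq> 0}" using finite_mi_size_le finite_subset by blast
next
  assume fin: "finite {\<alpha>. \<xi> \<alpha> \<noteq> 0}"
  have "\<xi> \<alpha> = 0" if "mi_size \<alpha> > Max (insert 0 (mi_size ` {\<alpha>. \<xi> \<alpha> \<noteq> 0}))" for \<alpha>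
  proof (rule ccontr)
    assume "\<xi> \<alpha> \<noteq> 0"
    then have "mi_size \<alpha> \<le> Max (insert 0 (mi_size ` {\<alpha>. \<xi> \<alpha> \<noteq> 0}))" using fin by (intro Max_ge) auto
    then show False using that by simp
  qed
  then show "\<xi> \<in> ell0" unfolding ell0_def by blast
qed

lemma ell0_subset_ell1: "ell0 \<subseteq> ell1"
proof
  fix \<xi> :: "('n::finite \<Rightarrow> nat) \<Rightarrow> complex" assume "\<xi> \<in> ell0"
  then have fin: "finite {\<alpha>. \<xi> \<alpha> \<noteq> 0}" by (simp add: ell0_iff_finite_support)
  have "(\<lambda>\<alpha>. cmod (\<xi> \<alpha>) * \<rho> ^ mi_size \<alpha>) summable_on UNIV" for \<rho>
  proof -
    have "(\<lambda>\<alpha>. cmod (\<xi> \<alpha>) * \<rho> ^ mi_size \<alpha>) summable_on {\<alpha>. \<xi> \<alpha> \<noteq> 0}" using fin by simp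
    then show ?thesis by (rule summable_on_cong_neutral[THEN iffD1, rotated -1]) auto
  qed
  then show "\<xi> \<in> ell1" by (simp add: ell1_def)
qed

lemma pairing0_finite:
  assumes "finite A" "\<And>\<alpha>. \<alpha> \<notin> A \<Longrightarrow> \<xi> \<alpha> = 0"
  shows "pairing0 \<xi> f = (\<Sum>\<alpha>\<in>A. \<xi> \<alpha> * taylor_coeff f \<alpha>)"
proof -
  have "pairing0 \<xi> f = (\<Sum>\<^sub>\<infinity>\<alpha>\<in>A. \<xi> \<alpha> * taylor_coeff f \<alpha>)"
    unfolding pairing0_def taylor_coeff_def by (rule infsum_cong_neutral) (auto simp: assms(2))
  then show ?thesis using assms(1) by simp
qed

lemma taylor_coeff_add:
  assumes "holomorphic_near_0 f" "holomorphic_near_0 g"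
  shows "taylor_coeff (\<lambda>z. f z + g z) \<alpha> = taylor_coeff f \<alpha> + taylor_coeff g \<alpha>"
proof -
  obtain s t where "power_series f (taylor_coeff f) s" "power_series g (taylor_coeff g) t"
    using holomorphic_imp_power_series assms by meson
  then have "power_series f (taylor_coeff f) (max s t)" "power_series g (taylor_coeff g) (max s t)"
    using power_series_mono by (meson max.cobounded1 max.cobounded2)+
  from taylor_coeff_eqI[OF power_series_add[OF this]] show ?thesis by simp
qed

lemma taylor_coeff_scale:
  assumes "holomorphic_near_0 f"
  shows "taylor_coeff (\<lambda>z. c * f z) \<alpha> = c * taylor_coeff f \<alpha>"
proof -
  obtain s where "power_series f (taylor_coeff f) s" using holomorphic_imp_power_series[OF assms] by blast
  from taylor_coeff_eqI[OF power_series_cmult[OF this]] show ?thesis by simp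
qed

lemma pairing0_add:
  assumes "\<xi> \<in> ell0" "holomorphic_near_0 f" "holomorphic_near_0 g"
  shows "pairing0 \<xi> (\<lambda>z. f z + g z) = pairing0 \<xi> f + pairing0 \<xi> g"
proof -
  have p: "pairing0 \<xi> h = (\<Sum>\<alpha> | \<xi> \<alpha> \<noteq> 0. \<xi> \<alpha> * taylor_coeff h \<alpha>)" for h
    using assms(1) by (intro pairing0_finite) (auto simp: ell0_iff_finite_support)
  show ?thesis
    by (simp add: p taylor_coeff_add[OF assms(2,3)] distrib_left sum.distrib)
qed

lemma pairing0_scale:
  assumes "\<xi> \<in> ell0" "holomorphic_near_0 f"
  shows "pairing0 \<xi> (\<lambda>z. c * f z) = c * pairing0 \<xi> f"
proof -
  have p: "pairing0 \<xi> h = (\<Sum>\<alpha> | \<xi> \<alpha> \<noteq> 0. \<xi> \<alpha> * taylor_coeff h \<alpha>)" for h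
    using assms(1) by (intro pairing0_finite) (auto simp: ell0_iff_finite_support)
  show ?thesis
    by (simp add: p taylor_coeff_scale[OF assms(2)] sum_distrib_left mult.left_commute)
qed

lemma ell0_add: "\<xi> \<in> ell0 \<Longrightarrow> \<eta> \<in> ell0 \<Longrightarrow> (\<lambda>\<alpha>. \<xi> \<alpha> + \<eta> \<alpha>) \<in> ell0"
  unfolding ell0_iff_finite_support
  by (rule finite_subset[of _ "{\<alpha>. \<xi> \<alpha> \<noteq> 0} \<union> {\<alpha>. \<eta> \<alpha> \<noteq> 0}"]) auto

lemma ell0_scale: "\<xi> \<in> ell0 \<Longrightarrow> (\<lambda>\<alpha>. c * \<xi> \<alpha>) \<in> ell0"
  unfolding ell0_iff_finite_support
  by (rule finite_subset[of _ "{\<alpha>. \<xi> \<alpha> \<noteq> 0}"]) auto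

lemma pairing0_add_left:
  assumes "\<xi> \<in> ell0" "\<eta> \<in> ell0"
  shows "pairing0 (\<lambda>\<alpha>. \<xi> \<alpha> + \<eta> \<alpha>) f = pairing0 \<xi> f + pairing0 \<eta> f"
proof -
  let ?A = "{\<alpha>. \<xi> \<alpha> \<noteq> 0} \<union> {\<alpha>. \<eta> \<alpha> \<noteq> 0}"
  have "finite ?A" using assms by (simp add: ell0_iff_finite_support)
  from pairing0_finite[OF this, of "\<lambda>\<alpha>. \<xi> \<alpha> + \<eta> \<alpha>" f] pairing0_finite[OF this, of \<xi> f] pairing0_finite[OF this, of \<eta> f]
  show ?thesis by (simp add: distrib_right sum.distrib)
qed

lemma pairing0_scale_left:
  assumes "\<xi> \<in> ell0"
  shows "pairing0 (\<lambda>\<alpha>. c * \<xi> \<alpha>) f = c * pairing0 \<xi> f"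
proof -
  have "finite {\<alpha>. \<xi> \<alpha> \<noteq> 0}" using assms by (simp add: ell0_iff_finite_support)
  from pairing0_finite[OF this, of "\<lambda>\<alpha>. c * \<xi> \<alpha>" f] pairing0_finite[OF this, of \<xi> f]
  show ?thesis by (simp add: sum_distrib_left mult.assoc)
qed

lemma germ_cong: "\<forall>\<^sub>F z in nhds 0. f z = g z \<Longrightarrow> germ f = germ g"
  unfolding germ_eq_Collect
  by (intro Collect_cong eventually_subst) (auto elim: eventually_mono)

lemma holomorphic_near_0_cong:
  assumes "holomorphic_near_0 f" "\<forall>\<^sub>F z in nhds 0. g z = f z"
  shows "holomorphic_near_0 g"
proof -
  have "(\<lambda>z. g z - f z) \<in> null0" using assms(2) by (auto simp: null0_def elim: eventually_mono)
  from holomorphic_near_0_add[OF assms(1) null0_imp_holomorphic_near_0[OF this]] show ?thesis by simp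
qed

text \<open>The set is the preimage of the ideal under the ring homomorphism \<open>germ\<close>,
  which identifies functions agreeing near the origin.\<close>

lemma holomorphic_ideal_of_germ_ideal:
  fixes I :: "(complex^'n \<Rightarrow> complex) set set"
  assumes I: "ideal I germ_ring"
  shows "holomorphic_ideal {f. holomorphic_near_0 f \<and> germ f \<in> I}"
proof -
  interpret I: ideal I germ_ring by (rule I)
  interpret N: ideal null0 "hol0_ring :: (complex^'n \<Rightarrow> complex) ring" by (rule ideal_null0)
  have hom: "germ \<in> ring_hom hol0_ring (germ_ring :: (complex^'n \<Rightarrow> complex) set ring)"
    using N.rcos_ring_hom unfolding germ_ring_def germ_def[abs_def] .
  have carr: "f \<in> carrier hol0_ring \<longleftrightarrow> holomorphic_near_0 f" for f :: "complex^'n \<Rightarrow> complex"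
    by (simp add: hol0_ring_def)
  have gadd: "germ (\<lambda>z. f z + g z) = germ f \<oplus>\<^bsub>germ_ring\<^esub> germ g" if "holomorphic_near_0 f" "holomorphic_near_0 g"
    for f g :: "complex^'n \<Rightarrow> complex"
    using ring_hom_add[OF hom, of f g] that by (simp add: carr) (simp add: hol0_ring_def)
  have gmult: "germ (\<lambda>z. f z * g z) = germ f \<otimes>\<^bsub>germ_ring\<^esub> germ g" if "holomorphic_near_0 f" "holomorphic_near_0 g"
    for f g :: "complex^'n \<Rightarrow> complex"
    using ring_hom_mult[OF hom, of f g] that by (simp add: carr) (simp add: hol0_ring_def)
  have gcarr: "germ f \<in> carrier germ_ring" if "holomorphic_near_0 f" for f :: "complex^'n \<Rightarrow> complex"
    using that by (simp add: carrier_germ_ring)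
  have g0: "germ (\<lambda>z :: complex^'n. 0) = \<zero>\<^bsub>germ_ring\<^esub>"
    using ring_hom_zero[OF hom cring.axioms(1)[OF cring_hol0_ring] cring.axioms(1)[OF cring_germ_ring]]
    by (simp add: hol0_ring_def)
  show ?thesis
  proof
    show "(\<lambda>z. 0) \<in> {f. holomorphic_near_0 f \<and> germ f \<in> I}"
      using I.zero_closed by (simp add: holomorphic_near_0_const g0)
  next
    fix f g :: "complex^'n \<Rightarrow> complex"
    assume "f \<in> {f. holomorphic_near_0 f \<and> germ f \<in> I}" "g \<in> {f. holomorphic_near_0 f \<and> germ f \<in> I}"
    then show "(\<lambda>z. f z + g z) \<in> {f. holomorphic_near_0 f \<and> germ f \<in> I}"
      by (simp add: holomorphic_near_0_add gadd I.a_closed)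
  next
    fix f h :: "complex^'n \<Rightarrow> complex"
    assume "f \<in> {f. holomorphic_near_0 f \<and> germ f \<in> I}" "holomorphic_near_0 h"
    then show "(\<lambda>z. h z * f z) \<in> {f. holomorphic_near_0 f \<and> germ f \<in> I}"
      by (simp add: holomorphic_near_0_mult gmult gcarr I.I_l_closed)
  next
    fix f g :: "complex^'n \<Rightarrow> complex"
    assume "f \<in> {f. holomorphic_near_0 f \<and> germ f \<in> I}" "\<forall>\<^sub>F z in nhds 0. g z = f z"
    then show "g \<in> {f. holomorphic_near_0 f \<and> germ f \<in> I}"
      using holomorphic_near_0_cong[of f g] germ_cong[of g f] by simp
  qed simp
qed

section \<open>Riesz representatives in the Bergman space\<close>

lemma hilbert_bergman:
  fixes D :: "(complex^'n) set"
  assumes D: "open D"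
  shows "hilbert_function_space (bergman D) (bergman_inner D) (bergman_norm D)"
proof
  show "(\<lambda>z. 0) \<in> bergman D" by (rule bergman_zero)
  show "(\<lambda>z. f z + g z) \<in> bergman D" if "f \<in> bergman D" "g \<in> bergman D" for f g
    by (rule bergman_add[OF D that])
  show "(\<lambda>z. c * f z) \<in> bergman D" if "f \<in> bergman D" for f c by (rule bergman_scale[OF that])
  show "bergman_inner D (\<lambda>z. f z + g z) h = bergman_inner D f h + bergman_inner D g h"
    if "f \<in> bergman D" "g \<in> bergman D" "h \<in> bergman D" for f g h
    using that bergman_integrable_product[OF D]
    by (simp add: bergman_inner_eq bergman_add[OF D] distrib_right)
  show "bergman_inner D (\<lambda>z. c * f z) h = c * bergman_inner D f h"
    if "f \<in> bergman D" "h \<in> bergman D" for f h c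
    using that by (simp add: bergman_inner_eq bergman_scale mult.assoc)
  show "bergman_inner D g f = cnj (bergman_inner D f g)" if "f \<in> bergman D" "g \<in> bergman D" for f g
  proof -
    have "(\<lambda>z. g z * cnj (f z)) = (\<lambda>z. cnj (f z * cnj (g z)))" by (simp add: fun_eq_iff mult.commute)
    then show ?thesis using that by (simp only: bergman_inner_eq Bochner_Integration.integral_cnj)
  qed
  show "bergman_inner D f f = of_real ((bergman_norm D f)\<^sup>2)" if "f \<in> bergman D" for f
    by (rule bergman_norm_eq_inner[OF that])
  show "0 \<le> bergman_norm D f" for f by (rule bergman_norm_nonneg)
  show "f = (\<lambda>z. 0)" if f: "f \<in> bergman D" "bergman_norm D f = 0" for f
  proof
    fix z
    show "f z = 0"
    proof (cases "z \<in> D")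
      case True
      then obtain r where "r > 0" "cball z r \<subseteq> D" using D unfolding open_contains_cball by metis
      from bergman_pointwise_bound[OF D f(1) this] show ?thesis using f(2) by simp
    qed (use f(1) in \<open>simp add: bergman_iff\<close>)
  qed
  show "\<exists>f\<in>bergman D. (\<lambda>n. bergman_norm D (\<lambda>z. s n z - f z)) \<longlonglongrightarrow> 0"
    if "\<And>n. s n \<in> bergman D" "\<And>e. e > 0 \<Longrightarrow> \<exists>N. \<forall>m\<ge>N. \<forall>n\<ge>N. bergman_norm D (\<lambda>z. s m z - s n z) < e" for s
    by (rule bergman_complete[OF D that])
qed

lemma bergman_holomorphic_near_0: "open D \<Longrightarrow> 0 \<in> D \<Longrightarrow> f \<in> bergman D \<Longrightarrow> holomorphic_near_0 f"
  unfolding holomorphic_near_0_def bergman_iff by blast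

text \<open>The norm bounds \<open>f\<close> uniformly on a small polydisc about the origin, and
  Cauchy's estimate passes from there to each coefficient.\<close>

lemma taylor_coeff_bergman_bound:
  fixes D :: "(complex^'n) set"
  assumes D: "open D" "0 \<in> D"
  shows "\<exists>C. \<forall>f\<in>bergman D. cmod (taylor_coeff f \<alpha>) \<le> C * bergman_norm D f"
proof -
  obtain r0 where r0: "r0 > 0" "cball 0 r0 \<subseteq> D" using D unfolding open_contains_cball by metis
  define r where "r = r0 / 2"
  have r: "r > 0" using r0 by (simp add: r_def)
  have sub: "cball z r \<subseteq> D" if "z \<in> ball 0 r" for z
  proof
    fix y assume "y \<in> cball z r"
    then have "y \<in> cball 0 r0" using that dist_triangle[of 0 y z] by (simp add: r_def)
    then show "y \<in> D" using r0 by blast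
  qed
  obtain R where R: "R > 0" "polydisc R \<subseteq> ball (0 :: complex^'n) r"
    using polydisc_subset_open[of "ball (0 :: complex^'n) r"] r by auto
  have "polydisc R \<subseteq> D" using R(2) sub r by fastforce
  then have "cmod (taylor_coeff f \<alpha>) \<le> (bergman_norm D f / sqrt (measure lborel (ball (0 :: complex^'n) r))) / R ^ mi_size \<alpha>"
    if f: "f \<in> bergman D" for f
    using f bergman_pointwise_bound[OF D(1) f r sub] R
    by (intro taylor_coeff_bound[OF _ D(1) R(1)]) (auto simp: bergman_iff)
  then show ?thesis
    by (intro exI[of _ "1 / sqrt (measure lborel (ball (0 :: complex^'n) r)) / R ^ mi_size \<alpha>"]) simp
qed

lemma pairing0_bergman_bound:
  fixes D :: "(complex^'n) set"
  assumes D: "open D" "0 \<in> D" and \<xi>: "\<xi> \<in> ell0"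
  shows "\<exists>C. \<forall>f\<in>bergman D. cmod (pairing0 \<xi> f) \<le> C * bergman_norm D f"
proof -
  have fin: "finite {\<alpha>. \<xi> \<alpha> \<noteq> 0}" using \<xi> by (simp add: ell0_iff_finite_support)
  obtain C where C: "\<And>\<alpha> f. f \<in> bergman D \<Longrightarrow> cmod (taylor_coeff f \<alpha>) \<le> C \<alpha> * bergman_norm D f"
    using taylor_coeff_bergman_bound[OF D] by metis
  have "cmod (pairing0 \<xi> f) \<le> (\<Sum>\<alpha> | \<xi> \<alpha> \<noteq> 0. cmod (\<xi> \<alpha>) * C \<alpha>) * bergman_norm D f" if f: "f \<in> bergman D" for f
  proof -
    have "cmod (pairing0 \<xi> f) \<le> (\<Sum>\<alpha> | \<xi> \<alpha> \<noteq> 0. cmod (\<xi> \<alpha> * taylor_coeff f \<alpha>))"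
      using pairing0_finite[OF fin, of \<xi> f] by (simp add: norm_sum)
    also have "\<dots> \<le> (\<Sum>\<alpha> | \<xi> \<alpha> \<noteq> 0. cmod (\<xi> \<alpha>) * (C \<alpha> * bergman_norm D f))"
      unfolding norm_mult by (intro sum_mono mult_left_mono C f) simp
    finally show ?thesis by (simp add: sum_distrib_right mult.assoc)
  qed
  then show ?thesis by blast
qed

text \<open>\<open>riesz_rep\<close> is a definite description, so existence and uniqueness must
  precede any use of it.\<close>

lemma riesz_rep_unique_existence:
  fixes D :: "(complex^'n) set"
  assumes D: "open D" "0 \<in> D" and \<xi>: "\<xi> \<in> ell0"
  shows "\<exists>!g. g \<in> bergman D \<and> (\<forall>f\<in>bergman D. bergman_inner D f g = pairing0 \<xi> f)"
proof -
  interpret hilbert_function_space "bergman D" "bergman_inner D" "bergman_norm D" by (rule hilbert_bergman[OF D(1)])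
  obtain C where "\<And>f. f \<in> bergman D \<Longrightarrow> cmod (pairing0 \<xi> f) \<le> C * bergman_norm D f"
    using pairing0_bergman_bound[OF D \<xi>] by blast
  then show ?thesis
    by (intro riesz pairing0_add pairing0_scale \<xi> bergman_holomorphic_near_0[OF D])
qed

lemma riesz_rep_props:
  fixes D :: "(complex^'n) set"
  assumes "open D" "0 \<in> D" "\<xi> \<in> ell0"
  shows "riesz_rep D \<xi> \<in> bergman D"
    and "f \<in> bergman D \<Longrightarrow> bergman_inner D f (riesz_rep D \<xi>) = pairing0 \<xi> f"
  using theI'[OF riesz_rep_unique_existence[OF assms]] unfolding riesz_rep_def by blast+

lemma riesz_rep_eqI:
  fixes D :: "(complex^'n) set"
  assumes "open D" "0 \<in> D" "\<xi> \<in> ell0"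
    and "g \<in> bergman D" "\<And>f. f \<in> bergman D \<Longrightarrow> bergman_inner D f g = pairing0 \<xi> f"
  shows "riesz_rep D \<xi> = g"
  using riesz_rep_unique_existence[OF assms(1-3)] riesz_rep_props[OF assms(1-3)] assms(4,5) by blast

theorem corollary1p8:
  fixes D :: "(complex^'n) set" and I :: "(complex^'n \<Rightarrow> complex) set set"
  assumes "open D" and "connected D" and "0 \<in> D"
    and "ideal I germ_ring"
  shows "bergman_dense_in D (riesz_rep D ` (ell_tilde I \<inter> ell0))
           (bergman_orth D (bergman_ideal D I))"
proof -
  note D = \<open>open D\<close> \<open>0 \<in> D\<close>
  interpret H: hilbert_function_space "bergman D" "bergman_inner D" "bergman_norm D" by (rule hilbert_bergman[OF D(1)])
  define J where "J = {f. holomorphic_near_0 f \<and> germ f \<in> I}"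
  interpret J: holomorphic_ideal J
    unfolding J_def by (rule holomorphic_ideal_of_germ_ideal[OF \<open>ideal I germ_ring\<close>])
  let ?E = "ell_tilde I \<inter> ell0" and ?T = "riesz_rep D"
  have hol: "holomorphic_near_0 f" if "f \<in> bergman D" for f by (rule bergman_holomorphic_near_0[OF D that])
  have E: "\<xi> \<in> ?E \<longleftrightarrow> \<xi> \<in> ell0 \<and> (\<forall>f\<in>J. pairing0 \<xi> f = 0)" for \<xi>
    using ell0_subset_ell1 by (auto simp: ell_tilde_def J_def)
  have TB: "?T \<xi> \<in> bergman D" if "\<xi> \<in> ?E" for \<xi> using riesz_rep_props(1)[OF D] that by blast
  have T: "bergman_inner D f (?T \<xi>) = pairing0 \<xi> f" if "\<xi> \<in> ?E" "f \<in> bergman D" for \<xi> f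
    using riesz_rep_props(2)[OF D] that by blast
  have "H.lin_subspace (?T ` ?E)"
    unfolding H.lin_subspace_def
  proof (intro conjI ballI allI)
    show "?T ` ?E \<subseteq> bergman D" using TB by blast
    define \<zeta> where "\<zeta> = (\<lambda>\<alpha> :: 'n \<Rightarrow> nat. 0 :: complex)"
    have z: "\<zeta> \<in> ?E"
      unfolding E by (auto simp: ell0_def pairing0_def \<zeta>_def)
    have "?T \<zeta> = (\<lambda>z. 0)"
    proof (rule riesz_rep_eqI[OF D _ bergman_zero])
      show "\<zeta> \<in> ell0" using z by blast
      show "bergman_inner D f (\<lambda>z. 0) = pairing0 \<zeta> f" for f
        by (simp add: bergman_inner_def pairing0_def set_lebesgue_integral_def \<zeta>_def)
    qed
    then show "(\<lambda>z. 0) \<in> ?T ` ?E" using z by (metis image_eqI)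
  next
    fix f g assume "f \<in> ?T ` ?E" "g \<in> ?T ` ?E"
    then obtain \<xi> \<eta> where \<xi>: "\<xi> \<in> ?E" "f = ?T \<xi>" and \<eta>: "\<eta> \<in> ?E" "g = ?T \<eta>" by blast
    have s: "(\<lambda>\<alpha>. \<xi> \<alpha> + \<eta> \<alpha>) \<in> ?E"
      using \<xi>(1) \<eta>(1) unfolding E by (auto simp: ell0_add pairing0_add_left)
    have "?T (\<lambda>\<alpha>. \<xi> \<alpha> + \<eta> \<alpha>) = (\<lambda>z. ?T \<xi> z + ?T \<eta> z)"
    proof (rule riesz_rep_eqI[OF D])
      show "(\<lambda>\<alpha>. \<xi> \<alpha> + \<eta> \<alpha>) \<in> ell0" using s by blast
      show "(\<lambda>z. ?T \<xi> z + ?T \<eta> z) \<in> bergman D" using TB \<xi> \<eta> H.add_mem by blast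
      show "bergman_inner D h (\<lambda>z. ?T \<xi> z + ?T \<eta> z) = pairing0 (\<lambda>\<alpha>. \<xi> \<alpha> + \<eta> \<alpha>) h" if "h \<in> bergman D" for h
        using H.ip_add_right[OF TB[OF \<xi>(1)] TB[OF \<eta>(1)] that] T[OF \<xi>(1) that] T[OF \<eta>(1) that]
          pairing0_add_left[of \<xi> \<eta> h] \<xi>(1) \<eta>(1) by simp
    qed
    then show "(\<lambda>z. f z + g z) \<in> ?T ` ?E" using s \<xi>(2) \<eta>(2) by (metis image_eqI)
  next
    fix f c assume "f \<in> ?T ` ?E"
    then obtain \<xi> where \<xi>: "\<xi> \<in> ?E" "f = ?T \<xi>" by blast
    \<comment> \<open>The representative depends conjugate-linearly on the functional, hence the
      conjugate.\<close>
    have s: "(\<lambda>\<alpha>. cnj c * \<xi> \<alpha>) \<in> ?E"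
      using \<xi>(1) unfolding E by (auto simp: ell0_scale pairing0_scale_left)
    have "?T (\<lambda>\<alpha>. cnj c * \<xi> \<alpha>) = (\<lambda>z. c * ?T \<xi> z)"
    proof (rule riesz_rep_eqI[OF D])
      show "(\<lambda>\<alpha>. cnj c * \<xi> \<alpha>) \<in> ell0" using s by blast
      show "(\<lambda>z. c * ?T \<xi> z) \<in> bergman D" using TB \<xi> H.scale_mem by blast
      show "bergman_inner D h (\<lambda>z. c * ?T \<xi> z) = pairing0 (\<lambda>\<alpha>. cnj c * \<xi> \<alpha>) h" if "h \<in> bergman D" for h
        using H.ip_scale_right[OF TB[OF \<xi>(1)] that] T[OF \<xi>(1) that]
          pairing0_scale_left[of \<xi> "cnj c" h] \<xi>(1) by simp
    qed
    then show "(\<lambda>z. c * f z) \<in> ?T ` ?E" using s \<xi>(2) by (metis image_eqI)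
  qed
  note subspace = this
  have ideal: "f \<in> bergman_ideal D I \<longleftrightarrow> f \<in> bergman D \<and> f \<in> J" for f
    using hol by (auto simp: bergman_ideal_def J_def)
  show ?thesis
    unfolding bergman_dense_in_def
  proof (intro conjI ballI allI impI)
    show "?T ` ?E \<subseteq> bergman_orth D (bergman_ideal D I)"
    proof
      fix g assume "g \<in> ?T ` ?E"
      then obtain \<xi> where \<xi>: "\<xi> \<in> ?E" "g = ?T \<xi>" by blast
      have "bergman_inner D f g = 0" if "f \<in> bergman_ideal D I" for f
        using that T[OF \<xi>(1), of f] \<xi> unfolding ideal E by simp
      then show "g \<in> bergman_orth D (bergman_ideal D I)"
        using TB[OF \<xi>(1)] \<xi>(2) by (simp add: bergman_orth_def)
    qed
  next
    fix h and \<epsilon> :: real assume h: "h \<in> bergman_orth D (bergman_ideal D I)" and \<epsilon>: "0 < \<epsilon>"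
    obtain \<Xi> where \<Xi>: "\<forall>\<xi>\<in>\<Xi>. finite {\<alpha>. \<xi> \<alpha> \<noteq> 0}"
      and sep: "\<forall>f. holomorphic_near_0 f \<longrightarrow> (f \<in> J \<longleftrightarrow> (\<forall>\<xi>\<in>\<Xi>. (\<Sum>\<^sub>\<infinity>\<alpha>. \<xi> \<alpha> * taylor_coeff f \<alpha>) = 0))"
      using J.separation by auto
    have sep': "f \<in> J \<longleftrightarrow> (\<forall>\<xi>\<in>\<Xi>. pairing0 \<xi> f = 0)" if "holomorphic_near_0 f" for f
      using sep that by (simp add: pairing0_def taylor_coeff_def)
    \<comment> \<open>Both directions of the separation are used: here that members of
      \<open>J\<close> are killed, which makes every such \<xi> admissible; below that being killed
      by all of them forces membership in \<open>J\<close>.\<close>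
    have \<Xi>E: "\<xi> \<in> ?E" if "\<xi> \<in> \<Xi>" for \<xi>
      unfolding E ell0_iff_finite_support using \<Xi> sep' J.hol that by blast
    show "\<exists>g\<in>?T ` ?E. bergman_norm D (\<lambda>z. h z - g z) < \<epsilon>"
    proof (rule H.dense_of_annihilator_subset[OF subspace, where W = "bergman_ideal D I"])
      show "f \<in> bergman_ideal D I" if f: "f \<in> bergman D" "\<And>g. g \<in> ?T ` ?E \<Longrightarrow> bergman_inner D f g = 0" for f
      proof -
        have "pairing0 \<xi> f = 0" if "\<xi> \<in> \<Xi>" for \<xi>
          using T[OF \<Xi>E[OF that] f(1)] f(2) \<Xi>E[OF that] by simp
        then show ?thesis using f(1) sep'[OF hol[OF f(1)]] unfolding ideal by blast
      qed
    qed (use h \<epsilon> in \<open>auto simp: bergman_orth_def\<close>)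
  qed
qed

end
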